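(* Let $A,C,W_1,W_2$ satisfy the standing assumptions of the context, and suppose that $\mathsf K\in\mathcal K_{\mathrm{info}}$. Then, for any symmetric matrix $Y\in\mathbb R^{2n\times 2n}$, the solution $\Sigma_{\mathsf K,Y}$ to the Lyapunov equation $A_{\mathrm{cl},\mathsf K}\Sigma_{\mathsf K,Y}+\Sigma_{\mathsf K,Y}A_{\mathrm{cl},\mathsf K}^\top+Y=0$ satisfies $$\|\Sigma_{\mathsf K,Y}\|_\circ\le C_{\mathrm{lyap}}(\mathsf K)\cdot\|Y\|_\circ,\qquad C_{\mathrm{lyap}}(\mathsf K)=\mathrm{poly}_{\mathrm{op}}\big(\Sigma_{\mathsf K},\Sigma_{\mathsf K}^{-1},Z_{\mathsf K}^{-1},W_1^{-1},W_2^{-1},C\big),$$ where $\|\cdot\|_\circ$ denotes either the operator, Frobenius, or nuclear norm.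
   Context: Let $n,m,p\ge 1$, $A\in\mathbb R^{n\times n}$, $C\in\mathbb R^{m\times n}$, $G\in\mathbb R^{p\times n}$, $W_1\in\mathbb R^{n\times n}$ and $W_2\in\mathbb R^{m\times m}$ symmetric. A filter is a triple $\mathsf K=(A_{\mathsf K},B_{\mathsf K},C_{\mathsf K})\in\mathbb R^{n\times n}\times\mathbb R^{n\times m}\times\mathbb R^{p\times n}$. $\mathcal K_{\mathrm{stab}}$ is the set of $\mathsf K$ with $A_{\mathsf K}$ Hurwitz stable. For $\mathsf K\in\mathcal K_{\mathrm{stab}}$, $\Sigma_{\mathsf K}\in\mathbb R^{2n\times 2n}$ is the unique solution of $$A_{\mathrm{cl},\mathsf K}\Sigma+\Sigma A_{\mathrm{cl},\mathsf K}^\top+W_{\mathrm{cl},\mathsf K}=0,\quad A_{\mathrm{cl},\mathsf K}=\begin{bmatrix}A&0\\ B_{\mathsf K}C&A_{\mathsf K}\end{bmatrix},\quad W_{\mathrm{cl},\mathsf K}=\begin{bmatrix}W_1&0\\0&B_{\mathsf K}W_2B_{\mathsf K}^\top\end{bmatrix},$$ partitioned into $n\times n$ blocks $\Sigma_{\mathsf K}=\begin{bmatrix}\Sigma_{11,\mathrm{sys}}&\Sigma_{12,\mathsf K}\\ \Sigma_{12,\mathsf K}^\top&\Sigma_{22,\mathsf K}\end{bmatrix}$. Put $\mathcal K_{\mathrm{info}}=\{\mathsf K\in\mathcal K_{\mathrm{stab}}:\mathrm{rank}(\Sigma_{12,\mathsf K})=n\}$; on this set $\Sigma_{\mathsf K}\succ0$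 and $Z_{\mathsf K}:=\Sigma_{12,\mathsf K}\Sigma_{22,\mathsf K}^{-1}\Sigma_{12,\mathsf K}^\top\succ0$. Standing assumptions: $A$ is Hurwitz stable; $(A,C)$ is observable; $W_1\succ0$ and $W_2\succ0$; and the optimal filter is controllable, i.e. with $P_\star$ the (positive semidefinite, stabilizing) solution of $AP_\star+P_\star A^\top-P_\star C^\top W_2^{-1}CP_\star+W_1=0$ and $L_\star=P_\star C^\top W_2^{-1}$, the pair $(A-L_\star C,L_\star)$ is controllable. $\mathrm{poly}_{\mathrm{op}}(X_1,X_2,\dots)$ denotes a term bounded by a universal polynomial in the operator norms $\|X_1\|,\|X_2\|,\dots$. *)

theory Defs
  imports
    "HOL-Analysis.Weierstrass_Theorems"
    "Jordan_Normal_Form.Char_Poly"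
    "Jordan_Normal_Form.Gauss_Jordan_Elimination"
    "Jordan_Normal_Form.DL_Rank"
begin

text \<open>
  Matrices are those of \<^theory>\<open>Jordan_Normal_Form.Matrix\<close>, whose dimensions are natural numbers:
  the bound of the main result is given by one polynomial for all dimensions, so the dimensions
  have to be quantified inside the scope of an existential quantifier.
\<close>

no_notation inner (infix \<open>\<bullet>\<close> 70)

definition hurwitz :: "real mat \<Rightarrow> bool" where
  "hurwitz A \<longleftrightarrow> (\<forall>z. eigenvalue (map_mat complex_of_real A) z \<longrightarrow> Re z < 0)"

definition symmetric_mat :: "nat \<Rightarrow> real mat \<Rightarrow> bool" where
  "symmetric_mat n X \<longleftrightarrow> X \<in> carrier_mat n n \<and> X\<^sup>T = X"

definition pos_semidef :: "nat \<Rightarrow> real mat \<Rightarrow> bool" where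
  "pos_semidef n X \<longleftrightarrow> symmetric_mat n X \<and> (\<forall>v \<in> carrier_vec n. 0 \<le> v \<bullet> (X *\<^sub>v v))"

definition pos_def :: "nat \<Rightarrow> real mat \<Rightarrow> bool" where
  "pos_def n X \<longleftrightarrow>
     symmetric_mat n X \<and> (\<forall>v \<in> carrier_vec n. v \<noteq> 0\<^sub>v n \<longrightarrow> 0 < v \<bullet> (X *\<^sub>v v))"

text \<open>Only meaningful for invertible matrices.\<close>

definition mat_inv :: "real mat \<Rightarrow> real mat" where
  "mat_inv X = the (mat_inverse X)"

text \<open>The block row \<open>[B, A B, \<dots>, A^(n-1) B]\<close>, with \<open>A\<close> of size \<open>n \<times> n\<close> and \<open>B\<close> of size \<open>n \<times> m\<close>.\<close>

definition controllability_mat :: "nat \<Rightarrow> nat \<Rightarrow> real mat \<Rightarrow> real mat \<Rightarrow> real mat" where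
  "controllability_mat n m A B =
     mat n (n * m) (\<lambda>(i, j). ((A ^\<^sub>m (j div m)) * B) $$ (i, j mod m))"

text \<open>The block column with blocks \<open>C, C A, \<dots>, C A^(n-1)\<close>, with \<open>C\<close> of size \<open>m \<times> n\<close>.\<close>

definition observability_mat :: "nat \<Rightarrow> nat \<Rightarrow> real mat \<Rightarrow> real mat \<Rightarrow> real mat" where
  "observability_mat n m A C =
     mat (n * m) n (\<lambda>(i, j). (C * (A ^\<^sub>m (i div m))) $$ (i mod m, j))"

text \<open>The first argument of \<^const>\<open>vec_space.rank\<close> is the number of rows.\<close>

definition controllable :: "nat \<Rightarrow> nat \<Rightarrow> real mat \<Rightarrow> real mat \<Rightarrow> bool" where
  "controllable n m A B \<longleftrightarrow> vec_space.rank n (controllability_mat n m A B) = n"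

definition observable :: "nat \<Rightarrow> nat \<Rightarrow> real mat \<Rightarrow> real mat \<Rightarrow> bool" where
  "observable n m A C \<longleftrightarrow> vec_space.rank (n * m) (observability_mat n m A C) = n"


definition eucl_norm :: "real vec \<Rightarrow> real" where
  "eucl_norm v = sqrt (v \<bullet> v)"

definition op_norm :: "real mat \<Rightarrow> real" where
  "op_norm X = Sup {eucl_norm (X *\<^sub>v v) | v. v \<in> carrier_vec (dim_col X) \<and> eucl_norm v = 1}"

definition frobenius_norm :: "real mat \<Rightarrow> real" where
  "frobenius_norm X = sqrt (\<Sum>i < dim_row X. \<Sum>j < dim_col X. (X $$ (i, j))\<^sup>2)"

text \<open>
  The sum of the singular values, that is, of the square roots of the eigenvalues of \<open>X\<^sup>T X\<close>
  counted with multiplicity.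
\<close>

definition nuclear_norm :: "real mat \<Rightarrow> real" where
  "nuclear_norm X =
     (let p = char_poly (X\<^sup>T * X) in \<Sum>l | poly p l = 0. real (Polynomial.order l p) * sqrt l)"


definition is_lyap_sol :: "real mat \<Rightarrow> real mat \<Rightarrow> real mat \<Rightarrow> bool" where
  "is_lyap_sol M Y S \<longleftrightarrow>
     S \<in> carrier_mat (dim_row M) (dim_row M) \<and>
     M * S + S * M\<^sup>T + Y = 0\<^sub>m (dim_row M) (dim_row M)"

definition lyap_sol :: "real mat \<Rightarrow> real mat \<Rightarrow> real mat" where
  "lyap_sol M Y = (THE S. is_lyap_sol M Y S)"

text \<open>A filter is a triple \<open>(A\<^sub>K, B\<^sub>K, C\<^sub>K)\<close>.\<close>

type_synonym filt = "real mat \<times> real mat \<times> real mat"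

definition K_stab :: "nat \<Rightarrow> nat \<Rightarrow> nat \<Rightarrow> filt set" where
  "K_stab n m p =
     {(AK, BK, CK). AK \<in> carrier_mat n n \<and> BK \<in> carrier_mat n m \<and> CK \<in> carrier_mat p n \<and>
                    hurwitz AK}"

definition A_cl :: "nat \<Rightarrow> real mat \<Rightarrow> real mat \<Rightarrow> filt \<Rightarrow> real mat" where
  "A_cl n A C = (\<lambda>(AK, BK, CK). four_block_mat A (0\<^sub>m n n) (BK * C) AK)"

definition W_cl :: "nat \<Rightarrow> real mat \<Rightarrow> real mat \<Rightarrow> filt \<Rightarrow> real mat" where
  "W_cl n W1 W2 = (\<lambda>(AK, BK, CK). four_block_mat W1 (0\<^sub>m n n) (0\<^sub>m n n) (BK * W2 * BK\<^sup>T))"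

definition Sigma_K ::
  "nat \<Rightarrow> real mat \<Rightarrow> real mat \<Rightarrow> real mat \<Rightarrow> real mat \<Rightarrow> filt \<Rightarrow> real mat" where
  "Sigma_K n A C W1 W2 K = lyap_sol (A_cl n A C K) (W_cl n W1 W2 K)"

definition Sigma12_K ::
  "nat \<Rightarrow> real mat \<Rightarrow> real mat \<Rightarrow> real mat \<Rightarrow> real mat \<Rightarrow> filt \<Rightarrow> real mat" where
  "Sigma12_K n A C W1 W2 K = mat n n (\<lambda>(i, j). Sigma_K n A C W1 W2 K $$ (i, n + j))"

definition Sigma22_K ::
  "nat \<Rightarrow> real mat \<Rightarrow> real mat \<Rightarrow> real mat \<Rightarrow> real mat \<Rightarrow> filt \<Rightarrow> real mat" where
  "Sigma22_K n A C W1 W2 K = mat n n (\<lambda>(i, j). Sigma_K n A C W1 W2 K $$ (n + i, n + j))"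

definition Z_K ::
  "nat \<Rightarrow> real mat \<Rightarrow> real mat \<Rightarrow> real mat \<Rightarrow> real mat \<Rightarrow> filt \<Rightarrow> real mat" where
  "Z_K n A C W1 W2 K =
     Sigma12_K n A C W1 W2 K * mat_inv (Sigma22_K n A C W1 W2 K) * (Sigma12_K n A C W1 W2 K)\<^sup>T"

definition K_info ::
  "nat \<Rightarrow> nat \<Rightarrow> nat \<Rightarrow> real mat \<Rightarrow> real mat \<Rightarrow> real mat \<Rightarrow> real mat \<Rightarrow> filt set" where
  "K_info n m p A C W1 W2 =
     {K \<in> K_stab n m p. vec_space.rank n (Sigma12_K n A C W1 W2 K) = n}"

text \<open>
  The Riccati equation has at most one stabilizing solution \<open>P\<close>, so the existential quantifier
  below refers to the solution that defines the optimal gain \<open>L = P C\<^sup>T W\<^sub>2\<^sup>-\<^sup>1\<close>.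
\<close>

definition optimal_filter_controllable ::
  "nat \<Rightarrow> nat \<Rightarrow> real mat \<Rightarrow> real mat \<Rightarrow> real mat \<Rightarrow> real mat \<Rightarrow> bool" where
  "optimal_filter_controllable n m A C W1 W2 \<longleftrightarrow>
     (\<exists>P. pos_semidef n P \<and>
          A * P + P * A\<^sup>T - P * C\<^sup>T * mat_inv W2 * C * P + W1 = 0\<^sub>m n n \<and>
          (let L = P * C\<^sup>T * mat_inv W2
           in hurwitz (A - L * C) \<and> controllable n m (A - L * C) L))"

definition standing_assumptions ::
  "nat \<Rightarrow> nat \<Rightarrow> real mat \<Rightarrow> real mat \<Rightarrow> real mat \<Rightarrow> real mat \<Rightarrow> bool" where
  "standing_assumptions n m A C W1 W2 \<longleftrightarrow>
     A \<in> carrier_mat n n \<and> C \<in> carrier_mat m n \<and>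
     hurwitz A \<and> observable n m A C \<and> pos_def n W1 \<and> pos_def m W2 \<and>
     optimal_filter_controllable n m A C W1 W2"

end

theory Submission
  imports Defs "Jordan_Normal_Form.Spectral_Radius"
begin

text \<open>
  Let \<open>M\<close> be the closed-loop matrix and \<open>S\<close> the stationary covariance with blocks \<open>S11, S12, S22\<close>.
  The solution operator of the Lyapunov equation is positive, so its operator norm is controlled by
  any \<open>X\<close> with \<open>M X + X M\<^sup>T \<le> -1\<close> and, by trace duality, its nuclear norm by any \<open>P\<close> with
  \<open>M\<^sup>T P + P M \<le> -1\<close>; the Frobenius norm is interpolated by a Kadison-type inequality. The
  noise covariance of the filter state may be degenerate, so multiples of \<open>S\<close> and \<open>S\<^sup>-\<^sup>1\<close>
  alone do not qualify. They are corrected with \<open>S11\<close>, whose Lyapunov equation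
  has the definite right-hand side \<open>W1\<close>, transported to the filter state by the invertible \<open>S12\<close>:
  \<open>X = \<alpha> S - \<beta> diag(0, S12\<^sup>T S11\<^sup>-\<^sup>1 S12)\<close> and \<open>P = \<alpha>' S\<^sup>-\<^sup>1 + \<beta>' diag(S11\<^sup>-\<^sup>1, 0)\<close>. The
  identity \<open>A S12 + S12 AK\<^sup>T + S11 C\<^sup>T BK\<^sup>T = 0\<close> makes the correction in \<open>X\<close> dissipate in the
  direction \<open>S12 y\<close>, up to a cross term with \<open>BK\<^sup>T y\<close> that \<open>W2\<close> absorbs.
\<close>

section \<open>Lyapunov equations with a Hurwitz coefficient\<close>

text \<open>The admissible quantities include neither a norm of \<open>A\<close>, \<open>AK\<close>
  or \<open>BK\<close> nor the dimension. No step may therefore pass through a decay rate of the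
  closed loop or through the equivalence of matrix norms; what remains is the comparison of
  quadratic forms, carried out separately for the three norms. The sign of the correction in
  \<open>X\<close> comes from a computation. Put \<open>f = S12 y\<close>,
  \<open>g = S11\<^sup>-\<^sup>1 f\<close> and \<open>u = BK\<^sup>T y\<close>. Along
  \<open>M\<^sup>T\<close> the form \<open>g \<bullet> f\<close> has derivative
  \<open>g \<bullet> W1 g - 2 (C f) \<bullet> u\<close>: it grows where \<open>S\<close> may fail to
  decay, so it is subtracted. \<open>AK\<close> has disappeared, and \<open>BK\<close> is left only
  inside \<open>u\<close>, where \<open>S\<close> contributes \<open>u \<bullet> W2 u\<close> with
  an arbitrarily large factor. Subtracting might seem to endanger positivity. But a Lyapunov
  inequality with a Hurwitz coefficient forces its form to be nonnegative, so only an upper bound of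
  \<open>X\<close> has to be computed, and for that the subtracted term is harmless. The constants
  are kept free of roots and quotients because a polynomial is wanted.\<close>

no_notation vec_nth (infixl \<open>$\<close> 90)

declare minus_carrier_mat [simp] add_carrier_mat [simp]

section \<open>Decay of matrix powers when all eigenvalues lie in the open unit disc\<close>

lemma pow_mat_smult:
  fixes A :: "'a :: comm_ring_1 mat"
  assumes A: "A \<in> carrier_mat n n"
  shows "(c \<cdot>\<^sub>m A) ^\<^sub>m k = c ^ k \<cdot>\<^sub>m (A ^\<^sub>m k)"
proof (induction k)
  case 0
  then show ?case using A by auto
next
  case (Suc k)
  have P: "A ^\<^sub>m k \<in> carrier_mat n n" using A by simp
  have "(c \<cdot>\<^sub>m A) ^\<^sub>m Suc k = (c ^ k \<cdot>\<^sub>m (A ^\<^sub>m k)) * (c \<cdot>\<^sub>m A)" using Suc by simp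
  also have "\<dots> = c ^ k \<cdot>\<^sub>m (A ^\<^sub>m k * (c \<cdot>\<^sub>m A))"
    by (rule mult_smult_assoc_mat[OF P]) (use A in auto)
  also have "A ^\<^sub>m k * (c \<cdot>\<^sub>m A) = c \<cdot>\<^sub>m (A ^\<^sub>m k * A)"
    by (rule mult_smult_distrib[OF P A])
  finally show ?case by (auto simp: ac_simps intro!: eq_matI)
qed

lemma smult_mult_mat_vec:
  fixes A :: "'a :: comm_ring_1 mat"
  assumes "A \<in> carrier_mat n m" "v \<in> carrier_vec m"
  shows "(c \<cdot>\<^sub>m A) *\<^sub>v v = c \<cdot>\<^sub>v (A *\<^sub>v v)"
  using assms by (intro eq_vecI) auto

text \<open>Bounded powers are not enough, so \<open>K\<close> is first divided by some
  \<open>r\<close> strictly between its spectral radius and \<open>1\<close>. The scaled matrix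
  still has spectral radius below \<open>1\<close>, hence bounded powers, and undoing the scaling
  gives entrywise decay like \<open>r ^ k\<close>.\<close>

lemma powers_tendsto_0:
  assumes K: "K \<in> carrier_mat n n"
    and ev: "\<And>l. eigenvalue (map_mat complex_of_real K) l \<Longrightarrow> cmod l < 1"
    and ij: "i < n" "j < n"
  shows "(\<lambda>k. (K ^\<^sub>m k) $$ (i, j)) \<longlonglongrightarrow> 0"
proof -
  let ?C = "map_mat complex_of_real K"
  have C: "?C \<in> carrier_mat n n" using K by simp
  have n: "n > 0" using ij by simp
  have fin: "finite (cmod ` spectrum ?C)" using card_finite_spectrum[OF C] by simp
  have ne: "cmod ` spectrum ?C \<noteq> {}" using spectrum_non_empty[OF C n] by simp
  have "spectral_radius ?C < 1"
    unfolding spectral_radius_def using ev fin ne by (auto simp: spectrum_def)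
  then obtain r where r: "spectral_radius ?C < r" "r < 1" using dense by blast
  have "0 \<le> spectral_radius ?C"
    using spectral_radius_mem_max(1)[OF C n] by (metis imageE norm_ge_zero)
  then have r0: "r > 0" using r by simp
  let ?D = "complex_of_real (1 / r) \<cdot>\<^sub>m ?C"
  have D: "?D \<in> carrier_mat n n" using C by simp
  have evD: "cmod l < 1" if l: "eigenvalue ?D l" for l
  proof -
    obtain v where v: "v \<in> carrier_vec n" "v \<noteq> 0\<^sub>v n" "?D *\<^sub>v v = l \<cdot>\<^sub>v v"
      using l D unfolding eigenvalue_def eigenvector_def by auto
    have "complex_of_real (1 / r) \<cdot>\<^sub>v (?C *\<^sub>v v) = l \<cdot>\<^sub>v v"
      using v smult_mult_mat_vec[OF C v(1)] by metis
    then have "of_real r \<cdot>\<^sub>v (complex_of_real (1 / r) \<cdot>\<^sub>v (?C *\<^sub>v v)) = of_real r \<cdot>\<^sub>v (l \<cdot>\<^sub>v v)" by simp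
    then have "?C *\<^sub>v v = (of_real r * l) \<cdot>\<^sub>v v"
      using r0 by (simp add: smult_smult_assoc)
    then have "eigenvalue ?C (of_real r * l)"
      using v K unfolding eigenvalue_def eigenvector_def by auto
    then have "cmod (of_real r * l) \<in> cmod ` spectrum ?C" by (auto simp: spectrum_def)
    then have "cmod (of_real r * l) \<le> spectral_radius ?C"
      by (rule spectral_radius_mem_max(2)[OF C n])
    moreover have "cmod (of_real r * l) = r * cmod l" using r0 by (simp add: norm_mult)
    ultimately have "r * cmod l < r" using r by linarith
    then show ?thesis using r0 by simp
  qed
  have finD: "finite (cmod ` spectrum ?D)" using card_finite_spectrum[OF D] by simp
  have neD: "cmod ` spectrum ?D \<noteq> {}" using spectrum_non_empty[OF D n] by simp
  have "spectral_radius ?D < 1"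
    unfolding spectral_radius_def using evD finD neD by (auto simp: spectrum_def)
  then obtain c where c: "\<And>k. norm_bound (?D ^\<^sub>m k) c"
    using spectral_radius_jnf_norm_bound_less_1_upper_triangular[OF D] by blast
  have bd: "norm ((K ^\<^sub>m k) $$ (i, j)) \<le> c * r ^ k" for k
  proof -
    have P: "K ^\<^sub>m k \<in> carrier_mat n n" using K by simp
    have "?D ^\<^sub>m k = of_real (1 / r) ^ k \<cdot>\<^sub>m map_mat complex_of_real (K ^\<^sub>m k)"
      unfolding pow_mat_smult[OF C] of_real_hom.mat_hom_pow[OF K] ..
    moreover have "norm ((?D ^\<^sub>m k) $$ (i, j)) \<le> c"
      using c[of k] ij pow_carrier_mat[OF D, of k] unfolding norm_bound_def by (metis carrier_matD)
    ultimately have "norm (of_real (1 / r) ^ k * complex_of_real ((K ^\<^sub>m k) $$ (i, j))) \<le> c"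
      using ij P K by simp
    then have "(1 / r) ^ k * \<bar>(K ^\<^sub>m k) $$ (i, j)\<bar> \<le> c"
      using r0 by (simp add: norm_mult norm_power norm_divide)
    then show ?thesis using r0 by (simp add: field_simps)
  qed
  have "(\<lambda>k. c * r ^ k) \<longlonglongrightarrow> 0"
    using r r0 by (intro tendsto_mult_right_zero LIMSEQ_realpow_zero) auto
  then show ?thesis by (rule Lim_null_comparison[rotated]) (use bd in \<open>auto intro!: always_eventually\<close>)
qed

lemma real_eigenvalue_complex:
  assumes A: "A \<in> carrier_mat n n" and v: "v \<in> carrier_vec n" "v \<noteq> 0\<^sub>v n" "A *\<^sub>v v = a \<cdot>\<^sub>v v"
  shows "eigenvalue (map_mat complex_of_real A) (of_real a)"
proof -
  have "eigenvalue A a" using assms unfolding eigenvalue_def eigenvector_def by auto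
  then have "poly (char_poly A) a = 0" using eigenvalue_root_char_poly[OF A] by simp
  then have "poly (char_poly (map_mat complex_of_real A)) (of_real a) = 0"
    using of_real_hom.char_poly_hom[OF A, where ?'a = complex] by simp
  then show ?thesis using eigenvalue_root_char_poly A by (metis map_carrier_mat)
qed

lemma invertible_mat_cases:
  fixes A :: "'a :: field mat"
  assumes A: "A \<in> carrier_mat n n" and inj: "\<And>v. v \<in> carrier_vec n \<Longrightarrow> A *\<^sub>v v = 0\<^sub>v n \<Longrightarrow> v = 0\<^sub>v n"
  obtains B where "B \<in> carrier_mat n n" "A * B = 1\<^sub>m n" "B * A = 1\<^sub>m n"
proof -
  have d: "det A \<noteq> 0" using det_0_iff_vec_prod_zero_field[OF A] inj by blast
  obtain B where B: "inverts_mat B A" "inverts_mat A B" "B \<in> carrier_mat n n"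
    using A d det_non_zero_imp_unit[OF A d] unfolding Units_def ring_mat_def
    by (auto simp: inverts_mat_def)
  then show ?thesis using that[of B] A unfolding inverts_mat_def by auto
qed

text \<open>The Cayley transform \<open>K = (1 + N) (1 - N)\<^sup>-\<^sup>1\<close> turns the continuous-time Lyapunov inequality for
  \<open>N\<close> into the discrete one \<open>K\<^sup>T X K \<le> X\<close>, which can be iterated.\<close>

lemma hurwitz_cayley:
  assumes N: "N \<in> carrier_mat n n" and hN: "hurwitz N"
  obtains J where "J \<in> carrier_mat n n" "(1\<^sub>m n - N) * J = 1\<^sub>m n"
    "\<And>i j. i < n \<Longrightarrow> j < n \<Longrightarrow> (\<lambda>k. (((1\<^sub>m n + N) * J) ^\<^sub>m k) $$ (i, j)) \<longlonglongrightarrow> 0"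
proof -
  have M: "1\<^sub>m n - N \<in> carrier_mat n n" using N by (rule minus_carrier_mat)
  have inj: "v = 0\<^sub>v n" if v: "v \<in> carrier_vec n" and 0: "(1\<^sub>m n - N) *\<^sub>v v = 0\<^sub>v n" for v
  proof (rule ccontr)
    assume "v \<noteq> 0\<^sub>v n"
    have "v - N *\<^sub>v v = 0\<^sub>v n"
      using 0 minus_mult_distrib_mat_vec[OF one_carrier_mat N v] v by simp
    then have "N *\<^sub>v v = 1 \<cdot>\<^sub>v v" using v N
      by (intro eq_vecI) (auto simp: vec_eq_iff dest!: arg_cong[where f = "\<lambda>w. \<lambda>i. vec_index w i"] fun_cong)
    then have "eigenvalue (map_mat complex_of_real N) (of_real 1)"
      by (rule real_eigenvalue_complex[OF N v \<open>v \<noteq> 0\<^sub>v n\<close>])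
    then show False using hN unfolding hurwitz_def by fastforce
  qed
  obtain J where J: "J \<in> carrier_mat n n" "(1\<^sub>m n - N) * J = 1\<^sub>m n" "J * (1\<^sub>m n - N) = 1\<^sub>m n"
    using invertible_mat_cases[OF M inj] by blast
  let ?K = "(1\<^sub>m n + N) * J"
  have K: "?K \<in> carrier_mat n n" by (rule mult_carrier_mat[of _ n n]) (use N J in auto)
  have ev: "cmod l < 1" if l: "eigenvalue (map_mat complex_of_real ?K) l" for l
  proof -
    let ?c = "map_mat complex_of_real"
    obtain v where v: "v \<in> carrier_vec n" "v \<noteq> 0\<^sub>v n" "?c ?K *\<^sub>v v = l \<cdot>\<^sub>v v"
      using l K unfolding eigenvalue_def eigenvector_def by auto
    have cN: "?c N \<in> carrier_mat n n" and cJ: "?c J \<in> carrier_mat n n" using N J by auto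
    have c1: "?c (1\<^sub>m n - N) = 1\<^sub>m n - ?c N" and c2: "?c (1\<^sub>m n + N) = 1\<^sub>m n + ?c N"
      using N by (auto intro!: eq_matI)
    define w where "w = ?c J *\<^sub>v v"
    have w: "w \<in> carrier_vec n" unfolding w_def using cJ v by simp
    have "(1\<^sub>m n - ?c N) *\<^sub>v w = ?c ((1\<^sub>m n - N) * J) *\<^sub>v v"
      unfolding w_def of_real_hom.mat_hom_mult[OF M J(1)] c1
      by (rule assoc_mult_mat_vec[symmetric, of _ n n _ n]) (use cN cJ v in auto)
    then have vw: "v = w - ?c N *\<^sub>v w"
      using J v w minus_mult_distrib_mat_vec[OF one_carrier_mat cN w]
      by (simp add: of_real_hom.mat_hom_one)
    have "(1\<^sub>m n + ?c N) *\<^sub>v w = ?c ?K *\<^sub>v v"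
      unfolding w_def of_real_hom.mat_hom_mult[OF add_carrier_mat[OF N] J(1)] c2
      by (rule assoc_mult_mat_vec[symmetric, of _ n n _ n]) (use cN cJ v in auto)
    then have lw: "w + ?c N *\<^sub>v w = l \<cdot>\<^sub>v (w - ?c N *\<^sub>v w)"
      using v w vw add_mult_distrib_mat_vec[OF one_carrier_mat cN w] by simp
    have w0: "w \<noteq> 0\<^sub>v n" using vw v(2) cN by (auto)
    define u where "u = ?c N *\<^sub>v w"
    have u: "u \<in> carrier_vec n" unfolding u_def using cN w by simp
    have comp: "(1 + l) * u $ i = (l - 1) * w $ i" if i: "i < n" for i
    proof -
      have "(w + u) $ i = (l \<cdot>\<^sub>v (w - u)) $ i" using lw unfolding u_def by simp
      then have "w $ i + u $ i = l * (w $ i - u $ i)" using i u w by simp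
      then show ?thesis by (simp add: algebra_simps)
    qed
    have l1: "l \<noteq> -1"
    proof
      assume "l = -1"
      then have "w = 0\<^sub>v n" using comp w by (intro eq_vecI) auto
      then show False using w0 by simp
    qed
    \<comment> \<open>This inverts the Cayley transform on eigenvalues:
      \<open>l = (1 + m) / (1 - m)\<close>, with \<open>l = -1\<close> the excluded point at
      infinity. The half plane \<open>Re m < 0\<close> consists of the points closer to
      \<open>-1\<close> than to \<open>1\<close>, which is \<open>cmod l < 1\<close>.\<close>
    define m where "m = (l - 1) / (1 + l)"
    have "1 + l \<noteq> 0" using l1 by (metis add.commute add_eq_0_iff)
    then have "u $ i = m * w $ i" if "i < n" for i
      using comp[OF that] unfolding m_def by (simp add: field_simps)
    then have "?c N *\<^sub>v w = m \<cdot>\<^sub>v w" unfolding u_def[symmetric] using u w by (intro eq_vecI) auto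
    then have "eigenvalue (?c N) m"
      using w w0 N unfolding eigenvalue_def eigenvector_def by auto
    then have m: "Re m < 0" using hN unfolding hurwitz_def by blast
    have lm: "l * (1 - m) = 1 + m"
      unfolding m_def using \<open>1 + l \<noteq> 0\<close> by (simp add: field_simps)
    have "cmod (1 + m) < cmod (1 - m)"
    proof -
      have "(cmod (1 + m))\<^sup>2 < (cmod (1 - m))\<^sup>2"
        using m unfolding cmod_power2 by (simp add: power2_eq_square algebra_simps)
      then show ?thesis by (simp add: power2_less_imp_less)
    qed
    moreover have "cmod l * cmod (1 - m) = cmod (1 + m)" using lm by (metis norm_mult)
    ultimately show ?thesis
      by (metis mult_le_cancel_right1 norm_ge_zero not_le order.strict_implies_not_eq order_less_le)
  qed
  show ?thesis using that[OF J(1,2)] powers_tendsto_0[OF K ev] by blast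
qed

section \<open>Comparison principle for Lyapunov inequalities\<close>

lemma zero_mult_mat_vec [simp]:
  fixes v :: "'a :: comm_ring_1 Matrix.vec"
  shows "v \<in> carrier_vec m \<Longrightarrow> 0\<^sub>m n m *\<^sub>v v = 0\<^sub>v n"
  by (intro eq_vecI) auto

lemma mult_mat_vec_tendsto_0:
  fixes A :: "real mat"
  assumes A: "A \<in> carrier_mat m n" and f: "\<And>k. f k \<in> carrier_vec n"
    and lim: "\<And>j. j < n \<Longrightarrow> (\<lambda>k. f k $ j) \<longlonglongrightarrow> 0" and i: "i < m"
  shows "(\<lambda>k. (A *\<^sub>v f k) $ i) \<longlonglongrightarrow> 0"
proof -
  have "(A *\<^sub>v f k) $ i = (\<Sum>j<n. A $$ (i, j) * f k $ j)" for k
    using A f[of k] i by (simp add: scalar_prod_def lessThan_atLeast0)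
  moreover have "(\<lambda>k. \<Sum>j<n. A $$ (i, j) * f k $ j) \<longlonglongrightarrow> 0"
    by (intro tendsto_null_sum tendsto_mult_right_zero lim) auto
  ultimately show ?thesis by simp
qed

lemma powers_mult_vec_tendsto_0:
  fixes K :: "real mat"
  assumes K: "K \<in> carrier_mat n n" and v: "v \<in> carrier_vec n"
    and lim: "\<And>i j. i < n \<Longrightarrow> j < n \<Longrightarrow> (\<lambda>k. (K ^\<^sub>m k) $$ (i, j)) \<longlonglongrightarrow> 0" and i: "i < n"
  shows "(\<lambda>k. (K ^\<^sub>m k *\<^sub>v v) $ i) \<longlonglongrightarrow> 0"
proof -
  have "(P *\<^sub>v v) $ i = (\<Sum>j<n. P $$ (i, j) * v $ j)" if "P \<in> carrier_mat n n" for P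
    using that v i by (auto simp: scalar_prod_def lessThan_atLeast0)
  from this[OF pow_carrier_mat[OF K]]
  have "(K ^\<^sub>m k *\<^sub>v v) $ i = (\<Sum>j<n. (K ^\<^sub>m k) $$ (i, j) * v $ j)" for k .
  moreover have "(\<lambda>k. \<Sum>j<n. (K ^\<^sub>m k) $$ (i, j) * v $ j) \<longlonglongrightarrow> 0"
    by (intro tendsto_null_sum tendsto_mult_left_zero lim) (use i in auto)
  ultimately show ?thesis by simp
qed

lemma powers_form_tendsto_0:
  fixes K X :: "real mat"
  assumes K: "K \<in> carrier_mat n n" and X: "X \<in> carrier_mat n n"
    and v: "v \<in> carrier_vec n" and u: "u \<in> carrier_vec n"
    and lim: "\<And>i j. i < n \<Longrightarrow> j < n \<Longrightarrow> (\<lambda>k. (K ^\<^sub>m k) $$ (i, j)) \<longlonglongrightarrow> 0"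
  shows "(\<lambda>k. (K ^\<^sub>m k *\<^sub>v v) \<bullet> (X *\<^sub>v (K ^\<^sub>m k *\<^sub>v u))) \<longlonglongrightarrow> 0"
proof -
  have c: "K ^\<^sub>m k *\<^sub>v u \<in> carrier_vec n" "K ^\<^sub>m k *\<^sub>v v \<in> carrier_vec n" for k
    using pow_carrier_mat[OF K, of k] u v by auto
  have "(\<lambda>k. \<Sum>i<n. (K ^\<^sub>m k *\<^sub>v v) $ i * (X *\<^sub>v (K ^\<^sub>m k *\<^sub>v u)) $ i) \<longlonglongrightarrow> 0"
    by (intro tendsto_null_sum tendsto_mult_zero mult_mat_vec_tendsto_0[OF X c(1)]
        powers_mult_vec_tendsto_0[OF K _ lim] u v) auto
  moreover have "(K ^\<^sub>m k *\<^sub>v v) \<bullet> (X *\<^sub>v (K ^\<^sub>m k *\<^sub>v u)) =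
      (\<Sum>i<n. (K ^\<^sub>m k *\<^sub>v v) $ i * (X *\<^sub>v (K ^\<^sub>m k *\<^sub>v u)) $ i)" for k
    using X c[of k] by (auto simp: scalar_prod_def lessThan_atLeast0)
  ultimately show ?thesis by simp
qed

text \<open>With \<open>p = J v\<close> one has \<open>v = p - N p\<close>, while the Cayley
  transform sends \<open>v\<close> to \<open>p + N p\<close>. Between the two forms the pure terms
  cancel and the mixed ones double, so one discrete step changes the form by exactly twice its
  continuous derivative, taken at \<open>J v\<close> and \<open>J u\<close>.\<close>

lemma cayley_form:
  fixes X N :: "real mat"
  assumes N: "N \<in> carrier_mat n n" and X: "X \<in> carrier_mat n n" and J: "J \<in> carrier_mat n n"
    and inv: "(1\<^sub>m n - N) * J = 1\<^sub>m n" and v: "v \<in> carrier_vec n" and u: "u \<in> carrier_vec n"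
  shows "(((1\<^sub>m n + N) * J) *\<^sub>v v) \<bullet> (X *\<^sub>v (((1\<^sub>m n + N) * J) *\<^sub>v u)) = v \<bullet> (X *\<^sub>v u) +
    2 * ((J *\<^sub>v v) \<bullet> (X *\<^sub>v (N *\<^sub>v (J *\<^sub>v u))) + (N *\<^sub>v (J *\<^sub>v v)) \<bullet> (X *\<^sub>v (J *\<^sub>v u)))"
proof -
  have a: "((1\<^sub>m n + N) * J) *\<^sub>v x = J *\<^sub>v x + N *\<^sub>v (J *\<^sub>v x)"
    and b: "J *\<^sub>v x - N *\<^sub>v (J *\<^sub>v x) = x" if x: "x \<in> carrier_vec n" for x
  proof -
    have "((1\<^sub>m n + N) * J) *\<^sub>v x = (1\<^sub>m n + N) *\<^sub>v (J *\<^sub>v x)"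
      by (rule assoc_mult_mat_vec[of _ n n _ n]) (use N J x in auto)
    then show "((1\<^sub>m n + N) * J) *\<^sub>v x = J *\<^sub>v x + N *\<^sub>v (J *\<^sub>v x)"
      using N J x add_mult_distrib_mat_vec[of "1\<^sub>m n" n n N "J *\<^sub>v x"] by simp
    have "J *\<^sub>v x - N *\<^sub>v (J *\<^sub>v x) = (1\<^sub>m n - N) *\<^sub>v (J *\<^sub>v x)"
      using N J x minus_mult_distrib_mat_vec[of "1\<^sub>m n" n n N "J *\<^sub>v x"] by simp
    also have "\<dots> = ((1\<^sub>m n - N) * J) *\<^sub>v x"
      by (rule assoc_mult_mat_vec[symmetric, of _ n n _ n]) (use N J x in auto)
    finally show "J *\<^sub>v x - N *\<^sub>v (J *\<^sub>v x) = x" using inv x by simp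
  qed
  define p q where "p = J *\<^sub>v v" and "q = J *\<^sub>v u"
  define p' q' where "p' = N *\<^sub>v p" and "q' = N *\<^sub>v q"
  have c: "p \<in> carrier_vec n" "q \<in> carrier_vec n" "p' \<in> carrier_vec n" "q' \<in> carrier_vec n"
    unfolding p'_def q'_def p_def q_def using N J u v by auto
  have Xc: "X *\<^sub>v q \<in> carrier_vec n" "X *\<^sub>v q' \<in> carrier_vec n" using X c by auto
  have "(p + p') \<bullet> (X *\<^sub>v (q + q')) = (p - p') \<bullet> (X *\<^sub>v (q - q')) +
      2 * (p \<bullet> (X *\<^sub>v q') + p' \<bullet> (X *\<^sub>v q))"
    using c X Xc by (simp add: mult_add_distrib_mat_vec[OF X] mult_minus_distrib_mat_vec[OF X]
        scalar_prod_add_distrib[of _ n] add_scalar_prod_distrib[of _ n]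
        scalar_prod_minus_distrib[of _ n] minus_scalar_prod_distrib[of _ n])
  then show ?thesis
    unfolding a[OF v] a[OF u] p'_def q'_def p_def q_def b[OF v] b[OF u] .
qed

text \<open>The form does not increase along the orbit \<open>K ^\<^sub>m k *\<^sub>v v\<close> and
  tends to \<open>0\<close>, so it starts nonnegative. This replaces the usual integral of matrix
  exponentials.\<close>

lemma lyapunov_ineq_form_nonneg:
  assumes N: "N \<in> carrier_mat n n" and hN: "hurwitz N" and X: "X \<in> carrier_mat n n"
    and le: "\<And>w. w \<in> carrier_vec n \<Longrightarrow> w \<bullet> (X *\<^sub>v (N *\<^sub>v w)) + (N *\<^sub>v w) \<bullet> (X *\<^sub>v w) \<le> 0"
    and v: "v \<in> carrier_vec n"
  shows "0 \<le> v \<bullet> (X *\<^sub>v v)"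
proof -
  obtain J where J: "J \<in> carrier_mat n n" "(1\<^sub>m n - N) * J = 1\<^sub>m n"
    and lim: "\<And>i j. i < n \<Longrightarrow> j < n \<Longrightarrow> (\<lambda>k. (((1\<^sub>m n + N) * J) ^\<^sub>m k) $$ (i, j)) \<longlonglongrightarrow> 0"
    using hurwitz_cayley[OF N hN] by blast
  define K where "K = (1\<^sub>m n + N) * J"
  have K: "K \<in> carrier_mat n n" unfolding K_def by (rule mult_carrier_mat[of _ n n]) (use N J in auto)
  have step: "(K *\<^sub>v u) \<bullet> (X *\<^sub>v (K *\<^sub>v u)) \<le> u \<bullet> (X *\<^sub>v u)" if u: "u \<in> carrier_vec n" for u
    using le[of "J *\<^sub>v u"] J u unfolding K_def cayley_form[OF N X J u u] by simp
  have "(K ^\<^sub>m k *\<^sub>v u) \<bullet> (X *\<^sub>v (K ^\<^sub>m k *\<^sub>v u)) \<le> u \<bullet> (X *\<^sub>v u)" if "u \<in> carrier_vec n" for k u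
    using that
  proof (induction k arbitrary: u)
    case 0
    then show ?case using K by simp
  next
    case (Suc k)
    have Ku: "K *\<^sub>v u \<in> carrier_vec n" using K Suc.prems by simp
    have "K ^\<^sub>m Suc k *\<^sub>v u = K ^\<^sub>m k *\<^sub>v (K *\<^sub>v u)"
      using assoc_mult_mat_vec[OF pow_carrier_mat[OF K] K Suc.prems] by simp
    then show ?case using Suc.IH[OF Ku] step[OF Suc.prems] by simp
  qed
  from this[OF v] show ?thesis
    using powers_form_tendsto_0[OF K X v v lim[folded K_def]] by (intro LIMSEQ_le_const2) auto
qed

text \<open>The form is constant along orbits and tends to \<open>0\<close>. Two independent
  arguments are carried because \<open>X\<close> may be non-symmetric, and then its quadratic form
  alone would not determine it.\<close>

lemma lyapunov_eq_form_zero: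
  assumes N: "N \<in> carrier_mat n n" and hN: "hurwitz N" and X: "X \<in> carrier_mat n n"
    and eq: "\<And>w x. w \<in> carrier_vec n \<Longrightarrow> x \<in> carrier_vec n \<Longrightarrow>
      w \<bullet> (X *\<^sub>v (N *\<^sub>v x)) + (N *\<^sub>v w) \<bullet> (X *\<^sub>v x) = 0"
    and v: "v \<in> carrier_vec n" and u: "u \<in> carrier_vec n"
  shows "v \<bullet> (X *\<^sub>v u) = 0"
proof -
  obtain J where J: "J \<in> carrier_mat n n" "(1\<^sub>m n - N) * J = 1\<^sub>m n"
    and lim: "\<And>i j. i < n \<Longrightarrow> j < n \<Longrightarrow> (\<lambda>k. (((1\<^sub>m n + N) * J) ^\<^sub>m k) $$ (i, j)) \<longlonglongrightarrow> 0"
    using hurwitz_cayley[OF N hN] by blast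
  define K where "K = (1\<^sub>m n + N) * J"
  have K: "K \<in> carrier_mat n n" unfolding K_def by (rule mult_carrier_mat[of _ n n]) (use N J in auto)
  have step: "(K *\<^sub>v w) \<bullet> (X *\<^sub>v (K *\<^sub>v x)) = w \<bullet> (X *\<^sub>v x)"
    if w: "w \<in> carrier_vec n" and x: "x \<in> carrier_vec n" for w x
    using eq[of "J *\<^sub>v w" "J *\<^sub>v x"] J w x unfolding K_def cayley_form[OF N X J w x] by simp
  have "(K ^\<^sub>m k *\<^sub>v w) \<bullet> (X *\<^sub>v (K ^\<^sub>m k *\<^sub>v x)) = w \<bullet> (X *\<^sub>v x)"
    if "w \<in> carrier_vec n" "x \<in> carrier_vec n" for k w x
    using that
  proof (induction k arbitrary: w x)
    case 0
    then show ?case using K by simp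
  next
    case (Suc k)
    have c: "K *\<^sub>v w \<in> carrier_vec n" "K *\<^sub>v x \<in> carrier_vec n" using K Suc.prems by auto
    have "K ^\<^sub>m Suc k *\<^sub>v y = K ^\<^sub>m k *\<^sub>v (K *\<^sub>v y)" if "y \<in> carrier_vec n" for y
      using assoc_mult_mat_vec[OF pow_carrier_mat[OF K] K that] by simp
    then show ?case using Suc.IH[OF c] step Suc.prems by simp
  qed
  from this[OF v u] show ?thesis
    using powers_form_tendsto_0[OF K X v u lim[folded K_def]] by (simp add: LIMSEQ_const_iff)
qed

lemma hurwitz_transpose:
  assumes A: "A \<in> carrier_mat n n" and h: "hurwitz A"
  shows "hurwitz A\<^sup>T"
proof -
  have "map_mat complex_of_real A\<^sup>T = (map_mat complex_of_real A)\<^sup>T" using A by (intro eq_matI) auto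
  then show ?thesis using h A unfolding hurwitz_def
    by (metis char_poly_transpose_mat eigenvalue_root_char_poly map_carrier_mat transpose_carrier_mat)
qed

section \<open>Matrix equations read as identities of bilinear forms\<close>

lemma unit_vec_form:
  fixes X :: "real mat"
  assumes X: "X \<in> carrier_mat n m" and ij: "i < n" "j < m"
  shows "unit_vec n i \<bullet> (X *\<^sub>v unit_vec m j) = X $$ (i, j)"
  using X ij by (simp add: scalar_prod_left_unit[of _ n])

lemma mat_eq_formI:
  fixes A B :: "real mat"
  assumes A: "A \<in> carrier_mat n m" and B: "B \<in> carrier_mat n m"
    and eq: "\<And>u v. u \<in> carrier_vec n \<Longrightarrow> v \<in> carrier_vec m \<Longrightarrow> u \<bullet> (A *\<^sub>v v) = u \<bullet> (B *\<^sub>v v)"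
  shows "A = B"
proof (rule eq_matI)
  fix i j assume "i < dim_row B" "j < dim_col B"
  then have ij: "i < n" "j < m" using B by auto
  show "A $$ (i, j) = B $$ (i, j)"
    using eq[of "unit_vec n i" "unit_vec m j"] unit_vec_form[OF A ij] unit_vec_form[OF B ij] by simp
qed (use A B in auto)

text \<open>The equation for \<open>M\<close> governs forms along orbits of
  \<open>M\<^sup>T\<close>. This is why the comparison lemmas are applied with
  \<open>N = M\<^sup>T\<close> to solutions for \<open>M\<close>, and with \<open>N = M\<close> to
  solutions for \<open>M\<^sup>T\<close>.\<close>

lemma lyapunov_form:
  fixes M X :: "real mat"
  assumes M: "M \<in> carrier_mat n n" and X: "X \<in> carrier_mat n n"
    and w: "w \<in> carrier_vec n" and u: "u \<in> carrier_vec n"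
  shows "w \<bullet> (X *\<^sub>v (M\<^sup>T *\<^sub>v u)) + (M\<^sup>T *\<^sub>v w) \<bullet> (X *\<^sub>v u) = w \<bullet> ((M * X + X * M\<^sup>T) *\<^sub>v u)"
proof -
  have Mt: "M\<^sup>T \<in> carrier_mat n n" using M by simp
  have c: "X *\<^sub>v (M\<^sup>T *\<^sub>v u) \<in> carrier_vec n" "M *\<^sub>v (X *\<^sub>v u) \<in> carrier_vec n" using M Mt X u by auto
  have "(M * X + X * M\<^sup>T) *\<^sub>v u = M *\<^sub>v (X *\<^sub>v u) + X *\<^sub>v (M\<^sup>T *\<^sub>v u)"
    using add_mult_distrib_mat_vec[OF mult_carrier_mat[OF M X] mult_carrier_mat[OF X Mt] u]
      assoc_mult_mat_vec[OF M X u] assoc_mult_mat_vec[OF X Mt u] by simp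
  moreover have "(M\<^sup>T *\<^sub>v w) \<bullet> (X *\<^sub>v u) = w \<bullet> (M *\<^sub>v (X *\<^sub>v u))"
    by (rule transpose_vec_mult_scalar[OF M _ w]) (use X u in simp)
  ultimately show ?thesis using c w by (simp add: scalar_prod_add_distrib[of _ n])
qed

lemma is_lyap_sol_iff:
  assumes M: "M \<in> carrier_mat n n" and Y: "Y \<in> carrier_mat n n"
  shows "is_lyap_sol M Y S \<longleftrightarrow> S \<in> carrier_mat n n \<and> M * S + S * M\<^sup>T = - Y"
proof -
  have "M * S + S * M\<^sup>T + Y = 0\<^sub>m n n \<longleftrightarrow> M * S + S * M\<^sup>T = - Y" if S: "S \<in> carrier_mat n n"
  proof -
    define T where "T = M * S + S * M\<^sup>T"
    have T: "T \<in> carrier_mat n n" unfolding T_def using M S by auto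
    have "T + Y = 0\<^sub>m n n \<longleftrightarrow> T = - Y"
    proof
      assume a: "T + Y = 0\<^sub>m n n"
      show "T = - Y"
      proof (rule eq_matI)
        fix i j assume "i < dim_row (- Y)" "j < dim_col (- Y)"
        then have ij: "i < n" "j < n" using Y by auto
        have "(T + Y) $$ (i, j) = 0" using a ij by simp
        then show "T $$ (i, j) = (- Y) $$ (i, j)" using ij Y by simp
      qed (use T Y in auto)
    qed (use Y in \<open>auto intro!: eq_matI\<close>)
    then show ?thesis unfolding T_def .
  qed
  then show ?thesis unfolding is_lyap_sol_def using M by auto
qed

lemma lyap_sol_form:
  assumes M: "M \<in> carrier_mat n n" and Y: "Y \<in> carrier_mat n n" and S: "is_lyap_sol M Y S"
    and w: "w \<in> carrier_vec n" and u: "u \<in> carrier_vec n"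
  shows "w \<bullet> (S *\<^sub>v (M\<^sup>T *\<^sub>v u)) + (M\<^sup>T *\<^sub>v w) \<bullet> (S *\<^sub>v u) = - (w \<bullet> (Y *\<^sub>v u))"
proof -
  have S': "S \<in> carrier_mat n n" "M * S + S * M\<^sup>T = - Y" using S is_lyap_sol_iff[OF M Y] by auto
  show ?thesis unfolding lyapunov_form[OF M S'(1) w u] S'(2) using Y w u by simp
qed

section \<open>Unique solvability of the Lyapunov equation\<close>

lemma sum_square_lessThan:
  fixes g :: "nat \<Rightarrow> 'a :: comm_monoid_add"
  shows "(\<Sum>q<n * n. g q) = (\<Sum>a<n. \<Sum>b<n. g (a * n + b))"
proof -
  have "sum g {a * n..<a * n + n} = (\<Sum>b<n. g (a * n + b))" for a
    using sum.shift_bounds_nat_ivl[of g 0 "a * n" n] by (simp add: lessThan_atLeast0 add.commute)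
  then show ?thesis by (simp add: sum.nat_group[symmetric])
qed

lemma square_index_less:
  fixes i j n :: nat
  assumes "i < n" "j < n"
  shows "i * n + j < n * n"
proof -
  have "i * n + j < Suc i * n" using assms by simp
  also have "\<dots> \<le> n * n" by (rule mult_right_mono) (use assms in auto)
  finally show ?thesis .
qed

lemma lyapunov_operator_zero:
  assumes M: "M \<in> carrier_mat n n" and h: "hurwitz M" and X: "X \<in> carrier_mat n n"
    and eq: "M * X + X * M\<^sup>T = 0\<^sub>m n n"
  shows "X = 0\<^sub>m n n"
proof (rule mat_eq_formI[OF X])
  fix u v :: "real Matrix.vec" assume uv: "u \<in> carrier_vec n" "v \<in> carrier_vec n"
  have "u \<bullet> (X *\<^sub>v v) = 0"
    by (rule lyapunov_eq_form_zero[OF _ hurwitz_transpose[OF M h] X _ uv])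
      (use M lyapunov_form[OF M X] eq in auto)
  then show "u \<bullet> (X *\<^sub>v v) = u \<bullet> (0\<^sub>m n n *\<^sub>v v)" using uv by simp
qed simp

text \<open>The operator \<open>X \<mapsto> M X + X M\<^sup>T\<close> has trivial kernel by
  comparison, so it is onto by finite dimension. To use invertibility of matrices it is written as a
  matrix acting on the vector of the entries of \<open>X\<close>.\<close>

lemma lyap_sol_ex1:
  assumes M: "M \<in> carrier_mat n n" and h: "hurwitz M" and Y: "Y \<in> carrier_mat n n"
  shows "\<exists>!S. is_lyap_sol M Y S"
proof -
  define X where "X x = mat n n (\<lambda>(i, j). x $ (i * n + j))" for x :: "real Matrix.vec"
  \<comment> \<open>In row-major order, where \<open>(i, j)\<close> has index
    \<open>i * n + j\<close>, this is the Kronecker sum of \<open>M\<close> with itself: the first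
    summand acts on the row index, the second on the column index.\<close>
  define T where "T = mat (n * n) (n * n) (\<lambda>(p, q).
    (if q mod n = p mod n then M $$ (p div n, q div n) else 0) +
    (if q div n = p div n then M $$ (p mod n, q mod n) else 0))"
  have Xc: "X x \<in> carrier_mat n n" for x unfolding X_def by simp
  have T: "T \<in> carrier_mat (n * n) (n * n)" unfolding T_def by simp
  have Tx: "(T *\<^sub>v x) $ (i * n + j) = (M * X x + X x * M\<^sup>T) $$ (i, j)"
    if x: "x \<in> carrier_vec (n * n)" and ij: "i < n" "j < n" for x i j
  proof -
    have p: "i * n + j < n * n" using square_index_less[OF ij] .
    have e: "(\<Sum>a<n. \<Sum>b<n. if a = i then M $$ (j, b) * x $ (a * n + b) else 0) =
        (\<Sum>a<n. if a = i then \<Sum>b<n. M $$ (j, b) * x $ (a * n + b) else 0)"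
      by (intro sum.cong refl) auto
    have "(T *\<^sub>v x) $ (i * n + j) = (\<Sum>q<n * n. T $$ (i * n + j, q) * x $ q)"
      using T x p by (simp add: scalar_prod_def lessThan_atLeast0)
    also have "\<dots> = (\<Sum>q<n * n. ((if q mod n = j then M $$ (i, q div n) else 0) +
        (if q div n = i then M $$ (j, q mod n) else 0)) * x $ q)"
      using p ij unfolding T_def by (intro sum.cong) auto
    also have "\<dots> = (\<Sum>a<n. \<Sum>b<n. ((if b = j then M $$ (i, a) else 0) +
        (if a = i then M $$ (j, b) else 0)) * x $ (a * n + b))"
      unfolding sum_square_lessThan by (intro sum.cong) auto
    also have "\<dots> = (\<Sum>a<n. \<Sum>b<n. if b = j then M $$ (i, a) * x $ (a * n + b) else 0) +
        (\<Sum>a<n. \<Sum>b<n. if a = i then M $$ (j, b) * x $ (a * n + b) else 0)"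
      unfolding sum.distrib[symmetric] by (intro sum.cong refl) (auto simp: distrib_right)
    also have "\<dots> = (\<Sum>a<n. M $$ (i, a) * x $ (a * n + j)) + (\<Sum>b<n. M $$ (j, b) * x $ (i * n + b))"
      using ij by (simp add: e)
    also have "\<dots> = (M * X x + X x * M\<^sup>T) $$ (i, j)"
      using ij M unfolding X_def by (simp add: scalar_prod_def lessThan_atLeast0 mult.commute)
    finally show ?thesis .
  qed
  have ix: "\<exists>i<n. \<exists>j<n. p = i * n + j" if "p < n * n" for p
  proof -
    have "n > 0" using that by (cases n) auto
    then have "p mod n < n" by simp
    moreover have "p div n < n" using that by (rule less_mult_imp_div_less)
    moreover have "p = (p div n) * n + p mod n" by simp
    ultimately show ?thesis by blast
  qed
  have inj: "x = 0\<^sub>v (n * n)" if x: "x \<in> carrier_vec (n * n)" and 0: "T *\<^sub>v x = 0\<^sub>v (n * n)" for x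
  proof -
    have "M * X x + X x * M\<^sup>T = 0\<^sub>m n n"
    proof (rule eq_matI)
      fix i j assume "i < dim_row (0\<^sub>m n n)" "j < dim_col (0\<^sub>m n n)"
      then have ij: "i < n" "j < n" by auto
      then have "i * n + j < n * n" using square_index_less[OF ij] by simp
      then show "(M * X x + X x * M\<^sup>T) $$ (i, j) = 0\<^sub>m n n $$ (i, j)" using Tx[OF x ij] 0 ij by simp
    qed (use M Xc[of x] in auto)
    from lyapunov_operator_zero[OF M h Xc this] have X0: "X x = 0\<^sub>m n n" .
    show ?thesis
    proof (rule eq_vecI)
      fix p assume "p < dim_vec (0\<^sub>v (n * n))"
      then have pn: "p < n * n" by simp
      then obtain i j where ij: "i < n" "j < n" "p = i * n + j" using ix by blast
      have "X x $$ (i, j) = 0" using X0 ij by simp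
      then show "x $ p = 0\<^sub>v (n * n) $ p" using ij pn unfolding X_def by simp
    qed (use x in simp)
  qed
  obtain B where B: "B \<in> carrier_mat (n * n) (n * n)" "T * B = 1\<^sub>m (n * n)"
    using invertible_mat_cases[OF T inj] by blast
  define y where "y = Matrix.vec (n * n) (\<lambda>p. - Y $$ (p div n, p mod n))"
  have y: "y \<in> carrier_vec (n * n)" unfolding y_def by simp
  define x where "x = B *\<^sub>v y"
  have x: "x \<in> carrier_vec (n * n)" unfolding x_def using B y by simp
  have Ty: "T *\<^sub>v x = y" unfolding x_def using assoc_mult_mat_vec[OF T B(1) y] B y by simp
  have "M * X x + X x * M\<^sup>T = - Y"
  proof (rule eq_matI)
    fix i j assume "i < dim_row (- Y)" "j < dim_col (- Y)"
    then have ij: "i < n" "j < n" using Y by auto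
    then have "i * n + j < n * n" using square_index_less[OF ij] by simp
    then show "(M * X x + X x * M\<^sup>T) $$ (i, j) = (- Y) $$ (i, j)"
      using Tx[OF x ij] ij Y unfolding Ty y_def by simp
  qed (use M Xc[of x] Y in auto)
  then have ex: "is_lyap_sol M Y (X x)" using is_lyap_sol_iff[OF M Y] Xc by blast
  moreover have "S = X x" if S: "is_lyap_sol M Y S" for S
  proof -
    have S': "S \<in> carrier_mat n n" using S is_lyap_sol_iff[OF M Y] by blast
    have D: "S - X x \<in> carrier_mat n n" using Xc by simp
    have "u \<bullet> ((S - X x) *\<^sub>v v) = 0" if uv: "u \<in> carrier_vec n" "v \<in> carrier_vec n" for u v
    proof (rule lyapunov_eq_form_zero[OF _ hurwitz_transpose[OF M h] D _ uv])
      show "M\<^sup>T \<in> carrier_mat n n" using M by simp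
      fix w z :: "real Matrix.vec" assume c: "w \<in> carrier_vec n" "z \<in> carrier_vec n"
      have d: "M\<^sup>T *\<^sub>v z \<in> carrier_vec n" "M\<^sup>T *\<^sub>v w \<in> carrier_vec n" using M c by auto
      have e: "S *\<^sub>v q \<in> carrier_vec n" "X x *\<^sub>v q \<in> carrier_vec n" if "q \<in> carrier_vec n" for q
        using S' Xc[of x] that by auto
      show "w \<bullet> ((S - X x) *\<^sub>v (M\<^sup>T *\<^sub>v z)) + (M\<^sup>T *\<^sub>v w) \<bullet> ((S - X x) *\<^sub>v z) = 0"
        using lyap_sol_form[OF M Y S c] lyap_sol_form[OF M Y ex c] c d e
        by (simp add: minus_mult_distrib_mat_vec[OF S' Xc] scalar_prod_minus_distrib[of _ n])
    qed
    note z = this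
    have "u \<bullet> (S *\<^sub>v v) = u \<bullet> (X x *\<^sub>v v)" if "u \<in> carrier_vec n" "v \<in> carrier_vec n" for u v
      using z[OF that] S' Xc[of x] that
      by (simp add: minus_mult_distrib_mat_vec[OF S' Xc] scalar_prod_minus_distrib[of _ n])
    then show "S = X x" using S' Xc by (intro mat_eq_formI) auto
  qed
  ultimately show ?thesis by blast
qed

section \<open>Quadratic forms and norms\<close>

lemma vec_nonneg_self [simp]: "0 \<le> v \<bullet> (v :: real Matrix.vec)"
  unfolding scalar_prod_def by (intro sum_nonneg) auto

lemma eucl_norm_nonneg [simp]: "0 \<le> eucl_norm v"
  unfolding eucl_norm_def by simp

lemma eucl_norm_sq: "(eucl_norm v)\<^sup>2 = v \<bullet> v"
  unfolding eucl_norm_def by simp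

lemma vec_self_eq_0:
  fixes v :: "real Matrix.vec"
  assumes "v \<in> carrier_vec n" "v \<bullet> v \<le> 0"
  shows "v = 0\<^sub>v n"
proof (rule eq_vecI)
  fix i assume "i < dim_vec (0\<^sub>v n)"
  then have i: "i < n" by simp
  have "v \<bullet> v = (\<Sum>i\<in>{0..<n}. v $ i * v $ i)" unfolding scalar_prod_def using assms by simp
  then have "(\<Sum>i\<in>{0..<n}. v $ i * v $ i) = 0" using assms vec_nonneg_self[of v] by simp
  then have "v $ i * v $ i = 0" using i by (subst (asm) sum_nonneg_eq_0_iff) auto
  then show "v $ i = 0\<^sub>v n $ i" using i by simp
qed (use assms in simp)

lemma eucl_norm_0_iff:
  assumes "v \<in> carrier_vec n"
  shows "eucl_norm v = 0 \<longleftrightarrow> v = 0\<^sub>v n"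
  using vec_self_eq_0[OF assms] assms unfolding eucl_norm_def by auto

lemma eucl_norm_smult:
  assumes "v \<in> carrier_vec n"
  shows "eucl_norm (c \<cdot>\<^sub>v v) = \<bar>c\<bar> * eucl_norm v"
proof -
  have "(c \<cdot>\<^sub>v v) \<bullet> (c \<cdot>\<^sub>v v) = c\<^sup>2 * (v \<bullet> v)" using assms by (simp add: power2_eq_square)
  then show ?thesis unfolding eucl_norm_def by (simp add: real_sqrt_mult)
qed

lemma quadratic_nonneg_discriminant:
  fixes a b c :: real
  assumes "\<And>t. 0 \<le> a + 2 * b * t + c * t\<^sup>2" "0 \<le> c"
  shows "b\<^sup>2 \<le> a * c"
proof (cases "c = 0")
  case True
  have "b = 0"
  proof (rule ccontr)
    assume "b \<noteq> 0"
    \<comment> \<open>At this \<open>t\<close> the affine function takes the value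
      \<open>-1\<close>.\<close>
    then show False using assms(1)[of "- (a + 1) / (2 * b)"] True by simp
  qed
  then show ?thesis using True by simp
next
  case False
  then have "c > 0" using assms by simp
  then show ?thesis using assms(1)[of "- b / c"] by (simp add: field_simps power2_eq_square)
qed

lemma symmetric_form:
  assumes "symmetric_mat n X" "u \<in> carrier_vec n" "v \<in> carrier_vec n"
  shows "u \<bullet> (X *\<^sub>v v) = v \<bullet> (X *\<^sub>v u)"
proof -
  have X: "X \<in> carrier_mat n n" "X\<^sup>T = X" using assms unfolding symmetric_mat_def by auto
  have "(X\<^sup>T *\<^sub>v u) \<bullet> v = u \<bullet> (X *\<^sub>v v)" by (rule transpose_vec_mult_scalar[OF X(1) assms(3,2)])
  then show ?thesis using X assms comm_scalar_prod[of "X *\<^sub>v u" n v] by simp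
qed

lemma form_add_smult:
  fixes X :: "real mat"
  assumes sym: "symmetric_mat n X" and u: "u \<in> carrier_vec n" and v: "v \<in> carrier_vec n"
  shows "(u + t \<cdot>\<^sub>v v) \<bullet> (X *\<^sub>v (u + t \<cdot>\<^sub>v v)) =
    u \<bullet> (X *\<^sub>v u) + 2 * (u \<bullet> (X *\<^sub>v v)) * t + (v \<bullet> (X *\<^sub>v v)) * t\<^sup>2"
proof -
  have X: "X \<in> carrier_mat n n" using sym unfolding symmetric_mat_def by auto
  have c: "X *\<^sub>v u \<in> carrier_vec n" "X *\<^sub>v v \<in> carrier_vec n" using X u v by auto
  have "X *\<^sub>v (u + t \<cdot>\<^sub>v v) = X *\<^sub>v u + t \<cdot>\<^sub>v (X *\<^sub>v v)"
    using u v by (simp add: mult_add_distrib_mat_vec[OF X] mult_mat_vec[OF X])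
  then show ?thesis
    using c u v symmetric_form[OF sym v u]
    by (simp add: scalar_prod_add_distrib[of _ n] add_scalar_prod_distrib[of _ n]
        power2_eq_square algebra_simps)
qed

lemma pos_semidef_Cauchy_Schwarz:
  assumes X: "pos_semidef n X" and u: "u \<in> carrier_vec n" and v: "v \<in> carrier_vec n"
  shows "(u \<bullet> (X *\<^sub>v v))\<^sup>2 \<le> (u \<bullet> (X *\<^sub>v u)) * (v \<bullet> (X *\<^sub>v v))"
proof (rule quadratic_nonneg_discriminant)
  have sym: "symmetric_mat n X" and nn: "\<And>w. w \<in> carrier_vec n \<Longrightarrow> 0 \<le> w \<bullet> (X *\<^sub>v w)"
    using X unfolding pos_semidef_def by auto
  show "0 \<le> u \<bullet> (X *\<^sub>v u) + 2 * (u \<bullet> (X *\<^sub>v v)) * t + (v \<bullet> (X *\<^sub>v v)) * t\<^sup>2" for t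
    using nn[of "u + t \<cdot>\<^sub>v v"] u v form_add_smult[OF sym u v] by simp
  show "0 \<le> v \<bullet> (X *\<^sub>v v)" using nn v by simp
qed

lemma pos_semidef_one: "pos_semidef n (1\<^sub>m n)"
  unfolding pos_semidef_def symmetric_mat_def by auto

lemma vec_Cauchy_Schwarz:
  assumes u: "u \<in> carrier_vec n" and v: "v \<in> carrier_vec n"
  shows "\<bar>u \<bullet> v\<bar> \<le> eucl_norm u * eucl_norm v"
proof -
  have "(u \<bullet> v)\<^sup>2 \<le> (eucl_norm u * eucl_norm v)\<^sup>2"
    using pos_semidef_Cauchy_Schwarz[OF pos_semidef_one u v] u v
    by (simp add: power_mult_distrib eucl_norm_sq)
  then have "\<bar>u \<bullet> v\<bar> \<le> \<bar>eucl_norm u * eucl_norm v\<bar>" by (simp only: abs_le_square_iff)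
  then show ?thesis by (simp add: abs_mult)
qed

text \<open>Cauchy-Schwarz for the form of \<open>X\<close>, applied to the vectors
  \<open>X v\<close> and \<open>v\<close>, bounds the fourth power of the length of
  \<open>X v\<close> by a multiple of \<open>v \<bullet> (X *\<^sub>v v)\<close>.\<close>

lemma pos_semidef_form_zero:
  assumes X: "pos_semidef n X" and v: "v \<in> carrier_vec n" and 0: "v \<bullet> (X *\<^sub>v v) = 0"
  shows "X *\<^sub>v v = 0\<^sub>v n"
proof -
  have Xc: "X \<in> carrier_mat n n" using X unfolding pos_semidef_def symmetric_mat_def by simp
  have Xv: "X *\<^sub>v v \<in> carrier_vec n" using Xc v by simp
  have "((X *\<^sub>v v) \<bullet> (X *\<^sub>v v))\<^sup>2 \<le> 0"
    using pos_semidef_Cauchy_Schwarz[OF X Xv v] 0 by simp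
  then show ?thesis using vec_self_eq_0[OF Xv] by simp
qed

lemma eucl_norm_triangle:
  assumes u: "u \<in> carrier_vec n" and v: "v \<in> carrier_vec n"
  shows "eucl_norm (u + v) \<le> eucl_norm u + eucl_norm v"
proof (rule power2_le_imp_le)
  have "(eucl_norm (u + v))\<^sup>2 = u \<bullet> u + 2 * (u \<bullet> v) + v \<bullet> v"
    using u v comm_scalar_prod[OF v u]
    by (simp add: eucl_norm_sq scalar_prod_add_distrib[of _ n] add_scalar_prod_distrib[of _ n])
  also have "\<dots> \<le> u \<bullet> u + 2 * (eucl_norm u * eucl_norm v) + v \<bullet> v"
    using vec_Cauchy_Schwarz[OF u v] by simp
  also have "\<dots> = (eucl_norm u + eucl_norm v)\<^sup>2"
    by (simp add: power2_sum eucl_norm_sq)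
  finally show "(eucl_norm (u + v))\<^sup>2 \<le> (eucl_norm u + eucl_norm v)\<^sup>2" .
qed simp

lemma eucl_norm_mult_le_rows:
  assumes X: "X \<in> carrier_mat m n" and v: "v \<in> carrier_vec n"
  shows "eucl_norm (X *\<^sub>v v) \<le> sqrt (\<Sum>i<m. Matrix.row X i \<bullet> Matrix.row X i) * eucl_norm v"
proof (rule power2_le_imp_le)
  have s: "0 \<le> (\<Sum>i<m. Matrix.row X i \<bullet> Matrix.row X i)" by (intro sum_nonneg) simp
  have "(eucl_norm (X *\<^sub>v v))\<^sup>2 = (\<Sum>i<m. (Matrix.row X i \<bullet> v)\<^sup>2)"
    unfolding eucl_norm_sq using X by (simp add: scalar_prod_def[of "X *\<^sub>v v"] lessThan_atLeast0 power2_eq_square)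
  also have "\<dots> \<le> (\<Sum>i<m. (Matrix.row X i \<bullet> Matrix.row X i) * (v \<bullet> v))"
  proof (intro sum_mono)
    fix i assume "i \<in> {..<m}"
    then have r: "Matrix.row X i \<in> carrier_vec n" using X by simp
    show "(Matrix.row X i \<bullet> v)\<^sup>2 \<le> (Matrix.row X i \<bullet> Matrix.row X i) * (v \<bullet> v)"
      using pos_semidef_Cauchy_Schwarz[OF pos_semidef_one r v] r v by simp
  qed
  also have "\<dots> = (sqrt (\<Sum>i<m. Matrix.row X i \<bullet> Matrix.row X i) * eucl_norm v)\<^sup>2"
    using s by (simp add: power_mult_distrib eucl_norm_sq sum_distrib_right)
  finally show "(eucl_norm (X *\<^sub>v v))\<^sup>2 \<le> \<dots>" .
  show "0 \<le> sqrt (\<Sum>i<m. Matrix.row X i \<bullet> Matrix.row X i) * eucl_norm v" using s by simp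
qed

lemma op_norm_bound:
  assumes X: "X \<in> carrier_mat m n" and v: "v \<in> carrier_vec n"
  shows "eucl_norm (X *\<^sub>v v) \<le> op_norm X * eucl_norm v"
proof (cases "v = 0\<^sub>v n")
  case True
  have "X *\<^sub>v 0\<^sub>v n = 0\<^sub>v m" using X by (intro eq_vecI) auto
  then show ?thesis using True by (simp add: eucl_norm_def)
next
  case False
  then have nv: "eucl_norm v > 0" using eucl_norm_0_iff[OF v] by (simp add: order_less_le)
  define u where "u = (1 / eucl_norm v) \<cdot>\<^sub>v v"
  have u: "u \<in> carrier_vec n" "eucl_norm u = 1" unfolding u_def using v nv by (auto simp: eucl_norm_smult)
  \<comment> \<open>The supremum in \<open>op_norm\<close> yields an upper bound only for a set that
    is bounded above. The crude estimate by the lengths of the rows is used for this finiteness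
    alone, so its dependence on the dimension does no harm.\<close>
  have bdd: "bdd_above {eucl_norm (X *\<^sub>v v) |v. v \<in> carrier_vec (dim_col X) \<and> eucl_norm v = 1}"
  proof (rule bdd_aboveI)
    fix y assume "y \<in> {eucl_norm (X *\<^sub>v v) |v. v \<in> carrier_vec (dim_col X) \<and> eucl_norm v = 1}"
    then obtain w where w: "y = eucl_norm (X *\<^sub>v w)" "w \<in> carrier_vec n" "eucl_norm w = 1"
      using X by auto
    show "y \<le> sqrt (\<Sum>i<m. Matrix.row X i \<bullet> Matrix.row X i)"
      using eucl_norm_mult_le_rows[OF X w(2)] w by simp
  qed
  have "eucl_norm (X *\<^sub>v u) \<le> op_norm X"
    unfolding op_norm_def by (rule cSup_upper[OF _ bdd]) (use u X in auto)
  moreover have "eucl_norm (X *\<^sub>v u) = (1 / eucl_norm v) * eucl_norm (X *\<^sub>v v)"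
    unfolding u_def using X v nv by (simp add: mult_mat_vec[OF X v] eucl_norm_smult[of _ m])
  ultimately show ?thesis using nv by (simp add: field_simps)
qed

lemma eucl_norm_unit_vec: "i < n \<Longrightarrow> eucl_norm (unit_vec n i) = 1"
  unfolding eucl_norm_def by simp

text \<open>In dimension \<open>0\<close> there is no unit vector and the supremum would be taken
  over the empty set; hence \<open>0 < n\<close>.\<close>

lemma op_norm_le:
  assumes X: "X \<in> carrier_mat m n" and n: "0 < n"
    and le: "\<And>v. v \<in> carrier_vec n \<Longrightarrow> eucl_norm (X *\<^sub>v v) \<le> c * eucl_norm v"
  shows "op_norm X \<le> c"
  unfolding op_norm_def
proof (rule cSup_least)
  show "{eucl_norm (X *\<^sub>v v) |v. v \<in> carrier_vec (dim_col X) \<and> eucl_norm v = 1} \<noteq> {}"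
    using eucl_norm_unit_vec[OF n] X by (auto intro!: exI[of _ "unit_vec n 0"])
next
  fix y assume "y \<in> {eucl_norm (X *\<^sub>v v) |v. v \<in> carrier_vec (dim_col X) \<and> eucl_norm v = 1}"
  then obtain w where "y = eucl_norm (X *\<^sub>v w)" "w \<in> carrier_vec n" "eucl_norm w = 1"
    using X by auto
  then show "y \<le> c" using le[of w] by simp
qed

lemma op_norm_nonneg:
  assumes X: "X \<in> carrier_mat m n" and n: "0 < n"
  shows "0 \<le> op_norm X"
  using op_norm_bound[OF X, of "unit_vec n 0"] order_trans[OF eucl_norm_nonneg]
  by (simp add: eucl_norm_unit_vec[OF n])

lemma op_norm_form:
  assumes X: "X \<in> carrier_mat m n" and u: "u \<in> carrier_vec m" and v: "v \<in> carrier_vec n"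
  shows "\<bar>u \<bullet> (X *\<^sub>v v)\<bar> \<le> op_norm X * (eucl_norm u * eucl_norm v)"
proof -
  have "\<bar>u \<bullet> (X *\<^sub>v v)\<bar> \<le> eucl_norm u * eucl_norm (X *\<^sub>v v)"
    by (rule vec_Cauchy_Schwarz[OF u]) (use X v in simp)
  also have "\<dots> \<le> eucl_norm u * (op_norm X * eucl_norm v)"
    by (intro mult_left_mono op_norm_bound[OF X v]) simp
  finally show ?thesis by (simp add: mult.left_commute)
qed

lemma op_norm_quadratic_form:
  assumes X: "X \<in> carrier_mat n n" and v: "v \<in> carrier_vec n"
  shows "\<bar>v \<bullet> (X *\<^sub>v v)\<bar> \<le> op_norm X * (v \<bullet> v)"
  using op_norm_form[OF X v v] by (simp add: eucl_norm_sq[symmetric] power2_eq_square)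

text \<open>For symmetric matrices the numerical radius controls the norm. With
  \<open>w = S v\<close>, polarization between \<open>v + t w\<close> and \<open>v - t w\<close>
  isolates \<open>v \<bullet> (S *\<^sub>v w)\<close>, which is the square of the length of
  \<open>w\<close>.\<close>

lemma symmetric_norm_le:
  assumes sym: "symmetric_mat n S"
    and le: "\<And>v. v \<in> carrier_vec n \<Longrightarrow> \<bar>v \<bullet> (S *\<^sub>v v)\<bar> \<le> c * (v \<bullet> v)"
    and v: "v \<in> carrier_vec n"
  shows "eucl_norm (S *\<^sub>v v) \<le> c * eucl_norm v"
proof (cases "v = 0\<^sub>v n \<or> S *\<^sub>v v = 0\<^sub>v n")
  case True
  have S: "S \<in> carrier_mat n n" using sym unfolding symmetric_mat_def by simp
  have "S *\<^sub>v 0\<^sub>v n = 0\<^sub>v n" using S by (intro eq_vecI) auto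
  then have z: "S *\<^sub>v v = 0\<^sub>v n" using True by auto
  have "0 \<le> c * (v \<bullet> v)" using le[OF v] by linarith
  then have "0 \<le> c * eucl_norm v"
    unfolding eucl_norm_sq[symmetric] by (cases "eucl_norm v = 0") (simp_all add: zero_le_mult_iff)
  then show ?thesis using z by (simp add: eucl_norm_def)
next
  case False
  have S: "S \<in> carrier_mat n n" using sym unfolding symmetric_mat_def by simp
  define w where "w = S *\<^sub>v v"
  have w: "w \<in> carrier_vec n" unfolding w_def using S v by simp
  define a where "a = eucl_norm v"
  define b where "b = eucl_norm w"
  have a: "a > 0" and b: "b > 0"
    using False eucl_norm_0_iff[OF v] eucl_norm_0_iff[OF w] unfolding w_def a_def b_def
    by (auto simp: order_less_le)
  \<comment> \<open>Chosen so that \<open>t w\<close> is as long as \<open>v\<close>. This minimises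
    the ratio of \<open>a\<^sup>2 + b\<^sup>2 * t\<^sup>2\<close> to \<open>t\<close>, so the
    polarization loses no factor.\<close>
  define t where "t = a / b"
  have wSv: "v \<bullet> (S *\<^sub>v w) = b\<^sup>2"
    using symmetric_form[OF sym v w] unfolding b_def eucl_norm_sq by (simp add: w_def)
  have q: "(v + s \<cdot>\<^sub>v w) \<bullet> (v + s \<cdot>\<^sub>v w) = a\<^sup>2 + 2 * (v \<bullet> w) * s + b\<^sup>2 * s\<^sup>2" for s
    using form_add_smult[of n "1\<^sub>m n" v w s] v w pos_semidef_one[of n] unfolding pos_semidef_def
    by (simp add: a_def b_def eucl_norm_sq)
  have p1: "(v + t \<cdot>\<^sub>v w) \<bullet> (S *\<^sub>v (v + t \<cdot>\<^sub>v w)) \<le> c * (a\<^sup>2 + 2 * (v \<bullet> w) * t + b\<^sup>2 * t\<^sup>2)"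
    using le[of "v + t \<cdot>\<^sub>v w"] v w unfolding q by simp
  have p2: "- ((v + (- t) \<cdot>\<^sub>v w) \<bullet> (S *\<^sub>v (v + (- t) \<cdot>\<^sub>v w))) \<le> c * (a\<^sup>2 + 2 * (v \<bullet> w) * (- t) + b\<^sup>2 * (- t)\<^sup>2)"
    using le[of "v + (- t) \<cdot>\<^sub>v w"] v w unfolding q by simp
  have "4 * b\<^sup>2 * t \<le> 2 * c * (a\<^sup>2 + b\<^sup>2 * t\<^sup>2)"
    using p1 p2 unfolding form_add_smult[OF sym v w] wSv by (simp add: algebra_simps)
  then have "4 * (a * b) \<le> 4 * (c * a * a)"
    unfolding t_def using a b by (simp add: power2_eq_square field_simps)
  then have "b \<le> c * a" using a by simp
  then show ?thesis unfolding a_def b_def w_def .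
qed

section \<open>Inverses of positive definite matrices\<close>

lemma mat_inv_eq:
  assumes A: "A \<in> carrier_mat n n" and B: "B \<in> carrier_mat n n" and AB: "A * B = 1\<^sub>m n"
  shows "mat_inv A = B"
proof -
  have BA: "B * A = 1\<^sub>m n" by (rule mat_mult_left_right_inverse[OF A B AB])
  have "A \<in> Units (ring_mat TYPE(real) n n)"
    unfolding Units_def ring_mat_def using A B AB BA by auto
  then obtain C where C: "mat_inverse A = Some C"
    using mat_inverse(1)[OF A, of n] by (cases "mat_inverse A") auto
  then have "A * C = 1\<^sub>m n" "C \<in> carrier_mat n n" using mat_inverse(2)[OF A] by auto
  then have "B * (A * C) = B" "B * (A * C) = C"
    using B BA assoc_mult_mat[OF B A \<open>C \<in> _\<close>] by auto
  then show ?thesis unfolding mat_inv_def C by simp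
qed

lemma pos_def_imp_pos_semidef: "pos_def n X \<Longrightarrow> pos_semidef n X"
  unfolding pos_semidef_def
proof (intro conjI ballI)
  fix v :: "real Matrix.vec" assume X: "pos_def n X" and v: "v \<in> carrier_vec n"
  have Xc: "X \<in> carrier_mat n n" using X unfolding pos_def_def symmetric_mat_def by simp
  then have "X *\<^sub>v v \<in> carrier_vec n" using v by simp
  then show "0 \<le> v \<bullet> (X *\<^sub>v v)"
    using X v unfolding pos_def_def by (cases "v = 0\<^sub>v n") (simp, force)
qed (simp add: pos_def_def)

lemma pos_def_mat_inv:
  assumes X: "pos_def n X"
  shows "mat_inv X \<in> carrier_mat n n" "X * mat_inv X = 1\<^sub>m n" "mat_inv X * X = 1\<^sub>m n"
proof -
  have Xc: "X \<in> carrier_mat n n" using X unfolding pos_def_def symmetric_mat_def by simp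
  have "v = 0\<^sub>v n" if v: "v \<in> carrier_vec n" "X *\<^sub>v v = 0\<^sub>v n" for v
    using X v unfolding pos_def_def by fastforce
  then obtain B where B: "B \<in> carrier_mat n n" "X * B = 1\<^sub>m n" "B * X = 1\<^sub>m n"
    using invertible_mat_cases[OF Xc] by blast
  then show "mat_inv X \<in> carrier_mat n n" "X * mat_inv X = 1\<^sub>m n" "mat_inv X * X = 1\<^sub>m n"
    using mat_inv_eq[OF Xc] by auto
qed

lemma pos_def_mat_inv_mult:
  assumes X: "pos_def n X" and v: "v \<in> carrier_vec n"
  shows "mat_inv X *\<^sub>v v \<in> carrier_vec n" "X *\<^sub>v (mat_inv X *\<^sub>v v) = v" "mat_inv X *\<^sub>v (X *\<^sub>v v) = v"
proof -
  note i = pos_def_mat_inv[OF X]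
  have Xc: "X \<in> carrier_mat n n" using X unfolding pos_def_def symmetric_mat_def by simp
  show "mat_inv X *\<^sub>v v \<in> carrier_vec n" using i v by simp
  show "X *\<^sub>v (mat_inv X *\<^sub>v v) = v" using assoc_mult_mat_vec[OF Xc i(1) v] i v by simp
  show "mat_inv X *\<^sub>v (X *\<^sub>v v) = v" using assoc_mult_mat_vec[OF i(1) Xc v] i v by simp
qed

text \<open>The estimate of the smallest eigenvalue from below, without eigenvalues: Cauchy-Schwarz
  for the form of \<open>X\<close> between \<open>v\<close> and
  \<open>u = X\<^sup>-\<^sup>1 v\<close> gives \<open>(v \<bullet> v)\<^sup>2 \<le> (v \<bullet> X
  v) * (v \<bullet> X\<^sup>-\<^sup>1 v)\<close>.\<close>

lemma pos_def_mat_inv_bound: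
  assumes X: "pos_def n X" and v: "v \<in> carrier_vec n" and n: "0 < n"
  shows "v \<bullet> v \<le> op_norm (mat_inv X) * (v \<bullet> (X *\<^sub>v v))"
proof (cases "v = 0\<^sub>v n")
  case True
  have "X \<in> carrier_mat n n" using X unfolding pos_def_def symmetric_mat_def by simp
  then have "X *\<^sub>v v \<in> carrier_vec n" using v by simp
  then show ?thesis using True by simp
next
  case False
  note i = pos_def_mat_inv[OF X]
  define u where "u = mat_inv X *\<^sub>v v"
  have u: "u \<in> carrier_vec n" "X *\<^sub>v u = v" unfolding u_def using pos_def_mat_inv_mult[OF X v] by auto
  have vv: "v \<bullet> v > 0" using vec_self_eq_0[OF v] False by force
  have nn: "0 \<le> v \<bullet> (X *\<^sub>v v)" using pos_def_imp_pos_semidef[OF X] v unfolding pos_semidef_def by simp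
  have "(v \<bullet> v)\<^sup>2 \<le> (v \<bullet> (X *\<^sub>v v)) * (u \<bullet> v)"
    using pos_semidef_Cauchy_Schwarz[OF pos_def_imp_pos_semidef[OF X] v u(1)] u by simp
  also have "u \<bullet> v = v \<bullet> (mat_inv X *\<^sub>v v)" unfolding u_def[symmetric] by (rule comm_scalar_prod[OF u(1) v])
  also have "(v \<bullet> (X *\<^sub>v v)) * \<dots> \<le> (v \<bullet> (X *\<^sub>v v)) * (op_norm (mat_inv X) * (v \<bullet> v))"
    using op_norm_quadratic_form[OF i(1) v] nn by (intro mult_left_mono) auto
  finally have "(v \<bullet> v) * (v \<bullet> v) \<le> (op_norm (mat_inv X) * (v \<bullet> (X *\<^sub>v v))) * (v \<bullet> v)"
    by (simp add: power2_eq_square mult_ac)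
  then show ?thesis using vv mult_le_cancel_right_pos by blast
qed

text \<open>The squared norm is split by columns so that a bound on each vector \<open>S v\<close>
  can be summed over the unit vectors.\<close>

lemma frobenius_norm_sq:
  assumes X: "X \<in> carrier_mat m n"
  shows "(frobenius_norm X)\<^sup>2 = (\<Sum>j<n. (X *\<^sub>v unit_vec n j) \<bullet> (X *\<^sub>v unit_vec n j))"
proof -
  have "(X *\<^sub>v unit_vec n j) \<bullet> (X *\<^sub>v unit_vec n j) = (\<Sum>i<m. (X $$ (i, j))\<^sup>2)" if "j < n" for j
    using X that by (simp add: scalar_prod_def[of "X *\<^sub>v unit_vec n j"] lessThan_atLeast0 power2_eq_square)
  then have "(\<Sum>j<n. (X *\<^sub>v unit_vec n j) \<bullet> (X *\<^sub>v unit_vec n j)) = (\<Sum>j<n. \<Sum>i<m. (X $$ (i, j))\<^sup>2)" by simp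
  also have "\<dots> = (\<Sum>i<m. \<Sum>j<n. (X $$ (i, j))\<^sup>2)" by (rule sum.swap)
  finally show ?thesis unfolding frobenius_norm_def using X by (simp add: sum_nonneg)
qed

section \<open>Orthogonal diagonalization and the nuclear norm\<close>

lemma mat_eq_vecI:
  fixes A B :: "real mat"
  assumes A: "A \<in> carrier_mat n m" and B: "B \<in> carrier_mat n m"
    and eq: "\<And>v. v \<in> carrier_vec m \<Longrightarrow> A *\<^sub>v v = B *\<^sub>v v"
  shows "A = B"
  by (rule mat_eq_formI[OF A B]) (simp add: eq)

text \<open>The reflection in the hyperplane orthogonal to \<open>e\<^sub>0 - u\<close>.\<close>

lemma householder_reflection:
  fixes u :: "real Matrix.vec"
  assumes n: "0 < n" and u: "u \<in> carrier_vec n" and uu: "u \<bullet> u = 1"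
  obtains H where "H \<in> carrier_mat n n" "H\<^sup>T = H" "H * H = 1\<^sub>m n" "H *\<^sub>v unit_vec n 0 = u"
proof (cases "u = unit_vec n 0")
  case True
  then show ?thesis using that[of "1\<^sub>m n"] n by simp
next
  case False
  define e where "e = (unit_vec n 0 :: real Matrix.vec)"
  have e: "e \<in> carrier_vec n" "e \<bullet> e = 1" unfolding e_def using n by auto
  define w where "w = e - u"
  have w: "w \<in> carrier_vec n" unfolding w_def using e u by simp
  define c where "c = w \<bullet> w"
  have c: "c \<noteq> 0"
  proof
    assume "c = 0"
    then have w0: "w = 0\<^sub>v n" using vec_self_eq_0[OF w] unfolding c_def by simp
    have "e = u"
    proof (rule eq_vecI)
      fix i assume "i < dim_vec u"
      then have i: "i < n" using u by simp
      have "w $ i = 0" using w0 i by simp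
      then show "e $ i = u $ i" using i u e unfolding w_def by simp
    qed (use u e in simp)
    then show False using False unfolding e_def by simp
  qed
  define H where "H = mat n n (\<lambda>(i, j). (if i = j then 1 else 0) - 2 / c * (w $ i * w $ j))"
  have H: "H \<in> carrier_mat n n" unfolding H_def by simp
  have Hv: "H *\<^sub>v v = v + (- (2 / c * (w \<bullet> v))) \<cdot>\<^sub>v w" if v: "v \<in> carrier_vec n" for v
  proof (rule eq_vecI)
    fix i assume "i < dim_vec (v + (- (2 / c * (w \<bullet> v))) \<cdot>\<^sub>v w)"
    then have i: "i < n" using w by simp
    have "(H *\<^sub>v v) $ i = (\<Sum>j<n. ((if i = j then 1 else 0) - 2 / c * (w $ i * w $ j)) * v $ j)"
      using i v unfolding H_def by (simp add: scalar_prod_def lessThan_atLeast0)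
    also have "\<dots> = (\<Sum>j<n. (if i = j then v $ j else 0)) - (\<Sum>j<n. 2 / c * (w $ i * w $ j) * v $ j)"
      unfolding sum_subtractf[symmetric] by (intro sum.cong) (auto simp: algebra_simps)
    also have "(\<Sum>j<n. 2 / c * (w $ i * w $ j) * v $ j) = 2 / c * (w \<bullet> v) * w $ i"
      using v by (simp add: scalar_prod_def lessThan_atLeast0 sum_distrib_left sum_distrib_right mult_ac)
    finally show "(H *\<^sub>v v) $ i = (v + (- (2 / c * (w \<bullet> v))) \<cdot>\<^sub>v w) $ i"
      using i v w by simp
  qed (use H w in auto)
  have HT: "H\<^sup>T = H" unfolding H_def by (intro eq_matI) (auto simp: mult.commute)
  have HH: "H * H = 1\<^sub>m n"
  proof (rule mat_eq_vecI)
    fix v :: "real Matrix.vec" assume v: "v \<in> carrier_vec n"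
    define s where "s = - (2 / c * (w \<bullet> v))"
    have x: "v + s \<cdot>\<^sub>v w \<in> carrier_vec n" using v w by simp
    have "w \<bullet> (v + s \<cdot>\<^sub>v w) = w \<bullet> v + s * c"
      using v w unfolding c_def by (simp add: scalar_prod_add_distrib[of _ n])
    also have "\<dots> = - (w \<bullet> v)" unfolding s_def using c by simp
    finally have "- (2 / c * (w \<bullet> (v + s \<cdot>\<^sub>v w))) = - s" unfolding s_def by simp
    then have "H *\<^sub>v (H *\<^sub>v v) = v + s \<cdot>\<^sub>v w + (- s) \<cdot>\<^sub>v w"
      using Hv[OF v] Hv[OF x] unfolding s_def by simp
    also have "\<dots> = v" using v w by (intro eq_vecI) auto
    finally show "(H * H) *\<^sub>v v = 1\<^sub>m n *\<^sub>v v" using assoc_mult_mat_vec[OF H H v] v by simp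
  qed (use H in auto)
  have ue: "u \<bullet> e = e \<bullet> u" by (rule comm_scalar_prod[OF u e(1)])
  \<comment> \<open>The equal lengths of \<open>e\<close> and \<open>u\<close> enter here: both
    \<open>c\<close> and \<open>2 * (w \<bullet> e)\<close> equal
    \<open>2 - 2 * (e \<bullet> u)\<close>.\<close>
  have "c = 2 * (w \<bullet> e)"
    unfolding c_def w_def using e u uu ue
    by (simp add: scalar_prod_minus_distrib[of _ n] minus_scalar_prod_distrib[of _ n])
  then have "2 / c * (w \<bullet> e) = 1" using c by simp
  then have "H *\<^sub>v e = e + (- 1) \<cdot>\<^sub>v w" using Hv[OF e(1)] by simp
  also have "\<dots> = u" unfolding w_def using e u by (intro eq_vecI) auto
  finally show ?thesis using that[OF H HT HH] unfolding e_def by simp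
qed

text \<open>A complex eigenvector is split into real and imaginary parts \<open>a\<close> and
  \<open>b\<close>. Symmetry of the form on this pair gives
  \<open>Im l * (a \<bullet> a + b \<bullet> b) = 0\<close>, so the eigenvalue is real, and
  whichever of \<open>a\<close>, \<open>b\<close> is nonzero is a real eigenvector.\<close>

lemma symmetric_eigenvector:
  assumes sym: "symmetric_mat n X" and n: "0 < n"
  obtains e u where "u \<in> carrier_vec n" "u \<bullet> u = 1" "X *\<^sub>v u = e \<cdot>\<^sub>v u"
proof -
  have X: "X \<in> carrier_mat n n" using sym unfolding symmetric_mat_def by simp
  let ?C = "map_mat complex_of_real X"
  have C: "?C \<in> carrier_mat n n" using X by simp
  obtain l where "eigenvalue ?C l" using spectrum_non_empty[OF C n] unfolding spectrum_def by auto
  then obtain v where v: "v \<in> carrier_vec n" "v \<noteq> 0\<^sub>v n" "?C *\<^sub>v v = l \<cdot>\<^sub>v v"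
    unfolding eigenvalue_def eigenvector_def using X by auto
  define a b where "a = map_vec Re v" and "b = map_vec Im v"
  have ab: "a \<in> carrier_vec n" "b \<in> carrier_vec n" unfolding a_def b_def using v by auto
  have vi: "(\<Sum>j<n. of_real (X $$ (i, j)) * v $ j) = l * v $ i" if i: "i < n" for i
  proof -
    have "(?C *\<^sub>v v) $ i = (\<Sum>j<n. of_real (X $$ (i, j)) * v $ j)"
      using X v(1) i by (simp add: scalar_prod_def lessThan_atLeast0)
    then show ?thesis using v i by simp
  qed
  have Xa: "(X *\<^sub>v a) $ i = Re l * a $ i - Im l * b $ i"
    and Xb: "(X *\<^sub>v b) $ i = Re l * b $ i + Im l * a $ i" if i: "i < n" for i
    using arg_cong[OF vi[OF i], of Re] arg_cong[OF vi[OF i], of Im] X v(1) i unfolding a_def b_def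
    by (simp_all add: scalar_prod_def lessThan_atLeast0)
  have XA: "X *\<^sub>v a = Re l \<cdot>\<^sub>v a + (- Im l) \<cdot>\<^sub>v b" using Xa X ab by (intro eq_vecI) auto
  have XB: "X *\<^sub>v b = Re l \<cdot>\<^sub>v b + Im l \<cdot>\<^sub>v a" using Xb X ab by (intro eq_vecI) auto
  have "a \<bullet> (X *\<^sub>v b) = b \<bullet> (X *\<^sub>v a)" by (rule symmetric_form[OF sym ab])
  then have "Im l * (a \<bullet> a + b \<bullet> b) = 0"
    unfolding XA XB using ab comm_scalar_prod[OF ab]
    by (simp add: scalar_prod_add_distrib[of _ n] algebra_simps)
  moreover have nz: "a \<noteq> 0\<^sub>v n \<or> b \<noteq> 0\<^sub>v n"
  proof (rule ccontr)
    assume "\<not> ?thesis"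
    then have z: "a = 0\<^sub>v n" "b = 0\<^sub>v n" by auto
    have "v = 0\<^sub>v n"
    proof (rule eq_vecI)
      fix i assume "i < dim_vec (0\<^sub>v n)"
      then have i: "i < n" by simp
      have "a $ i = 0" "b $ i = 0" using z i by auto
      then show "v $ i = 0\<^sub>v n $ i" using i v(1) unfolding a_def b_def by (simp add: complex_eq_iff)
    qed (use v in simp)
    then show False using v by simp
  qed
  moreover have "a \<bullet> a + b \<bullet> b > 0"
    using nz vec_self_eq_0[OF ab(1)] vec_self_eq_0[OF ab(2)]
    by (metis add_pos_nonneg add_nonneg_pos not_less vec_nonneg_self)
  ultimately have l0: "Im l = 0" by simp
  obtain x where x: "x \<in> carrier_vec n" "x \<noteq> 0\<^sub>v n" "X *\<^sub>v x = Re l \<cdot>\<^sub>v x"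
  proof (cases "a = 0\<^sub>v n")
    case True
    have "X *\<^sub>v b = Re l \<cdot>\<^sub>v b" using Xb X ab l0 by (intro eq_vecI) auto
    then show ?thesis using that ab nz True by blast
  next
    case False
    have "X *\<^sub>v a = Re l \<cdot>\<^sub>v a" using Xa X ab l0 by (intro eq_vecI) auto
    then show ?thesis using that ab False by blast
  qed
  have nx: "eucl_norm x > 0" using eucl_norm_0_iff[OF x(1)] x(2) by (simp add: order_less_le)
  define u where "u = (1 / eucl_norm x) \<cdot>\<^sub>v x"
  have "u \<in> carrier_vec n" unfolding u_def using x by simp
  moreover have "u \<bullet> u = 1"
    unfolding eucl_norm_sq[symmetric] u_def using nx x by (simp add: eucl_norm_smult)
  moreover have "X *\<^sub>v u = Re l \<cdot>\<^sub>v u"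
    unfolding u_def using x by (simp add: mult_mat_vec[OF X] smult_smult_assoc mult.commute)
  ultimately show ?thesis using that by blast
qed

text \<open>Induction by deflation. A reflection \<open>H\<close> taking the first unit vector to a
  unit eigenvector turns \<open>X\<close> into \<open>H * X * H\<close>, whose first column is a
  multiple of that unit vector; by symmetry so is the first row, and a symmetric block of size
  \<open>n\<close> remains.\<close>

lemma symmetric_diagonalization:
  assumes "symmetric_mat n X"
  shows "\<exists>U d. U \<in> carrier_mat n n \<and> U\<^sup>T * U = 1\<^sub>m n \<and> U * U\<^sup>T = 1\<^sub>m n \<and> X = U * mat_diag n d * U\<^sup>T"
  using assms
proof (induction n arbitrary: X)
  case 0
  then show ?case unfolding symmetric_mat_def
    by (intro exI[of _ "1\<^sub>m 0"] exI[of _ "\<lambda>_. 0"]) (auto intro!: eq_matI)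
next
  case (Suc n)
  have X: "X \<in> carrier_mat (Suc n) (Suc n)" "X\<^sup>T = X" using Suc.prems unfolding symmetric_mat_def by auto
  obtain e u where u: "u \<in> carrier_vec (Suc n)" "u \<bullet> u = 1" "X *\<^sub>v u = e \<cdot>\<^sub>v u"
    using symmetric_eigenvector[OF Suc.prems] by blast
  obtain H where H: "H \<in> carrier_mat (Suc n) (Suc n)" "H\<^sup>T = H" "H * H = 1\<^sub>m (Suc n)"
      "H *\<^sub>v unit_vec (Suc n) 0 = u"
    using householder_reflection[OF _ u(1,2)] by blast
  let ?N = "Suc n"
  let ?e = "unit_vec ?N 0 :: real Matrix.vec"
  define B where "B = H * X * H"
  have HX: "H * X \<in> carrier_mat ?N ?N" using H X by simp
  have B: "B \<in> carrier_mat ?N ?N" unfolding B_def using HX H by simp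
  have BT: "B\<^sup>T = B"
    unfolding B_def transpose_mult[OF HX H(1)] transpose_mult[OF H(1) X(1)] H(2) X(2)
    by (rule assoc_mult_mat[OF H(1) X(1) H(1), symmetric])
  have Hu: "H *\<^sub>v u = ?e"
    using assoc_mult_mat_vec[OF H(1) H(1), of ?e] H by simp
  have Be: "B *\<^sub>v ?e = e \<cdot>\<^sub>v ?e"
  proof -
    have "B *\<^sub>v ?e = H *\<^sub>v (X *\<^sub>v (H *\<^sub>v ?e))"
      unfolding B_def using assoc_mult_mat_vec[OF HX H(1), of ?e] assoc_mult_mat_vec[OF H(1) X(1), of "H *\<^sub>v ?e"] H u(1)
      by simp
    then show ?thesis using H u Hu mult_mat_vec[OF H(1) u(1)] by simp
  qed
  have B0: "B $$ (i, 0) = (if i = 0 then e else 0)" if i: "i < ?N" for i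
  proof -
    have "(B *\<^sub>v ?e) $ i = B $$ (i, 0)" using B i by simp
    then show ?thesis unfolding Be using i by (cases "i = 0") auto
  qed
  have B0': "B $$ (0, i) = (if i = 0 then e else 0)" if i: "i < ?N" for i
    using B0[OF i] BT B i index_transpose_mat(1)[of i B 0] by simp
  define B' where "B' = mat n n (\<lambda>(i, j). B $$ (Suc i, Suc j))"
  have B': "B' \<in> carrier_mat n n" unfolding B'_def by simp
  have "symmetric_mat n B'"
    unfolding symmetric_mat_def
  proof
    show "B'\<^sup>T = B'"
    proof (rule eq_matI)
      fix i j assume "i < dim_row B'" "j < dim_col B'"
      then have ij: "i < n" "j < n" using B' by auto
      have "B $$ (Suc j, Suc i) = B\<^sup>T $$ (Suc i, Suc j)" using B ij by simp
      then show "B'\<^sup>T $$ (i, j) = B' $$ (i, j)" unfolding BT using ij unfolding B'_def by simp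
    qed (use B' in auto)
  qed (rule B')
  from Suc.IH[OF this] obtain U d where U: "U \<in> carrier_mat n n" "U\<^sup>T * U = 1\<^sub>m n" "U * U\<^sup>T = 1\<^sub>m n"
    "B' = U * mat_diag n d * U\<^sup>T" by blast
  define E where "E = mat 1 1 (\<lambda>_. e)"
  have E: "E \<in> carrier_mat 1 1" unfolding E_def by simp
  have Bb: "B = four_block_mat E (0\<^sub>m 1 n) (0\<^sub>m n 1) B'"
    by (rule eq_matI) (use B B0 B0' in \<open>auto simp: E_def B'_def\<close>)
  define F where "F = four_block_mat (1\<^sub>m 1) (0\<^sub>m 1 n) (0\<^sub>m n 1) U"
  have F: "F \<in> carrier_mat ?N ?N" unfolding F_def using U four_block_carrier_mat[of "1\<^sub>m 1" 1 1 U n n] by simp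
  have FT: "F\<^sup>T = four_block_mat (1\<^sub>m 1) (0\<^sub>m 1 n) (0\<^sub>m n 1) (U\<^sup>T)"
    unfolding F_def using transpose_four_block_mat[of "1\<^sub>m 1" 1 1 "0\<^sub>m 1 n" n "0\<^sub>m n 1" n U] U by simp
  have F1: "F\<^sup>T * F = 1\<^sub>m ?N"
    unfolding FT unfolding F_def
    by (subst mult_four_block_mat[of _ 1 1 _ n _ n _ _ 1 _ n]) (use U in auto)
  have F2: "F * F\<^sup>T = 1\<^sub>m ?N"
    unfolding FT unfolding F_def
    by (subst mult_four_block_mat[of _ 1 1 _ n _ n _ _ 1 _ n]) (use U in auto)
  define d' where "d' i = (case i of 0 \<Rightarrow> e | Suc k \<Rightarrow> d k)" for i
  have D: "mat_diag ?N d' = four_block_mat E (0\<^sub>m 1 n) (0\<^sub>m n 1) (mat_diag n d)"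
    by (rule eq_matI) (auto simp: E_def d'_def mat_diag_def split: nat.splits)
  define G where "G = mat_diag n d"
  have G: "G \<in> carrier_mat n n" unfolding G_def by simp
  define R where "R = U * G"
  have R: "R \<in> carrier_mat n n" unfolding R_def using U G by simp
  have FD: "F * mat_diag ?N d' = four_block_mat E (0\<^sub>m 1 n) (0\<^sub>m n 1) R"
    unfolding D F_def G_def[symmetric]
    by (subst mult_four_block_mat[of _ 1 1 _ n _ n _ _ 1 _ n]) (use U G E in \<open>auto simp: R_def\<close>)
  have FDF: "F * mat_diag ?N d' * F\<^sup>T = B"
    unfolding FD FT Bb U(4) G_def[symmetric] R_def[symmetric]
    by (subst mult_four_block_mat[of _ 1 1 _ n _ n _ _ 1 _ n]) (use U R E in auto)
  have Dc: "mat_diag ?N d' \<in> carrier_mat ?N ?N" by simp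
  have Ft: "F\<^sup>T \<in> carrier_mat ?N ?N" using F by simp
  define V where "V = H * F"
  have V: "V \<in> carrier_mat ?N ?N" unfolding V_def using H F by simp
  have VT: "V\<^sup>T = F\<^sup>T * H" unfolding V_def transpose_mult[OF H(1) F] H(2) ..
  have cancel: "H * (H * R) = R" if R: "R \<in> carrier_mat ?N ?N" for R
  proof -
    have "H * (H * R) = (H * H) * R" by (rule assoc_mult_mat[symmetric, OF H(1) H(1) R])
    then show ?thesis unfolding H(3) using R by simp
  qed
  have "V\<^sup>T * V = F\<^sup>T * (H * V)" unfolding VT by (rule assoc_mult_mat[OF Ft H(1) V])
  also have "H * V = F" unfolding V_def by (rule cancel[OF F])
  finally have V1: "V\<^sup>T * V = 1\<^sub>m ?N" unfolding F1 .
  have V2: "V * V\<^sup>T = 1\<^sub>m ?N"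
    by (rule mat_mult_left_right_inverse[OF _ V V1]) (use V in simp)
  define K where "K = F * mat_diag ?N d'"
  have K: "K \<in> carrier_mat ?N ?N" unfolding K_def using F Dc by (rule mult_carrier_mat)
  have FtH: "F\<^sup>T * H \<in> carrier_mat ?N ?N" using Ft H(1) by (rule mult_carrier_mat)
  have VD: "V * mat_diag ?N d' = H * K" unfolding V_def K_def by (rule assoc_mult_mat[OF H(1) F Dc])
  have "V * mat_diag ?N d' * V\<^sup>T = H * (K * (F\<^sup>T * H))"
    unfolding VD VT by (rule assoc_mult_mat[OF H(1) K FtH])
  also have "K * (F\<^sup>T * H) = K * F\<^sup>T * H" by (rule assoc_mult_mat[symmetric, OF K Ft H(1)])
  also have "\<dots> = H * X * H * H" unfolding K_def FDF B_def ..
  also have "\<dots> = H * X * (H * H)" by (rule assoc_mult_mat[OF HX H(1) H(1)])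
  also have "\<dots> = H * X" unfolding H(3) by (rule right_mult_one_mat[OF HX])
  also have "H * (H * X) = X" by (rule cancel[OF X(1)])
  finally have "X = V * mat_diag ?N d' * V\<^sup>T" ..
  then show ?case using V V1 V2 by blast
qed

section \<open>Root multiplicities and the nuclear norm\<close>

lemma order_prod_linear_factors:
  fixes as :: "'a :: field list"
  shows "Polynomial.order l (\<Prod>a\<leftarrow>as. [:- a, 1:]) = count_list as l"
proof (induction as)
  case (Cons a as)
  let ?p = "\<Prod>a\<leftarrow>as. [:- a, 1:]"
  have "0 \<notin> set (map (\<lambda>a. [:- a, 1:]) as)" by auto
  then have nz: "?p \<noteq> 0" by (simp only: prod_list_zero_iff not_False_eq_True)
  have "Polynomial.order l [:- a, 1:] = (if a = l then 1 else 0)"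
  proof (cases "a = l")
    case True
    then show ?thesis using order_power_n_n[of l 1] by simp
  next
    case False
    then show ?thesis by (simp add: order_0I)
  qed
  moreover have "[:- a, 1:] * ?p \<noteq> 0" using nz by (metis mult_eq_0_iff pCons_eq_0_iff zero_neq_one)
  ultimately show ?case using Cons order_mult[of "[:- a, 1:]" ?p l] by (simp del: mult_pCons_left)
qed simp

text \<open>\<open>nuclear_norm\<close> sums over distinct roots weighted by their order, while a
  diagonalization supplies a list of roots with repetitions. For a polynomial that splits, the two
  sums agree.\<close>

lemma sum_order_linear_factors:
  fixes as :: "real list"
  assumes p: "p = (\<Prod>a\<leftarrow>as. [:- a, 1:])"
  shows "(\<Sum>l | poly p l = 0. real (Polynomial.order l p) * f l) = (\<Sum>a\<leftarrow>as. f a)"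
proof -
  have "{l. poly p l = 0} = set as"
    unfolding p by (induction as) auto
  then have "(\<Sum>l | poly p l = 0. real (Polynomial.order l p) * f l) =
      (\<Sum>l\<in>set as. real (count_list as l) * f l)"
    unfolding p order_prod_linear_factors by simp
  also have "\<dots> = (\<Sum>a\<leftarrow>as. f a)"
  proof -
    have "(\<Sum>a\<leftarrow>xs. f a) = (\<Sum>l\<in>S. real (count_list xs l) * f l)"
      if "finite S" "set xs \<subseteq> S" for xs S
      using that
    proof (induction xs)
      case (Cons x xs)
      have "(\<Sum>l\<in>S. real (count_list (x # xs) l) * f l) =
          (\<Sum>l\<in>S. real (count_list xs l) * f l + (if l = x then f l else 0))"
        by (intro sum.cong) (auto simp: algebra_simps)
      then show ?case using Cons by (simp add: sum.distrib)
    qed simp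
    from this[of "set as" as] show ?thesis by simp
  qed
  finally show ?thesis .
qed

lemma diagonalization_mult:
  fixes U :: "real mat"
  assumes U: "U \<in> carrier_mat n n" "U\<^sup>T * U = 1\<^sub>m n"
  shows "(U * mat_diag n d * U\<^sup>T) * (U * mat_diag n f * U\<^sup>T) = U * mat_diag n (\<lambda>i. d i * f i) * U\<^sup>T"
proof -
  have D: "mat_diag n g \<in> carrier_mat n n" for g :: "nat \<Rightarrow> real" by simp
  have Ut: "U\<^sup>T \<in> carrier_mat n n" using U by simp
  have UD: "U * mat_diag n g \<in> carrier_mat n n" for g by (rule mult_carrier_mat[OF U(1) D])
  have DU: "mat_diag n f * U\<^sup>T \<in> carrier_mat n n" by (rule mult_carrier_mat[OF D Ut])
  have X: "U * mat_diag n f * U\<^sup>T \<in> carrier_mat n n" by (rule mult_carrier_mat[OF UD Ut])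
  have "U\<^sup>T * (U * mat_diag n f * U\<^sup>T) = U\<^sup>T * (U * (mat_diag n f * U\<^sup>T))"
    using assoc_mult_mat[OF U(1) D Ut] by simp
  also have "\<dots> = U\<^sup>T * U * (mat_diag n f * U\<^sup>T)" by (rule assoc_mult_mat[symmetric, OF Ut U(1) DU])
  also have "\<dots> = mat_diag n f * U\<^sup>T" unfolding U(2) by (rule left_mult_one_mat[OF DU])
  finally have 1: "U\<^sup>T * (U * mat_diag n f * U\<^sup>T) = mat_diag n f * U\<^sup>T" .
  have "(U * mat_diag n d * U\<^sup>T) * (U * mat_diag n f * U\<^sup>T) = U * mat_diag n d * (mat_diag n f * U\<^sup>T)"
    unfolding assoc_mult_mat[OF UD Ut X] 1 ..
  also have "\<dots> = U * mat_diag n d * mat_diag n f * U\<^sup>T" by (rule assoc_mult_mat[symmetric, OF UD D Ut])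
  also have "U * mat_diag n d * mat_diag n f = U * mat_diag n (\<lambda>i. d i * f i)"
    unfolding assoc_mult_mat[OF U(1) D D] mat_diag_diag ..
  finally show ?thesis .
qed

text \<open>\<open>X\<^sup>T * X\<close> is similar to the diagonal matrix with entries
  \<open>d i * d i\<close>, so its characteristic polynomial splits, and the square roots are the
  absolute values of the \<open>d i\<close>.\<close>

lemma nuclear_norm_diagonalization:
  assumes U: "U \<in> carrier_mat n n" "U\<^sup>T * U = 1\<^sub>m n" "U * U\<^sup>T = 1\<^sub>m n"
    and X: "X = U * mat_diag n d * U\<^sup>T"
  shows "nuclear_norm X = (\<Sum>i<n. \<bar>d i\<bar>)"
proof -
  let ?D = "mat_diag n d"
  let ?D2 = "mat_diag n (\<lambda>i. d i * d i)"
  have D: "?D \<in> carrier_mat n n" and D2: "?D2 \<in> carrier_mat n n" by auto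
  have Ut: "U\<^sup>T \<in> carrier_mat n n" using U by simp
  have UD: "U * ?D \<in> carrier_mat n n" using U by simp
  have DT: "?D\<^sup>T = ?D" by (intro eq_matI) (auto simp: mat_diag_def)
  have XT: "X\<^sup>T = X"
    unfolding X transpose_mult[OF UD Ut] transpose_mult[OF U(1) D] DT
    using assoc_mult_mat[OF U(1) D Ut] by simp
  have XX: "X\<^sup>T * X = U * ?D2 * U\<^sup>T"
    unfolding XT unfolding X by (rule diagonalization_mult[OF U(1,2)])
  have Xc: "X \<in> carrier_mat n n" unfolding X by (rule mult_carrier_mat[OF UD Ut])
  have "X\<^sup>T * X \<in> carrier_mat n n" unfolding XT by (rule mult_carrier_mat[OF Xc Xc])
  then have "similar_mat_wit (X\<^sup>T * X) ?D2 U U\<^sup>T"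
    by (intro similar_mat_witI[OF U(3,2) XX]) (use U(1) Ut D2 in auto)
  then have "similar_mat (X\<^sup>T * X) ?D2" unfolding similar_mat_def by blast
  then have "char_poly (X\<^sup>T * X) = char_poly ?D2" by (rule char_poly_similar)
  also have "\<dots> = (\<Prod>a\<leftarrow>diag_mat ?D2. [:- a, 1:])"
    by (rule char_poly_upper_triangular[OF D2]) (auto simp: mat_diag_def)
  finally have "nuclear_norm X = (\<Sum>a\<leftarrow>diag_mat ?D2. sqrt a)"
    unfolding nuclear_norm_def Let_def by (rule sum_order_linear_factors)
  also have "\<dots> = (\<Sum>i<n. \<bar>d i\<bar>)"
    by (simp add: diag_mat_def mat_diag_def interv_sum_list_conv_sum_set_nat lessThan_atLeast0 o_def cong: map_cong)
  finally show ?thesis .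
qed

section \<open>Norm bounds for Lyapunov solutions\<close>

definition mat_trace :: "real mat \<Rightarrow> real" where
  "mat_trace A = (\<Sum>i<dim_row A. A $$ (i, i))"

lemma mat_trace_add:
  assumes "A \<in> carrier_mat n n" "B \<in> carrier_mat n n"
  shows "mat_trace (A + B) = mat_trace A + mat_trace B"
  using assms by (simp add: mat_trace_def sum.distrib)

lemma mat_trace_uminus:
  assumes "A \<in> carrier_mat n n"
  shows "mat_trace (- A) = - mat_trace A"
  using assms by (simp add: mat_trace_def sum_negf)

lemma mat_trace_comm:
  assumes A: "A \<in> carrier_mat n m" and B: "B \<in> carrier_mat m n"
  shows "mat_trace (A * B) = mat_trace (B * A)"
proof -
  have "mat_trace (A * B) = (\<Sum>i<n. \<Sum>j<m. A $$ (i, j) * B $$ (j, i))"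
    using A B by (simp add: mat_trace_def scalar_prod_def lessThan_atLeast0)
  also have "\<dots> = (\<Sum>j<m. \<Sum>i<n. B $$ (j, i) * A $$ (i, j))"
    by (subst sum.swap) (simp add: mult.commute)
  also have "\<dots> = mat_trace (B * A)"
    using A B by (simp add: mat_trace_def scalar_prod_def lessThan_atLeast0)
  finally show ?thesis .
qed

lemma mat_trace_diag_mult:
  assumes "B \<in> carrier_mat n n"
  shows "mat_trace (mat_diag n d * B) = (\<Sum>i<n. d i * B $$ (i, i))"
  unfolding mat_diag_mult_left[OF assms] mat_trace_def by simp

lemma congruence_diagonal:
  fixes A Q :: "real mat"
  assumes A: "A \<in> carrier_mat n m" and Q: "Q \<in> carrier_mat n n" and j: "j < m"
  shows "(A\<^sup>T * Q * A) $$ (j, j) = (A *\<^sub>v unit_vec m j) \<bullet> (Q *\<^sub>v (A *\<^sub>v unit_vec m j))"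
proof -
  have At: "A\<^sup>T \<in> carrier_mat m n" using A by simp
  have AQ: "A\<^sup>T * Q \<in> carrier_mat m n" using At Q by simp
  have e: "unit_vec m j \<in> carrier_vec m" by simp
  have Ae: "A *\<^sub>v unit_vec m j \<in> carrier_vec n" using A by simp
  have T: "A\<^sup>T * Q * A \<in> carrier_mat m m" using AQ A by simp
  have "(A\<^sup>T * Q * A) $$ (j, j) = unit_vec m j \<bullet> ((A\<^sup>T * Q * A) *\<^sub>v unit_vec m j)"
    by (rule unit_vec_form[OF T j j, symmetric])
  also have "(A\<^sup>T * Q * A) *\<^sub>v unit_vec m j = A\<^sup>T *\<^sub>v (Q *\<^sub>v (A *\<^sub>v unit_vec m j))"
    using assoc_mult_mat_vec[OF AQ A e] assoc_mult_mat_vec[OF At Q Ae] by simp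
  also have "unit_vec m j \<bullet> \<dots> = (A\<^sup>T *\<^sub>v (Q *\<^sub>v (A *\<^sub>v unit_vec m j))) \<bullet> unit_vec m j"
    by (rule comm_scalar_prod[of _ m]) (use At Q Ae in auto)
  also have "\<dots> = (Q *\<^sub>v (A *\<^sub>v unit_vec m j)) \<bullet> (A *\<^sub>v unit_vec m j)"
    by (rule transpose_vec_mult_scalar[OF A e]) (use Q Ae in simp)
  also have "\<dots> = (A *\<^sub>v unit_vec m j) \<bullet> (Q *\<^sub>v (A *\<^sub>v unit_vec m j))"
    by (rule comm_scalar_prod[of _ n]) (use Q Ae in auto)
  finally show ?thesis .
qed

text \<open>By cyclicity of the trace the Lyapunov operators of \<open>M\<close> and
  \<open>M\<^sup>T\<close> are adjoint: pairing \<open>S\<close> with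
  \<open>M\<^sup>T Q + Q M\<close> equals pairing \<open>M S + S M\<^sup>T\<close> with
  \<open>Q\<close>. Hence so are the solution operators.\<close>

lemma lyapunov_trace_duality:
  assumes M: "M \<in> carrier_mat n n" and Y: "Y \<in> carrier_mat n n" and R: "R \<in> carrier_mat n n"
    and S: "is_lyap_sol M Y S" and Q: "is_lyap_sol M\<^sup>T R Q"
  shows "mat_trace (S * R) = mat_trace (Y * Q)"
proof -
  have Mt: "M\<^sup>T \<in> carrier_mat n n" using M by simp
  have S': "S \<in> carrier_mat n n" "M * S + S * M\<^sup>T = - Y"
    using S is_lyap_sol_iff[OF M Y] by auto
  have Q': "Q \<in> carrier_mat n n" "M\<^sup>T * Q + Q * M = - R"
    using Q is_lyap_sol_iff[OF Mt R] by auto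
  have c: "M * S \<in> carrier_mat n n" "S * M\<^sup>T \<in> carrier_mat n n" "M\<^sup>T * Q \<in> carrier_mat n n"
    "Q * M \<in> carrier_mat n n" using M Mt S' Q' by auto
  have "- mat_trace (S * R) = mat_trace (S * (- R))"
    using S' R by (simp add: mat_trace_uminus[of _ n, symmetric])
  also have "S * (- R) = S * (M\<^sup>T * Q) + S * (Q * M)"
    unfolding Q'(2)[symmetric] by (rule mult_add_distrib_mat[OF S'(1) c(3,4)])
  also have "mat_trace \<dots> = mat_trace (S * (M\<^sup>T * Q)) + mat_trace (S * (Q * M))"
    by (rule mat_trace_add[of _ n]) (use S' c in auto)
  also have "S * (M\<^sup>T * Q) = S * M\<^sup>T * Q" by (rule assoc_mult_mat[symmetric, OF S'(1) Mt Q'(1)])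
  also have "mat_trace (S * (Q * M)) = mat_trace (S * Q * M)"
    by (simp add: assoc_mult_mat[OF S'(1) Q'(1) M])
  also have "\<dots> = mat_trace (M * (S * Q))" by (rule mat_trace_comm[of _ n n]) (use S' Q' M in auto)
  also have "M * (S * Q) = M * S * Q" by (rule assoc_mult_mat[symmetric, OF M S'(1) Q'(1)])
  also have "mat_trace (S * M\<^sup>T * Q) + mat_trace (M * S * Q) = mat_trace (M * S * Q + S * M\<^sup>T * Q)"
    using c Q' by (subst mat_trace_add[of _ n]) auto
  also have "M * S * Q + S * M\<^sup>T * Q = (M * S + S * M\<^sup>T) * Q"
    by (rule add_mult_distrib_mat[symmetric, OF c(1,2) Q'(1)])
  also have "\<dots> = - (Y * Q)" unfolding S'(2) using Y Q' by simp
  also have "mat_trace \<dots> = - mat_trace (Y * Q)"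
    by (rule mat_trace_uminus[of _ n]) (use Y Q' in auto)
  finally show ?thesis by simp
qed

section \<open>Stability of block systems and symmetry of solutions\<close>

lemma append_vec_cases:
  assumes "w \<in> carrier_vec (n + m)"
  obtains w1 w2 where "w1 \<in> carrier_vec n" "w2 \<in> carrier_vec m" "w = w1 @\<^sub>v w2"
  using that[of "vec_first w n" "vec_last w m"] assms by simp

text \<open>Split an eigenvector into its two parts. A nonzero first part is an eigenvector of
  \<open>A\<close>; if it vanishes, the second part is an eigenvector of \<open>D\<close>.\<close>

lemma hurwitz_four_block_lower:
  assumes A: "A \<in> carrier_mat n n" and C: "C \<in> carrier_mat m n" and D: "D \<in> carrier_mat m m"
    and h: "hurwitz A" "hurwitz D"
  shows "hurwitz (four_block_mat A (0\<^sub>m n m) C D)"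
  unfolding hurwitz_def
proof (intro allI impI)
  let ?c = "map_mat complex_of_real"
  let ?F = "four_block_mat A (0\<^sub>m n m) C D"
  fix z assume z: "eigenvalue (?c ?F) z"
  have F: "?F \<in> carrier_mat (n + m) (n + m)" using A D by simp
  have cA: "?c A \<in> carrier_mat n n" and cC: "?c C \<in> carrier_mat m n" and cD: "?c D \<in> carrier_mat m m"
    using A C D by auto
  have cF: "?c ?F = four_block_mat (?c A) (0\<^sub>m n m) (?c C) (?c D)"
    by (rule eq_matI) (use A C D in auto)
  obtain v where v: "v \<in> carrier_vec (n + m)" "v \<noteq> 0\<^sub>v (n + m)" "?c ?F *\<^sub>v v = z \<cdot>\<^sub>v v"
    using z F unfolding eigenvalue_def eigenvector_def by auto
  obtain v1 v2 where s: "v1 \<in> carrier_vec n" "v2 \<in> carrier_vec m" "v = v1 @\<^sub>v v2"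
    using append_vec_cases[OF v(1)] by blast
  have sm: "z \<cdot>\<^sub>v (v1 @\<^sub>v v2) = (z \<cdot>\<^sub>v v1) @\<^sub>v (z \<cdot>\<^sub>v v2)" by (intro eq_vecI) auto
  have "(?c A *\<^sub>v v1 + 0\<^sub>m n m *\<^sub>v v2) @\<^sub>v (?c C *\<^sub>v v1 + ?c D *\<^sub>v v2) = (z \<cdot>\<^sub>v v1) @\<^sub>v (z \<cdot>\<^sub>v v2)"
    using v(3) unfolding cF s(3) sm four_block_mat_mult_vec[OF cA zero_carrier_mat cC cD s(1,2)] .
  moreover have "?c A *\<^sub>v v1 + 0\<^sub>m n m *\<^sub>v v2 \<in> carrier_vec n" "z \<cdot>\<^sub>v v1 \<in> carrier_vec n"
    using s cA by auto
  ultimately have e: "?c A *\<^sub>v v1 + 0\<^sub>m n m *\<^sub>v v2 = z \<cdot>\<^sub>v v1" "?c C *\<^sub>v v1 + ?c D *\<^sub>v v2 = z \<cdot>\<^sub>v v2"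
    by (metis append_vec_eq)+
  have e1: "?c A *\<^sub>v v1 = z \<cdot>\<^sub>v v1" using e(1) s cA by simp
  show "Re z < 0"
  proof (cases "v1 = 0\<^sub>v n")
    case False
    then have "eigenvalue (?c A) z"
      using e1 s A unfolding eigenvalue_def eigenvector_def by auto
    then show ?thesis using h unfolding hurwitz_def by blast
  next
    case True
    have "?c C *\<^sub>v 0\<^sub>v n = 0\<^sub>v m" using cC by (intro eq_vecI) auto
    then have "?c D *\<^sub>v v2 = z \<cdot>\<^sub>v v2" using e(2) s cD True by simp
    moreover have "v2 \<noteq> 0\<^sub>v m"
    proof
      assume "v2 = 0\<^sub>v m"
      then have "v = 0\<^sub>v (n + m)" using True s by (intro eq_vecI) auto
      then show False using v by simp
    qed
    ultimately have "eigenvalue (?c D) z"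
      using s D unfolding eigenvalue_def eigenvector_def by auto
    then show ?thesis using h unfolding hurwitz_def by blast
  qed
qed

text \<open>The transpose solves the same equation, so uniqueness makes it equal to
  \<open>S\<close>.\<close>

lemma lyap_sol_symmetric:
  assumes M: "M \<in> carrier_mat n n" and h: "hurwitz M" and Y: "symmetric_mat n Y"
    and S: "is_lyap_sol M Y S"
  shows "symmetric_mat n S"
proof -
  have Y': "Y \<in> carrier_mat n n" "Y\<^sup>T = Y" using Y unfolding symmetric_mat_def by auto
  have Mt: "M\<^sup>T \<in> carrier_mat n n" using M by simp
  have S': "S \<in> carrier_mat n n" "M * S + S * M\<^sup>T = - Y"
    using S is_lyap_sol_iff[OF M Y'(1)] by auto
  have St: "S\<^sup>T \<in> carrier_mat n n" using S' by simp
  have "M * S\<^sup>T + S\<^sup>T * M\<^sup>T = (S * M\<^sup>T + M * S)\<^sup>T"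
    using transpose_add[OF mult_carrier_mat[OF S'(1) Mt] mult_carrier_mat[OF M S'(1)]]
      transpose_mult[OF S'(1) Mt] transpose_mult[OF M S'(1)] by simp
  also have "S * M\<^sup>T + M * S = M * S + S * M\<^sup>T"
    by (rule comm_add_mat[of _ n n]) (use M Mt S' in auto)
  also have "(M * S + S * M\<^sup>T)\<^sup>T = - Y" unfolding S'(2) transpose_uminus Y'(2) ..
  finally have "is_lyap_sol M Y S\<^sup>T" using is_lyap_sol_iff[OF M Y'(1)] St by blast
  then have "S\<^sup>T = S" using lyap_sol_ex1[OF M h Y'(1)] S by blast
  then show ?thesis unfolding symmetric_mat_def using S' by simp
qed

text \<open>Since \<open>X\<close> dissipates at least \<open>w \<bullet> w\<close> and the source
  of \<open>S\<close> is at most \<open>y\<close> times that in absolute value, the derivatives of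
  \<open>y X + S\<close> and \<open>y X - S\<close> are both nonpositive, and comparison applies to
  each. The coefficient is called \<open>N\<close> because the lemma serves both
  \<open>M\<^sup>T\<close> and \<open>M\<close>.\<close>

lemma lyapunov_form_bound:
  fixes X S Y N :: "real mat"
  assumes N: "N \<in> carrier_mat n n" and h: "hurwitz N"
    and X: "X \<in> carrier_mat n n" and S: "S \<in> carrier_mat n n"
    and Xle: "\<And>w. w \<in> carrier_vec n \<Longrightarrow> w \<bullet> (X *\<^sub>v (N *\<^sub>v w)) + (N *\<^sub>v w) \<bullet> (X *\<^sub>v w) \<le> - (w \<bullet> w)"
    and Seq: "\<And>w. w \<in> carrier_vec n \<Longrightarrow> w \<bullet> (S *\<^sub>v (N *\<^sub>v w)) + (N *\<^sub>v w) \<bullet> (S *\<^sub>v w) = - (w \<bullet> (Y *\<^sub>v w))"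
    and Yle: "\<And>w. w \<in> carrier_vec n \<Longrightarrow> \<bar>w \<bullet> (Y *\<^sub>v w)\<bar> \<le> y * (w \<bullet> w)" and y: "0 \<le> y"
    and v: "v \<in> carrier_vec n"
  shows "\<bar>v \<bullet> (S *\<^sub>v v)\<bar> \<le> y * (v \<bullet> (X *\<^sub>v v))"
proof -
  \<comment> \<open>\<open>s\<close> stands for the sign of \<open>S\<close>, so that one proof
    covers both combinations.\<close>
  have nn: "0 \<le> v \<bullet> ((y \<cdot>\<^sub>m X + s \<cdot>\<^sub>m S) *\<^sub>v v)" if s: "\<bar>s\<bar> = 1" for s
  proof (rule lyapunov_ineq_form_nonneg[OF N h _ _ v])
    show "y \<cdot>\<^sub>m X + s \<cdot>\<^sub>m S \<in> carrier_mat n n" using S by simp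
    fix w :: "real Matrix.vec" assume w: "w \<in> carrier_vec n"
    have f: "p \<bullet> ((y \<cdot>\<^sub>m X + s \<cdot>\<^sub>m S) *\<^sub>v q) = y * (p \<bullet> (X *\<^sub>v q)) + s * (p \<bullet> (S *\<^sub>v q))"
      if "p \<in> carrier_vec n" "q \<in> carrier_vec n" for p q
    proof -
      have "(y \<cdot>\<^sub>m X + s \<cdot>\<^sub>m S) *\<^sub>v q = y \<cdot>\<^sub>v (X *\<^sub>v q) + s \<cdot>\<^sub>v (S *\<^sub>v q)"
        using X S that by (subst add_mult_distrib_mat_vec[of _ n n]) (auto simp: smult_mult_mat_vec[of _ n n])
      moreover have "X *\<^sub>v q \<in> carrier_vec n" "S *\<^sub>v q \<in> carrier_vec n" using X S that by auto
      ultimately show ?thesis using that by (simp add: scalar_prod_add_distrib[of _ n])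
    qed
    have Nw: "N *\<^sub>v w \<in> carrier_vec n" using N w by simp
    have "w \<bullet> ((y \<cdot>\<^sub>m X + s \<cdot>\<^sub>m S) *\<^sub>v (N *\<^sub>v w)) + (N *\<^sub>v w) \<bullet> ((y \<cdot>\<^sub>m X + s \<cdot>\<^sub>m S) *\<^sub>v w) =
        y * (w \<bullet> (X *\<^sub>v (N *\<^sub>v w)) + (N *\<^sub>v w) \<bullet> (X *\<^sub>v w)) +
        s * (w \<bullet> (S *\<^sub>v (N *\<^sub>v w)) + (N *\<^sub>v w) \<bullet> (S *\<^sub>v w))"
      unfolding f[OF w Nw] f[OF Nw w] by (simp add: algebra_simps)
    also have "\<dots> \<le> y * (- (w \<bullet> w)) + s * (- (w \<bullet> (Y *\<^sub>v w)))"
      unfolding Seq[OF w] using mult_left_mono[OF Xle[OF w] y] by simp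
    also have "\<dots> \<le> 0" using Yle[OF w] s by (auto simp: abs_if split: if_splits)
    finally show "w \<bullet> ((y \<cdot>\<^sub>m X + s \<cdot>\<^sub>m S) *\<^sub>v (N *\<^sub>v w)) + (N *\<^sub>v w) \<bullet> ((y \<cdot>\<^sub>m X + s \<cdot>\<^sub>m S) *\<^sub>v w) \<le> 0" .
  qed
  have f: "v \<bullet> ((y \<cdot>\<^sub>m X + s \<cdot>\<^sub>m S) *\<^sub>v v) = y * (v \<bullet> (X *\<^sub>v v)) + s * (v \<bullet> (S *\<^sub>v v))" for s
  proof -
    have "(y \<cdot>\<^sub>m X + s \<cdot>\<^sub>m S) *\<^sub>v v = y \<cdot>\<^sub>v (X *\<^sub>v v) + s \<cdot>\<^sub>v (S *\<^sub>v v)"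
      using X S v by (subst add_mult_distrib_mat_vec[of _ n n]) (auto simp: smult_mult_mat_vec[of _ n n])
    moreover have "X *\<^sub>v v \<in> carrier_vec n" "S *\<^sub>v v \<in> carrier_vec n" using X S v by auto
    ultimately show ?thesis using v by (simp add: scalar_prod_add_distrib[of _ n])
  qed
  show ?thesis using nn[of 1] nn[of "-1"] unfolding f by simp
qed

text \<open>\<open>X\<close> and \<open>P\<close> are supersolutions of the Lyapunov equations of \<open>M\<close> and \<open>M\<^sup>T\<close> with right-hand
  side the identity. The first one bounds the solution operator in the operator norm, the second
  one in the dual nuclear norm.\<close>

locale lyapunov_supersolutions =
  fixes n :: nat and M X P :: "real mat" and a b :: real
  assumes n: "0 < n" and M: "M \<in> carrier_mat n n" and hM: "hurwitz M"
    and X: "symmetric_mat n X" and P: "P \<in> carrier_mat n n"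
    and X_ineq: "\<And>w. w \<in> carrier_vec n \<Longrightarrow>
      w \<bullet> (X *\<^sub>v (M\<^sup>T *\<^sub>v w)) + (M\<^sup>T *\<^sub>v w) \<bullet> (X *\<^sub>v w) \<le> - (w \<bullet> w)"
    and P_ineq: "\<And>w. w \<in> carrier_vec n \<Longrightarrow>
      w \<bullet> (P *\<^sub>v (M *\<^sub>v w)) + (M *\<^sub>v w) \<bullet> (P *\<^sub>v w) \<le> - (w \<bullet> w)"
    and X_le: "\<And>w. w \<in> carrier_vec n \<Longrightarrow> w \<bullet> (X *\<^sub>v w) \<le> a * (w \<bullet> w)"
    and P_le: "\<And>w. w \<in> carrier_vec n \<Longrightarrow> w \<bullet> (P *\<^sub>v w) \<le> b * (w \<bullet> w)"
begin

lemma Mt: "M\<^sup>T \<in> carrier_mat n n" using M by simp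

lemma hMt: "hurwitz M\<^sup>T" by (rule hurwitz_transpose[OF M hM])

lemma Xc: "X \<in> carrier_mat n n" using X unfolding symmetric_mat_def by simp

text \<open>Nonnegativity is a consequence of the dissipation inequality and stability. It therefore
  holds for certificates that are differences of positive matrices.\<close>

lemma X_nonneg: "w \<in> carrier_vec n \<Longrightarrow> 0 \<le> w \<bullet> (X *\<^sub>v w)"
  by (rule lyapunov_ineq_form_nonneg[OF Mt hMt Xc]) (use X_ineq vec_nonneg_self in \<open>force intro: order_trans\<close>)

lemma P_nonneg: "w \<in> carrier_vec n \<Longrightarrow> 0 \<le> w \<bullet> (P *\<^sub>v w)"
  by (rule lyapunov_ineq_form_nonneg[OF M hM P]) (use P_ineq vec_nonneg_self in \<open>force intro: order_trans\<close>)

lemma a_nonneg: "0 \<le> a"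
  using X_nonneg[of "unit_vec n 0"] X_le[of "unit_vec n 0"] n by simp

lemma b_nonneg: "0 \<le> b"
  using P_nonneg[of "unit_vec n 0"] P_le[of "unit_vec n 0"] n by simp

text \<open>Comparison bounds only quadratic forms of \<open>S\<close>; symmetry of \<open>S\<close>
  upgrades this to a bound of the operator norm.\<close>

lemma op_norm_lyap:
  assumes Y: "symmetric_mat n Y" and S: "is_lyap_sol M Y S"
  shows "op_norm S \<le> a * op_norm Y"
proof -
  have Yc: "Y \<in> carrier_mat n n" using Y unfolding symmetric_mat_def by simp
  have Ssym: "symmetric_mat n S" by (rule lyap_sol_symmetric[OF M hM Y S])
  have Sc: "S \<in> carrier_mat n n" using Ssym unfolding symmetric_mat_def by simp
  have y: "0 \<le> op_norm Y" by (rule op_norm_nonneg[OF Yc n])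
  have le: "\<bar>v \<bullet> (S *\<^sub>v v)\<bar> \<le> (a * op_norm Y) * (v \<bullet> v)" if v: "v \<in> carrier_vec n" for v
  proof -
    have "\<bar>v \<bullet> (S *\<^sub>v v)\<bar> \<le> op_norm Y * (v \<bullet> (X *\<^sub>v v))"
      by (rule lyapunov_form_bound[OF Mt hMt Xc Sc X_ineq lyap_sol_form[OF M Yc S]
            op_norm_quadratic_form[OF Yc] y v])
    also have "\<dots> \<le> op_norm Y * (a * (v \<bullet> v))" by (intro mult_left_mono X_le v y)
    finally show ?thesis by (simp add: mult_ac)
  qed
  show ?thesis by (rule op_norm_le[OF Sc n symmetric_norm_le[OF Ssym le]])
qed

text \<open>The operator-norm estimate for the adjoint equation, normalised to sources between
  \<open>-1\<close> and \<open>1\<close> in the order of quadratic forms. It is needed for the sign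
  matrix of a solution and for the identity.\<close>

lemma dual_form_bound:
  assumes R: "R \<in> carrier_mat n n" and Q: "is_lyap_sol M\<^sup>T R Q"
    and Rle: "\<And>w. w \<in> carrier_vec n \<Longrightarrow> \<bar>w \<bullet> (R *\<^sub>v w)\<bar> \<le> w \<bullet> w" and v: "v \<in> carrier_vec n"
  shows "\<bar>v \<bullet> (Q *\<^sub>v v)\<bar> \<le> b * (v \<bullet> v)"
proof -
  have Qc: "Q \<in> carrier_mat n n" using Q is_lyap_sol_iff[OF Mt R] by blast
  have "\<bar>v \<bullet> (Q *\<^sub>v v)\<bar> \<le> 1 * (v \<bullet> (P *\<^sub>v v))"
    by (rule lyapunov_form_bound[OF M hM P Qc P_ineq
          lyap_sol_form[OF Mt R Q, unfolded transpose_transpose] _ _ v]) (use Rle in auto)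
  then show ?thesis using P_le[OF v] by simp
qed

text \<open>The matrix \<open>R\<close> is the sign of \<open>S\<close>, that is, the maximiser in
  the trace duality of nuclear and operator norm: \<open>mat_trace (S * R)\<close> is the nuclear
  norm of \<open>S\<close>. Trace duality turns this into \<open>mat_trace (Y * Q)\<close> with
  \<open>Q\<close> bounded by \<open>b\<close>, and in an eigenbasis of \<open>Y\<close> the trace
  is a sum of eigenvalues of \<open>Y\<close> weighted by values of \<open>Q\<close> on unit
  vectors.\<close>

lemma nuclear_norm_lyap:
  assumes Y: "symmetric_mat n Y" and S: "is_lyap_sol M Y S"
  shows "nuclear_norm S \<le> b * nuclear_norm Y"
proof -
  have Yc: "Y \<in> carrier_mat n n" using Y unfolding symmetric_mat_def by simp
  have Ssym: "symmetric_mat n S" by (rule lyap_sol_symmetric[OF M hM Y S])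
  obtain U d where U: "U \<in> carrier_mat n n" "U\<^sup>T * U = 1\<^sub>m n" "U * U\<^sup>T = 1\<^sub>m n"
    and YU: "Y = U * mat_diag n d * U\<^sup>T" using symmetric_diagonalization[OF Y] by blast
  obtain V e where V: "V \<in> carrier_mat n n" "V\<^sup>T * V = 1\<^sub>m n" "V * V\<^sup>T = 1\<^sub>m n"
    and SV: "S = V * mat_diag n e * V\<^sup>T" using symmetric_diagonalization[OF Ssym] by blast
  have Ut: "U\<^sup>T \<in> carrier_mat n n" and Vt: "V\<^sup>T \<in> carrier_mat n n" using U V by auto
  define R where "R = V * mat_diag n (\<lambda>i. sgn (e i)) * V\<^sup>T"
  have D: "mat_diag n f \<in> carrier_mat n n" for f :: "nat \<Rightarrow> real" by simp
  have VD: "V * mat_diag n f \<in> carrier_mat n n" for f by (rule mult_carrier_mat[OF V(1) D])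
  have Rc: "R \<in> carrier_mat n n" unfolding R_def by (rule mult_carrier_mat[OF VD Vt])
  have Rle: "\<bar>w \<bullet> (R *\<^sub>v w)\<bar> \<le> w \<bullet> w" if w: "w \<in> carrier_vec n" for w
  proof -
    define x where "x = V\<^sup>T *\<^sub>v w"
    have x: "x \<in> carrier_vec n" unfolding x_def using Vt w by simp
    have Dx: "mat_diag n (\<lambda>i. sgn (e i)) *\<^sub>v x \<in> carrier_vec n" by (rule mult_mat_vec_carrier[OF D x])
    have "w \<bullet> (R *\<^sub>v w) = w \<bullet> (V *\<^sub>v (mat_diag n (\<lambda>i. sgn (e i)) *\<^sub>v x))"
      unfolding R_def x_def using assoc_mult_mat_vec[OF VD Vt w] assoc_mult_mat_vec[OF V(1) D, of "V\<^sup>T *\<^sub>v w"] Vt w by simp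
    also have "\<dots> = x \<bullet> (mat_diag n (\<lambda>i. sgn (e i)) *\<^sub>v x)"
      unfolding x_def by (rule transpose_vec_mult_scalar[OF V(1) _ w, symmetric]) (use Dx x_def in simp)
    also have "\<dots> = (\<Sum>i<n. sgn (e i) * (x $ i)\<^sup>2)"
    proof -
      have "(mat_diag n (\<lambda>i. sgn (e i)) *\<^sub>v x) $ i = sgn (e i) * x $ i" if i: "i < n" for i
      proof -
        have "(mat_diag n (\<lambda>i. sgn (e i)) *\<^sub>v x) $ i = (\<Sum>j<n. (if i = j then sgn (e j) else 0) * x $ j)"
          using i x by (simp add: mat_diag_def scalar_prod_def lessThan_atLeast0)
        also have "\<dots> = (\<Sum>j<n. if i = j then sgn (e j) * x $ j else 0)"
          by (intro sum.cong) auto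
        finally show ?thesis using i by simp
      qed
      then show ?thesis using x by (simp add: scalar_prod_def[of x] mat_diag_def lessThan_atLeast0
            power2_eq_square mult_ac)
    qed
    finally have "\<bar>w \<bullet> (R *\<^sub>v w)\<bar> \<le> (\<Sum>i<n. \<bar>sgn (e i) * (x $ i)\<^sup>2\<bar>)" by simp
    also have "\<dots> \<le> (\<Sum>i<n. x $ i * x $ i)"
      by (intro sum_mono) (auto simp: abs_mult sgn_if power2_eq_square)
    also have "\<dots> = x \<bullet> x" using x by (simp add: scalar_prod_def lessThan_atLeast0)
    also have "\<dots> = w \<bullet> (V *\<^sub>v x)"
      unfolding x_def by (rule transpose_vec_mult_scalar[OF V(1) _ w]) (use x x_def in simp)
    also have "V *\<^sub>v x = w" unfolding x_def using assoc_mult_mat_vec[OF V(1) Vt w] V(3) w by simp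
    finally show ?thesis .
  qed
  obtain Q where Q: "is_lyap_sol M\<^sup>T R Q" using lyap_sol_ex1[OF Mt hMt Rc] by blast
  have Qc: "Q \<in> carrier_mat n n" using Q is_lyap_sol_iff[OF Mt Rc] by blast
  have UD: "U * mat_diag n d \<in> carrier_mat n n" by (rule mult_carrier_mat[OF U(1) D])
  have UQ: "U\<^sup>T * Q \<in> carrier_mat n n" by (rule mult_carrier_mat[OF Ut Qc])
  have DUQ: "mat_diag n d * (U\<^sup>T * Q) \<in> carrier_mat n n" by (rule mult_carrier_mat[OF D UQ])
  have "S * R = V * mat_diag n (\<lambda>i. e i * sgn (e i)) * V\<^sup>T"
    unfolding SV R_def by (rule diagonalization_mult[OF V(1,2)])
  also have "(\<lambda>i. e i * sgn (e i)) = (\<lambda>i. \<bar>e i\<bar>)" by (simp add: abs_sgn)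
  finally have "mat_trace (S * R) = mat_trace (V * mat_diag n (\<lambda>i. \<bar>e i\<bar>) * V\<^sup>T)" by simp
  also have "\<dots> = mat_trace (V\<^sup>T * (V * mat_diag n (\<lambda>i. \<bar>e i\<bar>)))"
    by (rule mat_trace_comm[OF VD Vt])
  also have "V\<^sup>T * (V * mat_diag n (\<lambda>i. \<bar>e i\<bar>)) = mat_diag n (\<lambda>i. \<bar>e i\<bar>)"
    unfolding assoc_mult_mat[symmetric, OF Vt V(1) D] V(2) by (rule left_mult_one_mat[OF D])
  also have "mat_trace \<dots> = (\<Sum>i<n. \<bar>e i\<bar>)" by (simp add: mat_trace_def mat_diag_def)
  also have "\<dots> = nuclear_norm S" by (rule nuclear_norm_diagonalization[OF V SV, symmetric])
  finally have "nuclear_norm S = mat_trace (Y * Q)"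
    using lyapunov_trace_duality[OF M Yc Rc S Q] by simp
  also have "Y * Q = U * (mat_diag n d * (U\<^sup>T * Q))"
    unfolding YU assoc_mult_mat[OF UD Ut Qc] by (rule assoc_mult_mat[OF U(1) D UQ])
  also have "mat_trace \<dots> = mat_trace (mat_diag n d * (U\<^sup>T * Q) * U)"
    by (rule mat_trace_comm[OF U(1) DUQ])
  also have "mat_diag n d * (U\<^sup>T * Q) * U = mat_diag n d * (U\<^sup>T * Q * U)"
    by (rule assoc_mult_mat[OF D UQ U(1)])
  also have "mat_trace \<dots> = (\<Sum>i<n. d i * (U\<^sup>T * Q * U) $$ (i, i))"
    by (rule mat_trace_diag_mult[OF mult_carrier_mat[OF UQ U(1)]])
  also have "\<dots> \<le> (\<Sum>i<n. \<bar>d i\<bar> * b)"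
  proof (intro sum_mono)
    fix i assume "i \<in> {..<n}"
    then have i: "i < n" by simp
    define u where "u = U *\<^sub>v unit_vec n i"
    have u: "u \<in> carrier_vec n" unfolding u_def using U by simp
    have "u \<bullet> u = (U\<^sup>T * 1\<^sub>m n * U) $$ (i, i)"
      using congruence_diagonal[OF U(1) one_carrier_mat i] u unfolding u_def by simp
    also have "\<dots> = 1" using U Ut i by simp
    finally have uu: "u \<bullet> u = 1" .
    have "\<bar>(U\<^sup>T * Q * U) $$ (i, i)\<bar> \<le> b"
      using dual_form_bound[OF Rc Q Rle u] uu unfolding congruence_diagonal[OF U(1) Qc i] u_def by simp
    then have "\<bar>d i * (U\<^sup>T * Q * U) $$ (i, i)\<bar> \<le> \<bar>d i\<bar> * b"
      unfolding abs_mult by (intro mult_left_mono) auto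
    then show "d i * (U\<^sup>T * Q * U) $$ (i, i) \<le> \<bar>d i\<bar> * b" by linarith
  qed
  also have "\<dots> = b * nuclear_norm Y"
    unfolding nuclear_norm_diagonalization[OF U YU] sum_distrib_left by (simp add: mult.commute)
  finally show ?thesis .
qed

text \<open>Positivity for the doubled system \<open>diag(M, M)\<close> plays the role of Kadison's inequality for
  the solution operator.\<close>

lemma lyap_sol_square_bound:
  assumes Y: "symmetric_mat n Y" and S: "is_lyap_sol M Y S" and S2: "is_lyap_sol M (Y * Y) S2"
    and v: "v \<in> carrier_vec n"
  shows "(S *\<^sub>v v) \<bullet> (S *\<^sub>v v) \<le> a * (v \<bullet> (S2 *\<^sub>v v))"
proof -
  have Yc: "Y \<in> carrier_mat n n" using Y unfolding symmetric_mat_def by simp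
  have YY: "Y * Y \<in> carrier_mat n n" using Yc by simp
  have Ssym: "symmetric_mat n S" by (rule lyap_sol_symmetric[OF M hM Y S])
  have Sc: "S \<in> carrier_mat n n" using Ssym unfolding symmetric_mat_def by simp
  have S2c: "S2 \<in> carrier_mat n n" using S2 is_lyap_sol_iff[OF M YY] by blast
  let ?N = "four_block_mat M\<^sup>T (0\<^sub>m n n) (0\<^sub>m n n) M\<^sup>T"
  \<comment> \<open>Along the doubled system the derivative of the form of \<open>?B\<close> at
    \<open>p @\<^sub>v q\<close> is at most minus the squared length of \<open>Y p + q\<close>: the
    diagonal block \<open>S2\<close> supplies the square of \<open>Y p\<close>, the two copies of
    \<open>S\<close> the cross term, and \<open>X\<close> the square of \<open>q\<close>. So
    \<open>?B\<close> is positive semidefinite, and this relates \<open>S\<close> to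
    \<open>S2\<close> and \<open>X\<close> like a Schur complement.\<close>
  let ?B = "four_block_mat S2 S S X"
  have N: "?N \<in> carrier_mat (n + n) (n + n)" using Mt by simp
  have B: "?B \<in> carrier_mat (n + n) (n + n)" using S2c Xc by simp
  have hN: "hurwitz ?N" by (rule hurwitz_four_block_lower[OF Mt zero_carrier_mat Mt hMt hMt])
  have Bf: "(p @\<^sub>v q) \<bullet> (?B *\<^sub>v (r @\<^sub>v s)) =
      p \<bullet> (S2 *\<^sub>v r) + p \<bullet> (S *\<^sub>v s) + q \<bullet> (S *\<^sub>v r) + q \<bullet> (X *\<^sub>v s)"
    if c: "p \<in> carrier_vec n" "q \<in> carrier_vec n" "r \<in> carrier_vec n" "s \<in> carrier_vec n" for p q r s
  proof -
    have d: "S2 *\<^sub>v r \<in> carrier_vec n" "S *\<^sub>v s \<in> carrier_vec n" "S *\<^sub>v r \<in> carrier_vec n" "X *\<^sub>v s \<in> carrier_vec n"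
      using c S2c Sc Xc by auto
    show ?thesis
      unfolding four_block_mat_mult_vec[OF S2c Sc Sc Xc c(3,4)]
      using scalar_prod_append[OF c(1,2), of "S2 *\<^sub>v r + S *\<^sub>v s" "S *\<^sub>v r + X *\<^sub>v s"] c d
      by (simp add: scalar_prod_add_distrib[of _ n])
  qed
  have nn: "0 \<le> w \<bullet> (?B *\<^sub>v w)" if w: "w \<in> carrier_vec (n + n)" for w
  proof (rule lyapunov_ineq_form_nonneg[OF N hN B _ w])
    fix w :: "real Matrix.vec" assume "w \<in> carrier_vec (n + n)"
    then obtain p q where pq: "p \<in> carrier_vec n" "q \<in> carrier_vec n" and w: "w = p @\<^sub>v q"
      by (rule append_vec_cases)
    define p' q' where "p' = M\<^sup>T *\<^sub>v p" and "q' = M\<^sup>T *\<^sub>v q"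
    have pq': "p' \<in> carrier_vec n" "q' \<in> carrier_vec n" unfolding p'_def q'_def using Mt pq by auto
    have Nw: "?N *\<^sub>v w = p' @\<^sub>v q'"
      unfolding w four_block_mat_mult_vec[OF Mt zero_carrier_mat zero_carrier_mat Mt pq]
      using pq pq' unfolding p'_def q'_def by simp
    have Yp: "Y *\<^sub>v p \<in> carrier_vec n" "Y *\<^sub>v q \<in> carrier_vec n" using Yc pq by auto
    have f1: "p \<bullet> (S2 *\<^sub>v p') + p' \<bullet> (S2 *\<^sub>v p) = - ((Y *\<^sub>v p) \<bullet> (Y *\<^sub>v p))"
      using lyap_sol_form[OF M YY S2 pq(1) pq(1)] symmetric_form[OF Y pq(1) Yp(1)]
        assoc_mult_mat_vec[OF Yc Yc pq(1)] unfolding p'_def by simp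
    have f2: "p \<bullet> (S *\<^sub>v q') + p' \<bullet> (S *\<^sub>v q) = - ((Y *\<^sub>v p) \<bullet> q)"
      using lyap_sol_form[OF M Yc S pq] symmetric_form[OF Y pq] comm_scalar_prod[OF pq(2) Yp(1)]
      unfolding p'_def q'_def by simp
    have f3: "q \<bullet> (S *\<^sub>v p') + q' \<bullet> (S *\<^sub>v p) = - ((Y *\<^sub>v p) \<bullet> q)"
      using lyap_sol_form[OF M Yc S pq(2,1)] comm_scalar_prod[OF pq(2) Yp(1)]
      unfolding p'_def q'_def by simp
    have f4: "q \<bullet> (X *\<^sub>v q') + q' \<bullet> (X *\<^sub>v q) \<le> - (q \<bullet> q)"
      using X_ineq[OF pq(2)] unfolding q'_def .
    have sq: "(Y *\<^sub>v p + q) \<bullet> (Y *\<^sub>v p + q) =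
        (Y *\<^sub>v p) \<bullet> (Y *\<^sub>v p) + 2 * ((Y *\<^sub>v p) \<bullet> q) + q \<bullet> q"
      using Yp pq comm_scalar_prod[OF pq(2) Yp(1)]
      by (simp add: scalar_prod_add_distrib[of _ n] add_scalar_prod_distrib[of _ n])
    show "w \<bullet> (?B *\<^sub>v (?N *\<^sub>v w)) + (?N *\<^sub>v w) \<bullet> (?B *\<^sub>v w) \<le> 0"
      unfolding Nw unfolding w Bf[OF pq pq'] Bf[OF pq' pq]
      using f1 f2 f3 f4 sq vec_nonneg_self[of "Y *\<^sub>v p + q"] by linarith
  qed
  define u where "u = S *\<^sub>v v"
  have u: "u \<in> carrier_vec n" unfolding u_def using Sc v by simp
  have vSu: "v \<bullet> (S *\<^sub>v u) = u \<bullet> u" using symmetric_form[OF Ssym v u] unfolding u_def by simp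
  have uSv: "u \<bullet> (S *\<^sub>v v) = u \<bullet> u" unfolding u_def ..
  \<comment> \<open>Test \<open>?B\<close> on \<open>v @\<^sub>v (t \<cdot>\<^sub>v u)\<close> with
    \<open>u = S v\<close>. Both off-diagonal blocks contribute \<open>t * (u \<bullet> u)\<close>,
    so the discriminant of the nonnegative polynomial in \<open>t\<close> gives the
    inequality.\<close>
  have "(u \<bullet> u)\<^sup>2 \<le> (v \<bullet> (S2 *\<^sub>v v)) * (u \<bullet> (X *\<^sub>v u))"
  proof (rule quadratic_nonneg_discriminant)
    fix t
    have tu: "t \<cdot>\<^sub>v u \<in> carrier_vec n" using u by simp
    have c: "S *\<^sub>v u \<in> carrier_vec n" "X *\<^sub>v u \<in> carrier_vec n" "S *\<^sub>v v \<in> carrier_vec n" using Sc Xc u v by auto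
    have "v @\<^sub>v (t \<cdot>\<^sub>v u) \<in> carrier_vec (n + n)" using v tu by simp
    from nn[OF this] show "0 \<le> v \<bullet> (S2 *\<^sub>v v) + 2 * (u \<bullet> u) * t + u \<bullet> (X *\<^sub>v u) * t\<^sup>2"
      unfolding Bf[OF v tu v tu] mult_mat_vec[OF Sc u] mult_mat_vec[OF Xc u]
      using v u c vSu uSv by (simp add: power2_eq_square algebra_simps)
  qed (rule X_nonneg[OF u])
  also have "\<dots> \<le> (v \<bullet> (S2 *\<^sub>v v)) * (a * (u \<bullet> u))"
  proof (rule mult_left_mono[OF X_le[OF u]])
    have z: "0\<^sub>v n \<in> carrier_vec n" by simp
    have "v @\<^sub>v 0\<^sub>v n \<in> carrier_vec (n + n)" using v by simp
    moreover have "S *\<^sub>v 0\<^sub>v n = 0\<^sub>v n" "X *\<^sub>v 0\<^sub>v n = 0\<^sub>v n" using Sc Xc by (auto intro!: eq_vecI)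
    ultimately show "0 \<le> v \<bullet> (S2 *\<^sub>v v)"
      using nn[of "v @\<^sub>v 0\<^sub>v n"] Sc v unfolding Bf[OF v z v z] by simp
  qed
  finally have main: "(u \<bullet> u) * (u \<bullet> u) \<le> (a * (v \<bullet> (S2 *\<^sub>v v))) * (u \<bullet> u)"
    by (simp add: power2_eq_square mult_ac)
  \<comment> \<open>Needed when \<open>u\<close> vanishes, where one factor
    \<open>u \<bullet> u\<close> cannot be cancelled from \<open>main\<close>.\<close>
  have v2: "0 \<le> v \<bullet> (S2 *\<^sub>v v)"
  proof (rule lyapunov_ineq_form_nonneg[OF Mt hMt S2c _ v])
    fix w :: "real Matrix.vec" assume w: "w \<in> carrier_vec n"
    have Yw: "Y *\<^sub>v w \<in> carrier_vec n" using Yc w by simp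
    show "w \<bullet> (S2 *\<^sub>v (M\<^sup>T *\<^sub>v w)) + (M\<^sup>T *\<^sub>v w) \<bullet> (S2 *\<^sub>v w) \<le> 0"
      using lyap_sol_form[OF M YY S2 w w] symmetric_form[OF Y w Yw]
        assoc_mult_mat_vec[OF Yc Yc w] by simp
  qed
  show ?thesis
  proof (cases "u \<bullet> u = 0")
    case True
    then show ?thesis using v2 a_nonneg unfolding u_def by simp
  next
    case False
    then have "u \<bullet> u > 0" using vec_nonneg_self[of u] by linarith
    then show ?thesis using main mult_le_cancel_right_pos unfolding u_def by blast
  qed
qed

text \<open>The squared norm of \<open>S\<close> is the trace of \<open>S * S\<close>, which the
  square bound replaces by \<open>a\<close> times the trace of \<open>S2\<close>. Duality with the
  adjoint solution \<open>Q\<close> for the identity turns that trace into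
  \<open>mat_trace (Y * Y * Q)\<close>, where \<open>Q\<close> costs a factor \<open>b\<close>. The
  natural constant is the geometric mean of \<open>a\<close> and \<open>b\<close>; it is relaxed to
  \<open>a + b\<close>, which involves no root.\<close>

lemma frobenius_norm_lyap:
  assumes Y: "symmetric_mat n Y" and S: "is_lyap_sol M Y S"
  shows "frobenius_norm S \<le> (a + b) * frobenius_norm Y"
proof (rule power2_le_imp_le)
  have Yc: "Y \<in> carrier_mat n n" and YT: "Y\<^sup>T = Y" using Y unfolding symmetric_mat_def by auto
  have YY: "Y * Y \<in> carrier_mat n n" using Yc by simp
  have Sc: "S \<in> carrier_mat n n" using S is_lyap_sol_iff[OF M Yc] by blast
  obtain S2 where S2: "is_lyap_sol M (Y * Y) S2" using lyap_sol_ex1[OF M hM YY] by blast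
  have S2c: "S2 \<in> carrier_mat n n" using S2 is_lyap_sol_iff[OF M YY] by blast
  obtain Q where Q: "is_lyap_sol M\<^sup>T (1\<^sub>m n) Q" using lyap_sol_ex1[OF Mt hMt, of "1\<^sub>m n"] by auto
  have Qc: "Q \<in> carrier_mat n n" using Q is_lyap_sol_iff[OF Mt one_carrier_mat] by blast
  have "(frobenius_norm S)\<^sup>2 = (\<Sum>j<n. (S *\<^sub>v unit_vec n j) \<bullet> (S *\<^sub>v unit_vec n j))"
    by (rule frobenius_norm_sq[OF Sc])
  also have "\<dots> \<le> (\<Sum>j<n. a * (unit_vec n j \<bullet> (S2 *\<^sub>v unit_vec n j)))"
    by (intro sum_mono lyap_sol_square_bound[OF Y S S2]) simp
  also have "\<dots> = a * mat_trace (S2 * 1\<^sub>m n)"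
    using S2c by (simp add: mat_trace_def sum_distrib_left scalar_prod_left_unit[of _ n])
  also have "mat_trace (S2 * 1\<^sub>m n) = mat_trace (Y * Y * Q)"
    by (rule lyapunov_trace_duality[OF M YY one_carrier_mat S2 Q])
  also have "Y * Y * Q = Y * (Y * Q)" by (rule assoc_mult_mat[OF Yc Yc Qc])
  also have "mat_trace \<dots> = mat_trace (Y\<^sup>T * Q * Y)"
    unfolding YT by (rule mat_trace_comm[of _ n n]) (use Yc Qc in auto)
  also have "\<dots> = (\<Sum>j<n. (Y *\<^sub>v unit_vec n j) \<bullet> (Q *\<^sub>v (Y *\<^sub>v unit_vec n j)))"
    unfolding mat_trace_def using Yc congruence_diagonal[OF Yc Qc] by simp
  also have "a * \<dots> \<le> a * (\<Sum>j<n. b * ((Y *\<^sub>v unit_vec n j) \<bullet> (Y *\<^sub>v unit_vec n j)))"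
  proof (intro mult_left_mono a_nonneg sum_mono)
    fix j assume "j \<in> {..<n}"
    have "Y *\<^sub>v unit_vec n j \<in> carrier_vec n" using Yc by simp
    from dual_form_bound[OF one_carrier_mat Q _ this]
    show "(Y *\<^sub>v unit_vec n j) \<bullet> (Q *\<^sub>v (Y *\<^sub>v unit_vec n j)) \<le> b * ((Y *\<^sub>v unit_vec n j) \<bullet> (Y *\<^sub>v unit_vec n j))"
      by fastforce
  qed
  also have "\<dots> = a * b * (frobenius_norm Y)\<^sup>2"
    unfolding frobenius_norm_sq[OF Yc] by (simp add: sum_distrib_left mult.assoc)
  also have "\<dots> \<le> (a + b)\<^sup>2 * (frobenius_norm Y)\<^sup>2"
    using a_nonneg b_nonneg by (intro mult_right_mono) (auto simp: power2_eq_square algebra_simps)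
  finally show "(frobenius_norm S)\<^sup>2 \<le> ((a + b) * frobenius_norm Y)\<^sup>2" by (simp add: power_mult_distrib)
  show "0 \<le> (a + b) * frobenius_norm Y"
    using a_nonneg b_nonneg by (simp add: frobenius_norm_def sum_nonneg)
qed

end

section \<open>Supersolutions for the closed-loop equation\<close>

text \<open>The constant \<open>r\<close> is allowed to come from elsewhere: the diagonal blocks of
  \<open>S\<close> inherit their lower bound from \<open>S\<close>, so the inverses of
  \<open>S11\<close> and \<open>S22\<close> are bounded through the inverse of
  \<open>S\<close>.\<close>

lemma pos_def_mat_inv_norm_le:
  assumes X: "pos_def n X" and le: "\<And>v. v \<in> carrier_vec n \<Longrightarrow> v \<bullet> v \<le> r * (v \<bullet> (X *\<^sub>v v))"
    and v: "v \<in> carrier_vec n" and r: "0 \<le> r"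
  shows "eucl_norm (mat_inv X *\<^sub>v v) \<le> r * eucl_norm v"
proof -
  define u where "u = mat_inv X *\<^sub>v v"
  have u: "u \<in> carrier_vec n" "X *\<^sub>v u = v" unfolding u_def using pos_def_mat_inv_mult[OF X v] by auto
  have "eucl_norm u * eucl_norm u \<le> r * (u \<bullet> v)"
    using le[OF u(1)] unfolding u(2) by (simp add: eucl_norm_sq[symmetric] power2_eq_square)
  also have "\<dots> \<le> r * (eucl_norm u * eucl_norm v)"
    using vec_Cauchy_Schwarz[OF u(1) v] r by (intro mult_left_mono) auto
  finally have le: "eucl_norm u * eucl_norm u \<le> (r * eucl_norm v) * eucl_norm u" by (simp add: mult_ac)
  show ?thesis
  proof (cases "eucl_norm u = 0")
    case True
    then show ?thesis using r unfolding u_def by simp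
  next
    case False
    then have "eucl_norm u > 0" using eucl_norm_nonneg[of u] by linarith
    then show ?thesis using le mult_le_cancel_right_pos unfolding u_def by blast
  qed
qed

lemma pos_def_mat_inv_symmetric_form:
  assumes X: "pos_def n X" and u: "u \<in> carrier_vec n" and v: "v \<in> carrier_vec n"
  shows "u \<bullet> (mat_inv X *\<^sub>v v) = (mat_inv X *\<^sub>v u) \<bullet> v"
proof -
  have sym: "symmetric_mat n X" using X unfolding pos_def_def by simp
  define p q where "p = mat_inv X *\<^sub>v u" and "q = mat_inv X *\<^sub>v v"
  have p: "p \<in> carrier_vec n" "X *\<^sub>v p = u" unfolding p_def using pos_def_mat_inv_mult[OF X u] by auto
  have q: "q \<in> carrier_vec n" "X *\<^sub>v q = v" unfolding q_def using pos_def_mat_inv_mult[OF X v] by auto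
  have "(X *\<^sub>v p) \<bullet> q = p \<bullet> (X *\<^sub>v q)"
    using symmetric_form[OF sym p(1) q(1)] comm_scalar_prod[of "X *\<^sub>v p" n q] p q u by simp
  then show ?thesis unfolding p(2) q(2) unfolding p_def q_def .
qed

lemma eucl_norm_append:
  assumes "x \<in> carrier_vec n" "y \<in> carrier_vec m"
  shows "(eucl_norm (x @\<^sub>v y))\<^sup>2 = (eucl_norm x)\<^sup>2 + (eucl_norm y)\<^sup>2"
  unfolding eucl_norm_sq by (rule scalar_prod_append[OF assms assms])

lemma symmetric_congruence:
  assumes X: "symmetric_mat m X" and B: "B \<in> carrier_mat n m"
  shows "symmetric_mat n (B * X * B\<^sup>T)"
proof -
  have X': "X \<in> carrier_mat m m" "X\<^sup>T = X" using X unfolding symmetric_mat_def by auto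
  have Bt: "B\<^sup>T \<in> carrier_mat m n" using B by simp
  have BX: "B * X \<in> carrier_mat n m" by (rule mult_carrier_mat[OF B X'(1)])
  have "(B * X * B\<^sup>T)\<^sup>T = B * (X * B\<^sup>T)"
    unfolding transpose_mult[OF BX Bt] transpose_mult[OF B X'(1)] X'(2) transpose_transpose ..
  also have "\<dots> = B * X * B\<^sup>T" by (rule assoc_mult_mat[symmetric, OF B X'(1) Bt])
  finally show ?thesis
    unfolding symmetric_mat_def using mult_carrier_mat[OF BX Bt] by simp
qed

lemma symmetric_block_diagonal:
  assumes "symmetric_mat n X" "symmetric_mat m Y"
  shows "symmetric_mat (n + m) (four_block_mat X (0\<^sub>m n m) (0\<^sub>m m n) Y)"
proof -
  have X: "X \<in> carrier_mat n n" "X\<^sup>T = X" and Y: "Y \<in> carrier_mat m m" "Y\<^sup>T = Y"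
    using assms unfolding symmetric_mat_def by auto
  then show ?thesis
    unfolding symmetric_mat_def
    using transpose_four_block_mat[OF X(1) zero_carrier_mat zero_carrier_mat Y(1)] by simp
qed

text \<open>The rank condition is represented by the explicit inverse \<open>J\<close> of
  \<open>S12\<close>. Definiteness of the blocks is not assumed but derived from the Lyapunov
  equation.\<close>

locale informative_filter =
  fixes n m :: nat and A C AK BK W1 W2 S11 S12 S22 J :: "real mat"
  assumes n: "0 < n" and m: "0 < m"
    and A: "A \<in> carrier_mat n n" and C: "C \<in> carrier_mat m n"
    and AK: "AK \<in> carrier_mat n n" and BK: "BK \<in> carrier_mat n m"
    and hA: "hurwitz A" and hAK: "hurwitz AK"
    and W1: "pos_def n W1" and W2: "pos_def m W2"
    and S11: "S11 \<in> carrier_mat n n" and S12: "S12 \<in> carrier_mat n n" and S22: "S22 \<in> carrier_mat n n"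
    and lyap: "is_lyap_sol (four_block_mat A (0\<^sub>m n n) (BK * C) AK)
      (four_block_mat W1 (0\<^sub>m n n) (0\<^sub>m n n) (BK * W2 * BK\<^sup>T)) (four_block_mat S11 S12 S12\<^sup>T S22)"
    and J: "J \<in> carrier_mat n n" "S12 * J = 1\<^sub>m n" "J * S12 = 1\<^sub>m n"
begin

section \<open>The closed-loop equation on block vectors\<close>

definition "M = four_block_mat A (0\<^sub>m n n) (BK * C) AK"
definition "W = four_block_mat W1 (0\<^sub>m n n) (0\<^sub>m n n) (BK * W2 * BK\<^sup>T)"
definition "S = four_block_mat S11 S12 S12\<^sup>T S22"

lemma BKC: "BK * C \<in> carrier_mat n n" using BK C by (rule mult_carrier_mat)

lemma M: "M \<in> carrier_mat (n + n) (n + n)" unfolding M_def using A AK by simp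

lemma hM: "hurwitz M" unfolding M_def by (rule hurwitz_four_block_lower[OF A BKC AK hA hAK])

lemma Mt: "M\<^sup>T \<in> carrier_mat (n + n) (n + n)" using M by simp

lemma W1c: "W1 \<in> carrier_mat n n" "W1\<^sup>T = W1"
  using W1 unfolding pos_def_def symmetric_mat_def by auto

lemma W2c: "W2 \<in> carrier_mat m m" "W2\<^sup>T = W2"
  using W2 unfolding pos_def_def symmetric_mat_def by auto

lemma At: "A\<^sup>T \<in> carrier_mat n n" and Ct: "C\<^sup>T \<in> carrier_mat n m" and AKt: "AK\<^sup>T \<in> carrier_mat n n"
  and BKt: "BK\<^sup>T \<in> carrier_mat m n" and S12t: "S12\<^sup>T \<in> carrier_mat n n"
  using A C AK BK S12 by auto

lemma BW: "BK * W2 \<in> carrier_mat n m" using BK W2c by simp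

lemma BWB: "BK * W2 * BK\<^sup>T \<in> carrier_mat n n" using BW BKt by (rule mult_carrier_mat)

lemma W: "W \<in> carrier_mat (n + n) (n + n)" unfolding W_def using W1c BWB by simp

lemma W_symmetric: "symmetric_mat (n + n) W"
  unfolding W_def
  by (intro symmetric_block_diagonal symmetric_congruence[OF _ BK])
    (use W1 W2 in \<open>auto simp: pos_def_def\<close>)

lemma S_lyap: "is_lyap_sol M W S" unfolding M_def W_def S_def by (rule lyap)

lemma S_symmetric: "symmetric_mat (n + n) S" by (rule lyap_sol_symmetric[OF M hM W_symmetric S_lyap])

lemma S: "S \<in> carrier_mat (n + n) (n + n)" using S_symmetric unfolding symmetric_mat_def by simp

lemma S_vec:
  assumes "x \<in> carrier_vec n" "y \<in> carrier_vec n"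
  shows "S *\<^sub>v (x @\<^sub>v y) = (S11 *\<^sub>v x + S12 *\<^sub>v y) @\<^sub>v (S12\<^sup>T *\<^sub>v x + S22 *\<^sub>v y)"
  unfolding S_def by (rule four_block_mat_mult_vec[OF S11 S12 S12t S22 assms])

lemma M_vec:
  assumes "x \<in> carrier_vec n" "y \<in> carrier_vec n"
  shows "M *\<^sub>v (x @\<^sub>v y) = (A *\<^sub>v x) @\<^sub>v ((BK * C) *\<^sub>v x + AK *\<^sub>v y)"
proof -
  have "A *\<^sub>v x \<in> carrier_vec n" using A assms by simp
  then show ?thesis
    unfolding M_def four_block_mat_mult_vec[OF A zero_carrier_mat BKC AK assms] using assms by simp
qed

lemma Mt_vec:
  assumes x: "x \<in> carrier_vec n" and y: "y \<in> carrier_vec n"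
  shows "M\<^sup>T *\<^sub>v (x @\<^sub>v y) = (A\<^sup>T *\<^sub>v x + C\<^sup>T *\<^sub>v (BK\<^sup>T *\<^sub>v y)) @\<^sub>v (AK\<^sup>T *\<^sub>v y)"
proof -
  have c: "(BK * C)\<^sup>T \<in> carrier_mat n n" using BKC by simp
  have "AK\<^sup>T *\<^sub>v y \<in> carrier_vec n" using AKt y by simp
  moreover have "(BK * C)\<^sup>T *\<^sub>v y = C\<^sup>T *\<^sub>v (BK\<^sup>T *\<^sub>v y)"
    unfolding transpose_mult[OF BK C] by (rule assoc_mult_mat_vec[OF Ct BKt y])
  moreover have "(0\<^sub>m n n)\<^sup>T = 0\<^sub>m n n" by simp
  ultimately show ?thesis
    unfolding M_def transpose_four_block_mat[OF A zero_carrier_mat BKC AK]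
    using four_block_mat_mult_vec[OF At c zero_carrier_mat AKt x y] x by simp
qed

lemma W_form:
  assumes "x \<in> carrier_vec n" "y \<in> carrier_vec n" "x' \<in> carrier_vec n" "y' \<in> carrier_vec n"
  shows "(x @\<^sub>v y) \<bullet> (W *\<^sub>v (x' @\<^sub>v y')) = x \<bullet> (W1 *\<^sub>v x') + (BK\<^sup>T *\<^sub>v y) \<bullet> (W2 *\<^sub>v (BK\<^sup>T *\<^sub>v y'))"
proof -
  have u: "BK\<^sup>T *\<^sub>v y' \<in> carrier_vec m" using BKt assms by simp
  have wu: "W2 *\<^sub>v (BK\<^sup>T *\<^sub>v y') \<in> carrier_vec m" using W2c u by simp
  have c: "W1 *\<^sub>v x' \<in> carrier_vec n" "(BK * W2 * BK\<^sup>T) *\<^sub>v y' \<in> carrier_vec n"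
    using W1c BWB assms by auto
  have "W *\<^sub>v (x' @\<^sub>v y') = (W1 *\<^sub>v x') @\<^sub>v ((BK * W2 * BK\<^sup>T) *\<^sub>v y')"
    unfolding W_def four_block_mat_mult_vec[OF W1c(1) zero_carrier_mat zero_carrier_mat BWB assms(3,4)]
    using c assms by simp
  then have "(x @\<^sub>v y) \<bullet> (W *\<^sub>v (x' @\<^sub>v y')) = x \<bullet> (W1 *\<^sub>v x') + y \<bullet> ((BK * W2 * BK\<^sup>T) *\<^sub>v y')"
    using scalar_prod_append[OF assms(1,2) c] by simp
  also have "(BK * W2 * BK\<^sup>T) *\<^sub>v y' = BK *\<^sub>v (W2 *\<^sub>v (BK\<^sup>T *\<^sub>v y'))"
    unfolding assoc_mult_mat_vec[OF BW BKt assms(4)] by (rule assoc_mult_mat_vec[OF BK W2c(1) u])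
  also have "y \<bullet> \<dots> = (BK\<^sup>T *\<^sub>v y) \<bullet> (W2 *\<^sub>v (BK\<^sup>T *\<^sub>v y'))"
    by (rule transpose_vec_mult_scalar[OF BK wu assms(2), symmetric])
  finally show ?thesis .
qed

lemma W1_nonneg: "x \<in> carrier_vec n \<Longrightarrow> 0 \<le> x \<bullet> (W1 *\<^sub>v x)"
  using pos_def_imp_pos_semidef[OF W1] unfolding pos_semidef_def by simp

lemma W2_nonneg: "x \<in> carrier_vec m \<Longrightarrow> 0 \<le> x \<bullet> (W2 *\<^sub>v x)"
  using pos_def_imp_pos_semidef[OF W2] unfolding pos_semidef_def by simp

text \<open>Semidefiniteness comes first because the later kernel argument rests on Cauchy-Schwarz
  for the form of \<open>S\<close>.\<close>

lemma S_pos_semidef: "pos_semidef (n + n) S"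
  unfolding pos_semidef_def
proof (intro conjI ballI S_symmetric)
  fix v :: "real Matrix.vec" assume v: "v \<in> carrier_vec (n + n)"
  show "0 \<le> v \<bullet> (S *\<^sub>v v)"
  proof (rule lyapunov_ineq_form_nonneg[OF Mt hurwitz_transpose[OF M hM] S _ v])
    fix w :: "real Matrix.vec" assume w: "w \<in> carrier_vec (n + n)"
    obtain x y where xy: "x \<in> carrier_vec n" "y \<in> carrier_vec n" "w = x @\<^sub>v y"
      using append_vec_cases[OF w] by blast
    have "BK\<^sup>T *\<^sub>v y \<in> carrier_vec m" using BKt xy by simp
    then have "0 \<le> w \<bullet> (W *\<^sub>v w)"
      unfolding xy(3) W_form[OF xy(1,2,1,2)] using W1_nonneg[OF xy(1)] W2_nonneg by simp
    then show "w \<bullet> (S *\<^sub>v (M\<^sup>T *\<^sub>v w)) + (M\<^sup>T *\<^sub>v w) \<bullet> (S *\<^sub>v w) \<le> 0"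
      using lyap_sol_form[OF M W S_lyap w w] by simp
  qed
qed

lemma J_cancel:
  assumes "y \<in> carrier_vec n"
  shows "J *\<^sub>v (S12 *\<^sub>v y) = y" "S12 *\<^sub>v (J *\<^sub>v y) = y" "S12\<^sup>T *\<^sub>v (J\<^sup>T *\<^sub>v y) = y"
proof -
  show "J *\<^sub>v (S12 *\<^sub>v y) = y" using assoc_mult_mat_vec[OF J(1) S12 assms] J(3) assms by simp
  show "S12 *\<^sub>v (J *\<^sub>v y) = y" using assoc_mult_mat_vec[OF S12 J(1) assms] J(2) assms by simp
  have Jt: "J\<^sup>T \<in> carrier_mat n n" using J by simp
  have "S12\<^sup>T * J\<^sup>T = 1\<^sub>m n" using transpose_mult[OF J(1) S12] J(3) by simp
  then show "S12\<^sup>T *\<^sub>v (J\<^sup>T *\<^sub>v y) = y" using assoc_mult_mat_vec[OF S12t Jt assms] assms by simp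
qed

text \<open>A vector with vanishing form lies in the kernel of \<open>S\<close>, and the Lyapunov
  equation then makes the form of \<open>W\<close> vanish on it. Definiteness of \<open>W1\<close>
  kills the first component \<open>x\<close>; the first block row of \<open>S w = 0\<close> becomes
  \<open>S12 y = 0\<close>, and invertibility of \<open>S12\<close> kills \<open>y\<close>.\<close>

lemma S_pos_def: "pos_def (n + n) S"
  unfolding pos_def_def
proof (intro conjI ballI impI S_symmetric)
  fix w :: "real Matrix.vec" assume w: "w \<in> carrier_vec (n + n)" and w0: "w \<noteq> 0\<^sub>v (n + n)"
  show "0 < w \<bullet> (S *\<^sub>v w)"
  proof (rule ccontr)
    assume "\<not> 0 < w \<bullet> (S *\<^sub>v w)"
    moreover have "0 \<le> w \<bullet> (S *\<^sub>v w)" using S_pos_semidef w unfolding pos_semidef_def by simp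
    ultimately have "w \<bullet> (S *\<^sub>v w) = 0" by simp
    then have Sw: "S *\<^sub>v w = 0\<^sub>v (n + n)" by (rule pos_semidef_form_zero[OF S_pos_semidef w])
    have Mw: "M\<^sup>T *\<^sub>v w \<in> carrier_vec (n + n)" using Mt w by simp
    have "w \<bullet> (W *\<^sub>v w) = 0"
      using lyap_sol_form[OF M W S_lyap w w] symmetric_form[OF S_symmetric w Mw] Sw Mw by simp
    moreover obtain x y where xy: "x \<in> carrier_vec n" "y \<in> carrier_vec n" "w = x @\<^sub>v y"
      using append_vec_cases[OF w] by blast
    moreover have "BK\<^sup>T *\<^sub>v y \<in> carrier_vec m" using BKt xy by simp
    ultimately have "x \<bullet> (W1 *\<^sub>v x) = 0"
      using W1_nonneg[OF xy(1)] W2_nonneg unfolding xy(3) W_form[OF xy(1,2,1,2)]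
      by (metis add_nonneg_eq_0_iff)
    then have x0: "x = 0\<^sub>v n" using W1 xy(1) unfolding pos_def_def by fastforce
    have z: "0\<^sub>v (n + n) = 0\<^sub>v n @\<^sub>v (0\<^sub>v n :: real Matrix.vec)" by (intro eq_vecI) auto
    have c: "S11 *\<^sub>v x + S12 *\<^sub>v y \<in> carrier_vec n" using S11 S12 xy by simp
    have "S11 *\<^sub>v x + S12 *\<^sub>v y = 0\<^sub>v n"
      using Sw unfolding xy(3) S_vec[OF xy(1,2)] z
      using append_vec_eq[OF c zero_carrier_vec] by metis
    moreover have "S11 *\<^sub>v 0\<^sub>v n = 0\<^sub>v n" using S11 by (intro eq_vecI) auto
    ultimately have "S12 *\<^sub>v y = 0\<^sub>v n" using x0 S12 xy by simp
    then have "y = J *\<^sub>v 0\<^sub>v n" using J_cancel(1)[OF xy(2)] by simp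
    also have "J *\<^sub>v 0\<^sub>v n = 0\<^sub>v n" using J by (intro eq_vecI) auto
    finally show False using w0 x0 unfolding xy(3) z by simp
  qed
qed

lemma S_form_fst:
  assumes "x \<in> carrier_vec n" "x' \<in> carrier_vec n"
  shows "(x @\<^sub>v 0\<^sub>v n) \<bullet> (S *\<^sub>v (x' @\<^sub>v 0\<^sub>v n)) = x \<bullet> (S11 *\<^sub>v x')"
proof -
  have "S12 *\<^sub>v 0\<^sub>v n = 0\<^sub>v n" using S12 by (intro eq_vecI) auto
  moreover have c: "S11 *\<^sub>v x' \<in> carrier_vec n" "S12\<^sup>T *\<^sub>v x' + S22 *\<^sub>v 0\<^sub>v n \<in> carrier_vec n"
    using S11 S12t S22 assms by auto
  ultimately show ?thesis
    unfolding S_vec[OF assms(2) zero_carrier_vec]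
    using scalar_prod_append[OF assms(1) zero_carrier_vec c] by simp
qed

lemma S_form_snd:
  assumes "y \<in> carrier_vec n" "y' \<in> carrier_vec n"
  shows "(0\<^sub>v n @\<^sub>v y) \<bullet> (S *\<^sub>v (0\<^sub>v n @\<^sub>v y')) = y \<bullet> (S22 *\<^sub>v y')"
proof -
  have "S12\<^sup>T *\<^sub>v 0\<^sub>v n = 0\<^sub>v n" using S12t by (intro eq_vecI) auto
  moreover have c: "S11 *\<^sub>v 0\<^sub>v n + S12 *\<^sub>v y' \<in> carrier_vec n" "S22 *\<^sub>v y' \<in> carrier_vec n"
    using S11 S12 S22 assms by auto
  ultimately show ?thesis
    unfolding S_vec[OF zero_carrier_vec assms(2)]
    using scalar_prod_append[OF zero_carrier_vec assms(1) c] by simp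
qed

lemma S_blocks_symmetric: "S11\<^sup>T = S11" "S22\<^sup>T = S22"
proof -
  have "S\<^sup>T = S" using S_symmetric unfolding symmetric_mat_def by simp
  then have eq: "S $$ (i, j) = S $$ (j, i)" if "i < n + n" "j < n + n" for i j
    using that S by (metis carrier_matD index_transpose_mat(1))
  show "S11\<^sup>T = S11"
  proof (rule eq_matI)
    fix i j assume "i < dim_row S11" "j < dim_col S11"
    then have "i < n" "j < n" using S11 by auto
    then show "S11\<^sup>T $$ (i, j) = S11 $$ (i, j)" using eq[of j i] S11 S22 unfolding S_def by simp
  qed (use S11 in auto)
  show "S22\<^sup>T = S22"
  proof (rule eq_matI)
    fix i j assume "i < dim_row S22" "j < dim_col S22"
    then have "i < n" "j < n" using S22 by auto
    then show "S22\<^sup>T $$ (i, j) = S22 $$ (i, j)" using eq[of "n + j" "n + i"] S11 S22 unfolding S_def by simp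
  qed (use S22 in auto)
qed

lemma append_0_nonzero:
  assumes "x \<in> carrier_vec n" "x \<noteq> 0\<^sub>v n"
  shows "x @\<^sub>v 0\<^sub>v n \<noteq> 0\<^sub>v (n + n)" "0\<^sub>v n @\<^sub>v x \<noteq> (0\<^sub>v (n + n) :: real Matrix.vec)"
proof -
  have z: "0\<^sub>v (n + n) = 0\<^sub>v n @\<^sub>v (0\<^sub>v n :: real Matrix.vec)" by (intro eq_vecI) auto
  show "x @\<^sub>v 0\<^sub>v n \<noteq> 0\<^sub>v (n + n)" "0\<^sub>v n @\<^sub>v x \<noteq> (0\<^sub>v (n + n) :: real Matrix.vec)"
    unfolding z using append_vec_eq[OF assms(1) zero_carrier_vec]
      append_vec_eq[OF zero_carrier_vec[of n] zero_carrier_vec[of n]] assms(2) by metis+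
qed

lemma S11_pos_def: "pos_def n S11"
  unfolding pos_def_def symmetric_mat_def
proof (intro conjI ballI impI S11 S_blocks_symmetric)
  fix x :: "real Matrix.vec" assume x: "x \<in> carrier_vec n" "x \<noteq> 0\<^sub>v n"
  have "x @\<^sub>v 0\<^sub>v n \<in> carrier_vec (n + n)" using x by simp
  then have "0 < (x @\<^sub>v 0\<^sub>v n) \<bullet> (S *\<^sub>v (x @\<^sub>v 0\<^sub>v n))"
    using S_pos_def append_0_nonzero(1)[OF x] unfolding pos_def_def by blast
  then show "0 < x \<bullet> (S11 *\<^sub>v x)" unfolding S_form_fst[OF x(1) x(1)] .
qed

lemma S22_pos_def: "pos_def n S22"
  unfolding pos_def_def symmetric_mat_def
proof (intro conjI ballI impI S22 S_blocks_symmetric)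
  fix x :: "real Matrix.vec" assume x: "x \<in> carrier_vec n" "x \<noteq> 0\<^sub>v n"
  have "0\<^sub>v n @\<^sub>v x \<in> carrier_vec (n + n)" using x by simp
  then have "0 < (0\<^sub>v n @\<^sub>v x) \<bullet> (S *\<^sub>v (0\<^sub>v n @\<^sub>v x))"
    using S_pos_def append_0_nonzero(2)[OF x] unfolding pos_def_def by blast
  then show "0 < x \<bullet> (S22 *\<^sub>v x)" unfolding S_form_snd[OF x(1) x(1)] .
qed

section \<open>The norms entering the constant and their consequences for the blocks\<close>

definition "s = op_norm S"
definition "r = op_norm (mat_inv S)"
definition "z = op_norm (mat_inv (S12 * mat_inv S22 * S12\<^sup>T))"
definition "w1 = op_norm (mat_inv W1)"
definition "w2 = op_norm (mat_inv W2)"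
definition "c = op_norm C"

text \<open>\<open>k\<close> bounds the inverse of \<open>S12\<close>, because \<open>S12\<^sup>-\<^sup>1 = S22\<^sup>-\<^sup>1 S12\<^sup>T Z\<^sup>-\<^sup>1\<close>.\<close>

definition "k = r * s * z"
text \<open>The price of passing from dissipation to length: if \<open>S11 g = f\<close>, then
  \<open>f \<bullet> f \<le> D * (g \<bullet> W1 g)\<close>.\<close>

definition "D = s\<^sup>2 * w1"

lemma nn: "0 < n + n" using n by simp

text \<open>Inverting factor by factor, with \<open>J\<close> for the inverse of \<open>S12\<close>.
  The explicit form lets \<open>Z\<^sup>-\<^sup>1\<close> act on \<open>S12 y\<close> without a
  division.\<close>

lemma Z_inv: "mat_inv (S12 * mat_inv S22 * S12\<^sup>T) = J\<^sup>T * (S22 * J)"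
proof (rule mat_inv_eq[of _ n])
  note i = pos_def_mat_inv[OF S22_pos_def]
  have a: "S12 * mat_inv S22 \<in> carrier_mat n n" using S12 i by simp
  show Z: "S12 * mat_inv S22 * S12\<^sup>T \<in> carrier_mat n n" by (rule mult_carrier_mat[OF a S12t])
  have SJ: "S22 * J \<in> carrier_mat n n" using S22 J by simp
  have Jt: "J\<^sup>T \<in> carrier_mat n n" using J by simp
  show JSJ: "J\<^sup>T * (S22 * J) \<in> carrier_mat n n" by (rule mult_carrier_mat[OF Jt SJ])
  show "S12 * mat_inv S22 * S12\<^sup>T * (J\<^sup>T * (S22 * J)) = 1\<^sub>m n"
  proof (rule mat_eq_vecI[of _ n n])
    fix v :: "real Matrix.vec" assume v: "v \<in> carrier_vec n"
    have Jv: "J *\<^sub>v v \<in> carrier_vec n" using J v by simp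
    have SJv: "S22 *\<^sub>v (J *\<^sub>v v) \<in> carrier_vec n" using S22 Jv by simp
    have u: "J\<^sup>T *\<^sub>v (S22 *\<^sub>v (J *\<^sub>v v)) \<in> carrier_vec n" using Jt SJv by simp
    have "(S12 * mat_inv S22 * S12\<^sup>T * (J\<^sup>T * (S22 * J))) *\<^sub>v v =
        (S12 * mat_inv S22 * S12\<^sup>T) *\<^sub>v (J\<^sup>T *\<^sub>v (S22 *\<^sub>v (J *\<^sub>v v)))"
      unfolding assoc_mult_mat_vec[OF Z JSJ v] assoc_mult_mat_vec[OF Jt SJ v] assoc_mult_mat_vec[OF S22 J(1) v] ..
    also have "\<dots> = (S12 * mat_inv S22) *\<^sub>v (S22 *\<^sub>v (J *\<^sub>v v))"
      unfolding assoc_mult_mat_vec[OF a S12t u] J_cancel(3)[OF SJv] ..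
    also have "\<dots> = v"
      unfolding assoc_mult_mat_vec[OF S12 i(1) SJv] pos_def_mat_inv_mult(3)[OF S22_pos_def Jv]
      by (rule J_cancel(2)[OF v])
    finally show "(S12 * mat_inv S22 * S12\<^sup>T * (J\<^sup>T * (S22 * J))) *\<^sub>v v = 1\<^sub>m n *\<^sub>v v" using v by simp
  qed (use mult_carrier_mat[OF Z JSJ] in auto)
qed

lemma Z_inv_carrier: "mat_inv (S12 * mat_inv S22 * S12\<^sup>T) \<in> carrier_mat n n"
proof -
  have "S22 * J \<in> carrier_mat n n" "J\<^sup>T \<in> carrier_mat n n" using S22 J by auto
  then show ?thesis unfolding Z_inv by (rule mult_carrier_mat[rotated])
qed

lemma consts_nonneg: "0 \<le> s" "0 \<le> r" "0 \<le> z" "0 \<le> w1" "0 \<le> w2" "0 \<le> c" "0 \<le> k" "0 \<le> D"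
proof -
  show c: "0 \<le> s" "0 \<le> r" "0 \<le> z" "0 \<le> w1" "0 \<le> w2" "0 \<le> c"
    unfolding s_def r_def z_def w1_def w2_def c_def
    using op_norm_nonneg[OF S nn] op_norm_nonneg[OF pos_def_mat_inv(1)[OF S_pos_def] nn]
      op_norm_nonneg[OF pos_def_mat_inv(1)[OF W1] n] op_norm_nonneg[OF pos_def_mat_inv(1)[OF W2] m]
      op_norm_nonneg[OF C n] op_norm_nonneg[OF Z_inv_carrier n] by auto
  show "0 \<le> k" "0 \<le> D" unfolding k_def D_def using c by auto
qed

lemma S_lower:
  assumes "v \<in> carrier_vec (n + n)"
  shows "v \<bullet> v \<le> r * (v \<bullet> (S *\<^sub>v v))"
  unfolding r_def by (rule pos_def_mat_inv_bound[OF S_pos_def assms nn])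

lemma S11_inv_norm:
  assumes "x \<in> carrier_vec n"
  shows "eucl_norm (mat_inv S11 *\<^sub>v x) \<le> r * eucl_norm x"
proof (rule pos_def_mat_inv_norm_le[OF S11_pos_def _ assms consts_nonneg(2)])
  fix v :: "real Matrix.vec" assume v: "v \<in> carrier_vec n"
  show "v \<bullet> v \<le> r * (v \<bullet> (S11 *\<^sub>v v))"
    using S_lower[of "v @\<^sub>v 0\<^sub>v n"] v scalar_prod_append[OF v zero_carrier_vec v zero_carrier_vec]
    unfolding S_form_fst[OF v v] by simp
qed

lemma S22_inv_norm:
  assumes "x \<in> carrier_vec n"
  shows "eucl_norm (mat_inv S22 *\<^sub>v x) \<le> r * eucl_norm x"
proof (rule pos_def_mat_inv_norm_le[OF S22_pos_def _ assms consts_nonneg(2)])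
  fix v :: "real Matrix.vec" assume v: "v \<in> carrier_vec n"
  show "v \<bullet> v \<le> r * (v \<bullet> (S22 *\<^sub>v v))"
    using S_lower[of "0\<^sub>v n @\<^sub>v v"] v scalar_prod_append[OF zero_carrier_vec v zero_carrier_vec v]
    unfolding S_form_snd[OF v v] by simp
qed

lemma S_column_norm:
  assumes x: "x \<in> carrier_vec n"
  shows "eucl_norm (S11 *\<^sub>v x) \<le> s * eucl_norm x" "eucl_norm (S12\<^sup>T *\<^sub>v x) \<le> s * eucl_norm x"
proof -
  have z: "S12 *\<^sub>v 0\<^sub>v n = 0\<^sub>v n" "S22 *\<^sub>v 0\<^sub>v n = 0\<^sub>v n" using S12 S22 by (auto intro!: eq_vecI)
  have cc: "S11 *\<^sub>v x \<in> carrier_vec n" "S12\<^sup>T *\<^sub>v x \<in> carrier_vec n" using S11 S12t x by auto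
  have x0: "x @\<^sub>v 0\<^sub>v n \<in> carrier_vec (n + n)" using x by simp
  have "eucl_norm (0\<^sub>v n) = 0" by (simp add: eucl_norm_def)
  then have "eucl_norm (x @\<^sub>v 0\<^sub>v n) = eucl_norm x"
    using eucl_norm_append[OF x zero_carrier_vec[of n]] by simp
  then have "eucl_norm (S *\<^sub>v (x @\<^sub>v 0\<^sub>v n)) \<le> s * eucl_norm x"
    using op_norm_bound[OF S x0] unfolding s_def by simp
  then have "(eucl_norm (S *\<^sub>v (x @\<^sub>v 0\<^sub>v n)))\<^sup>2 \<le> (s * eucl_norm x)\<^sup>2"
    by (intro power_mono) auto
  moreover have "S *\<^sub>v (x @\<^sub>v 0\<^sub>v n) = (S11 *\<^sub>v x) @\<^sub>v (S12\<^sup>T *\<^sub>v x)"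
    unfolding S_vec[OF x zero_carrier_vec] z using cc by simp
  ultimately have le: "(eucl_norm (S11 *\<^sub>v x))\<^sup>2 + (eucl_norm (S12\<^sup>T *\<^sub>v x))\<^sup>2 \<le> (s * eucl_norm x)\<^sup>2"
    using eucl_norm_append[OF cc] by simp
  have nn: "0 \<le> s * eucl_norm x" using consts_nonneg by simp
  show "eucl_norm (S11 *\<^sub>v x) \<le> s * eucl_norm x"
    by (rule power2_le_imp_le[OF _ nn]) (use le zero_le_power2[of "eucl_norm (S12\<^sup>T *\<^sub>v x)"] in linarith)
  show "eucl_norm (S12\<^sup>T *\<^sub>v x) \<le> s * eucl_norm x"
    by (rule power2_le_imp_le[OF _ nn]) (use le zero_le_power2[of "eucl_norm (S11 *\<^sub>v x)"] in linarith)
qed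

lemma S12_lower:
  assumes y: "y \<in> carrier_vec n"
  shows "eucl_norm y \<le> k * eucl_norm (S12 *\<^sub>v y)"
proof -
  define f where "f = S12 *\<^sub>v y"
  have f: "f \<in> carrier_vec n" unfolding f_def using S12 y by simp
  define g where "g = mat_inv (S12 * mat_inv S22 * S12\<^sup>T) *\<^sub>v f"
  have g: "g \<in> carrier_vec n" unfolding g_def using Z_inv_carrier f by simp
  have Jt: "J\<^sup>T \<in> carrier_mat n n" and SJ: "S22 * J \<in> carrier_mat n n" using S22 J by auto
  have Sy: "S22 *\<^sub>v y \<in> carrier_vec n" using S22 y by simp
  have "g = J\<^sup>T *\<^sub>v (S22 *\<^sub>v y)"
    unfolding g_def Z_inv assoc_mult_mat_vec[OF Jt SJ f] assoc_mult_mat_vec[OF S22 J(1) f]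
    unfolding f_def J_cancel(1)[OF y] ..
  then have "S12\<^sup>T *\<^sub>v g = S22 *\<^sub>v y" using J_cancel(3)[OF Sy] by simp
  then have "y = mat_inv S22 *\<^sub>v (S12\<^sup>T *\<^sub>v g)" using pos_def_mat_inv_mult(3)[OF S22_pos_def y] by simp
  then have "eucl_norm y \<le> r * eucl_norm (S12\<^sup>T *\<^sub>v g)"
    using S22_inv_norm[of "S12\<^sup>T *\<^sub>v g"] S12t g by (metis mult_mat_vec_carrier)
  also have "\<dots> \<le> r * (s * eucl_norm g)"
    by (intro mult_left_mono S_column_norm(2) g consts_nonneg)
  also have "\<dots> \<le> r * (s * (z * eucl_norm f))"
    unfolding g_def z_def by (intro mult_left_mono op_norm_bound[OF Z_inv_carrier f] consts_nonneg)
  finally show ?thesis unfolding k_def f_def by (simp add: mult_ac)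
qed

lemma W1_lower:
  assumes "x \<in> carrier_vec n"
  shows "x \<bullet> x \<le> w1 * (x \<bullet> (W1 *\<^sub>v x))"
  unfolding w1_def by (rule pos_def_mat_inv_bound[OF W1 assms n])

lemma W2_lower:
  assumes "u \<in> carrier_vec m"
  shows "u \<bullet> u \<le> w2 * (u \<bullet> (W2 *\<^sub>v u))"
  unfolding w2_def by (rule pos_def_mat_inv_bound[OF W2 assms m])

text \<open>Vectors with vanishing second component are invariant under \<open>M\<^sup>T\<close>,
  since the closed loop is block lower triangular. On them the equation reduces to that of the
  system alone.\<close>

lemma S11_lyap:
  assumes x: "x \<in> carrier_vec n"
  shows "2 * ((A\<^sup>T *\<^sub>v x) \<bullet> (S11 *\<^sub>v x)) = - (x \<bullet> (W1 *\<^sub>v x))"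
proof -
  have Ax: "A\<^sup>T *\<^sub>v x \<in> carrier_vec n" using At x by simp
  have z: "BK\<^sup>T *\<^sub>v 0\<^sub>v n = 0\<^sub>v m" "C\<^sup>T *\<^sub>v 0\<^sub>v m = 0\<^sub>v n" "AK\<^sup>T *\<^sub>v 0\<^sub>v n = 0\<^sub>v n" "W2 *\<^sub>v 0\<^sub>v m = 0\<^sub>v m"
    using BKt Ct AKt W2c by (auto intro!: eq_vecI)
  have x0: "x @\<^sub>v 0\<^sub>v n \<in> carrier_vec (n + n)" using x by simp
  have Mx: "M\<^sup>T *\<^sub>v (x @\<^sub>v 0\<^sub>v n) = (A\<^sup>T *\<^sub>v x) @\<^sub>v 0\<^sub>v n"
    unfolding Mt_vec[OF x zero_carrier_vec] z using Ax by simp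
  have sym: "symmetric_mat n S11" using S11_pos_def unfolding pos_def_def by simp
  have "x \<bullet> (S11 *\<^sub>v (A\<^sup>T *\<^sub>v x)) + (A\<^sup>T *\<^sub>v x) \<bullet> (S11 *\<^sub>v x) = - (x \<bullet> (W1 *\<^sub>v x))"
    using lyap_sol_form[OF M W S_lyap x0 x0]
    unfolding Mx S_form_fst[OF x Ax] S_form_fst[OF Ax x] W_form[OF x zero_carrier_vec x zero_carrier_vec] z
    by simp
  then show ?thesis using symmetric_form[OF sym x Ax] by simp
qed

text \<open>The noise has no off-diagonal block, so this block of the equation is homogeneous. It
  trades \<open>AK\<close>, for which no bound is available, against \<open>A\<close>, which
  \<open>S11_lyap\<close> then converts into \<open>W1\<close>.\<close>

lemma S12_lyap:
  assumes x: "x \<in> carrier_vec n" and y: "y \<in> carrier_vec n"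
  shows "x \<bullet> (S12 *\<^sub>v (AK\<^sup>T *\<^sub>v y)) =
    - ((A\<^sup>T *\<^sub>v x) \<bullet> (S12 *\<^sub>v y)) - x \<bullet> (S11 *\<^sub>v (C\<^sup>T *\<^sub>v (BK\<^sup>T *\<^sub>v y)))"
proof -
  have Ax: "A\<^sup>T *\<^sub>v x \<in> carrier_vec n" using At x by simp
  have z: "BK\<^sup>T *\<^sub>v 0\<^sub>v n = 0\<^sub>v m" "C\<^sup>T *\<^sub>v 0\<^sub>v m = 0\<^sub>v n" "AK\<^sup>T *\<^sub>v 0\<^sub>v n = 0\<^sub>v n" "A\<^sup>T *\<^sub>v 0\<^sub>v n = 0\<^sub>v n"
    "S11 *\<^sub>v 0\<^sub>v n = 0\<^sub>v n" "W1 *\<^sub>v 0\<^sub>v n = 0\<^sub>v n"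
    using BKt Ct AKt W1c At S11 by (auto intro!: eq_vecI)
  have x0: "x @\<^sub>v 0\<^sub>v n \<in> carrier_vec (n + n)" and y0: "0\<^sub>v n @\<^sub>v y \<in> carrier_vec (n + n)" using x y by auto
  define q where "q = C\<^sup>T *\<^sub>v (BK\<^sup>T *\<^sub>v y)"
  define y' where "y' = AK\<^sup>T *\<^sub>v y"
  have u: "BK\<^sup>T *\<^sub>v y \<in> carrier_vec m" using BKt y by simp
  have q: "q \<in> carrier_vec n" unfolding q_def using Ct u by simp
  have y': "y' \<in> carrier_vec n" unfolding y'_def using AKt y by simp
  have Mx: "M\<^sup>T *\<^sub>v (x @\<^sub>v 0\<^sub>v n) = (A\<^sup>T *\<^sub>v x) @\<^sub>v 0\<^sub>v n"
    unfolding Mt_vec[OF x zero_carrier_vec] z using Ax by simp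
  have My: "M\<^sup>T *\<^sub>v (0\<^sub>v n @\<^sub>v y) = q @\<^sub>v y'"
    unfolding Mt_vec[OF zero_carrier_vec y] z using q unfolding q_def y'_def by simp
  have f: "(p @\<^sub>v 0\<^sub>v n) \<bullet> (S *\<^sub>v (p' @\<^sub>v q')) = p \<bullet> (S11 *\<^sub>v p') + p \<bullet> (S12 *\<^sub>v q')"
    if c: "p \<in> carrier_vec n" "p' \<in> carrier_vec n" "q' \<in> carrier_vec n" for p p' q'
  proof -
    have d: "S11 *\<^sub>v p' \<in> carrier_vec n" "S12 *\<^sub>v q' \<in> carrier_vec n" using c S11 S12 by auto
    have e: "S12\<^sup>T *\<^sub>v p' + S22 *\<^sub>v q' \<in> carrier_vec n" using c S12t S22 by simp
    show ?thesis unfolding S_vec[OF c(2,3)]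
      using scalar_prod_append[OF c(1) zero_carrier_vec _ e, of "S11 *\<^sub>v p' + S12 *\<^sub>v q'"] c d e
      by (simp add: scalar_prod_add_distrib[of _ n])
  qed
  have "x \<bullet> (S11 *\<^sub>v q) + x \<bullet> (S12 *\<^sub>v y') + (A\<^sup>T *\<^sub>v x) \<bullet> (S12 *\<^sub>v y) = 0"
    using lyap_sol_form[OF M W S_lyap x0 y0] Ax x
    unfolding Mx My f[OF x q y'] f[OF Ax zero_carrier_vec y] W_form[OF x zero_carrier_vec zero_carrier_vec y] z
    using W2c u by simp
  then show ?thesis unfolding q_def y'_def by simp
qed

section \<open>The supersolution for the closed loop\<close>

definition "\<beta> = 2 * D * k\<^sup>2"
text \<open>Bookkeeping for \<open>X_ineq\<close>: \<open>\<beta>\<close> makes the dissipation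
  \<open>\<beta> * (g \<bullet> W1 g)\<close> worth twice
  \<open>k\<^sup>2 * (f \<bullet> f)\<close>, once to cover \<open>y \<bullet> y\<close> and once
  for half of the cross term. In \<open>\<alpha>\<close>, the summand \<open>w1\<close> covers
  \<open>x \<bullet> x\<close>, and the other one lets \<open>W2\<close> pay the remaining half of
  the cross term.\<close>

definition "\<alpha> = w1 + 2 * \<beta> * D * c\<^sup>2 * w2"
text \<open>The part of \<open>S22\<close> explained by the system state: \<open>S22 - T\<close> is
  the Schur complement of \<open>S11\<close> in \<open>S\<close>.\<close>

definition "T = S12\<^sup>T * (mat_inv S11 * S12)"
definition "X = \<alpha> \<cdot>\<^sub>m S + (- \<beta>) \<cdot>\<^sub>m four_block_mat (0\<^sub>m n n) (0\<^sub>m n n) (0\<^sub>m n n) T"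

lemma T: "T \<in> carrier_mat n n"
  unfolding T_def using S12t S12 pos_def_mat_inv(1)[OF S11_pos_def] by simp

lemma T_form:
  assumes "y \<in> carrier_vec n" "y' \<in> carrier_vec n"
  shows "y \<bullet> (T *\<^sub>v y') = (mat_inv S11 *\<^sub>v (S12 *\<^sub>v y)) \<bullet> (S12 *\<^sub>v y')"
proof -
  note i = pos_def_mat_inv(1)[OF S11_pos_def]
  have a: "mat_inv S11 * S12 \<in> carrier_mat n n" using i S12 by simp
  have cc: "S12 *\<^sub>v y \<in> carrier_vec n" "S12 *\<^sub>v y' \<in> carrier_vec n" using S12 assms by auto
  have ic: "mat_inv S11 *\<^sub>v (S12 *\<^sub>v y') \<in> carrier_vec n" using i cc by simp
  have "T *\<^sub>v y' = S12\<^sup>T *\<^sub>v (mat_inv S11 *\<^sub>v (S12 *\<^sub>v y'))"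
    unfolding T_def assoc_mult_mat_vec[OF S12t a assms(2)] assoc_mult_mat_vec[OF i S12 assms(2)] ..
  then have "y \<bullet> (T *\<^sub>v y') = (S12 *\<^sub>v y) \<bullet> (mat_inv S11 *\<^sub>v (S12 *\<^sub>v y'))"
    using transpose_vec_mult_scalar[OF S12t ic assms(1)] by simp
  also have "\<dots> = (mat_inv S11 *\<^sub>v (S12 *\<^sub>v y)) \<bullet> (S12 *\<^sub>v y')"
    by (rule pos_def_mat_inv_symmetric_form[OF S11_pos_def cc])
  finally show ?thesis .
qed

lemma X_form:
  assumes xy: "x \<in> carrier_vec n" "y \<in> carrier_vec n" "x' \<in> carrier_vec n" "y' \<in> carrier_vec n"
  shows "(x @\<^sub>v y) \<bullet> (X *\<^sub>v (x' @\<^sub>v y')) =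
    \<alpha> * ((x @\<^sub>v y) \<bullet> (S *\<^sub>v (x' @\<^sub>v y'))) - \<beta> * ((mat_inv S11 *\<^sub>v (S12 *\<^sub>v y)) \<bullet> (S12 *\<^sub>v y'))"
proof -
  let ?F = "four_block_mat (0\<^sub>m n n) (0\<^sub>m n n) (0\<^sub>m n n) T"
  have F: "?F \<in> carrier_mat (n + n) (n + n)" using T by simp
  have v: "x @\<^sub>v y \<in> carrier_vec (n + n)" "x' @\<^sub>v y' \<in> carrier_vec (n + n)" using xy by auto
  have Ty: "T *\<^sub>v y' \<in> carrier_vec n" using T xy by simp
  have Fv: "?F *\<^sub>v (x' @\<^sub>v y') = 0\<^sub>v n @\<^sub>v (T *\<^sub>v y')"
    unfolding four_block_mat_mult_vec[OF zero_carrier_mat zero_carrier_mat zero_carrier_mat T xy(3,4)]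
    using xy Ty by simp
  have "(x @\<^sub>v y) \<bullet> (?F *\<^sub>v (x' @\<^sub>v y')) = y \<bullet> (T *\<^sub>v y')"
    unfolding Fv using scalar_prod_append[OF xy(1,2) zero_carrier_vec Ty] xy by simp
  moreover have "X *\<^sub>v (x' @\<^sub>v y') = \<alpha> \<cdot>\<^sub>v (S *\<^sub>v (x' @\<^sub>v y')) + (- \<beta>) \<cdot>\<^sub>v (?F *\<^sub>v (x' @\<^sub>v y'))"
    unfolding X_def using S F v
    by (subst add_mult_distrib_mat_vec[of _ "n + n" "n + n"]) (auto simp: smult_mult_mat_vec[of _ "n + n" "n + n"])
  moreover have "S *\<^sub>v (x' @\<^sub>v y') \<in> carrier_vec (n + n)" "?F *\<^sub>v (x' @\<^sub>v y') \<in> carrier_vec (n + n)"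
    using S F v by (auto intro: mult_mat_vec_carrier)
  ultimately show ?thesis
    unfolding T_form[OF xy(2,4), symmetric] using v by (simp add: scalar_prod_add_distrib[of _ "n + n"])
qed

lemma X_symmetric: "symmetric_mat (n + n) X"
proof -
  have Tt: "T\<^sup>T = T"
  proof (rule mat_eq_formI[OF _ T])
    show "T\<^sup>T \<in> carrier_mat n n" using T by simp
    fix u v :: "real Matrix.vec" assume uv: "u \<in> carrier_vec n" "v \<in> carrier_vec n"
    have cc: "S12 *\<^sub>v u \<in> carrier_vec n" "S12 *\<^sub>v v \<in> carrier_vec n" using S12 uv by auto
    have Tv: "T *\<^sub>v u \<in> carrier_vec n" "T\<^sup>T *\<^sub>v v \<in> carrier_vec n" using T uv by auto
    have "u \<bullet> (T\<^sup>T *\<^sub>v v) = (T\<^sup>T *\<^sub>v v) \<bullet> u" by (rule comm_scalar_prod[OF uv(1) Tv(2)])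
    also have "\<dots> = v \<bullet> (T *\<^sub>v u)" by (rule transpose_vec_mult_scalar[OF T uv])
    also have "\<dots> = (S12 *\<^sub>v v) \<bullet> (mat_inv S11 *\<^sub>v (S12 *\<^sub>v u))"
      unfolding T_form[OF uv(2,1)] by (rule pos_def_mat_inv_symmetric_form[OF S11_pos_def cc(2,1), symmetric])
    also have "\<dots> = u \<bullet> (T *\<^sub>v v)"
      unfolding T_form[OF uv] by (rule comm_scalar_prod[OF cc(2) pos_def_mat_inv_mult(1)[OF S11_pos_def cc(1)]])
    finally show "u \<bullet> (T\<^sup>T *\<^sub>v v) = u \<bullet> (T *\<^sub>v v)" .
  qed
  let ?F = "four_block_mat (0\<^sub>m n n) (0\<^sub>m n n) (0\<^sub>m n n) T"
  have F: "?F \<in> carrier_mat (n + n) (n + n)" using T by simp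
  have Ft: "?F\<^sup>T = ?F"
    using transpose_four_block_mat[of "0\<^sub>m n n" n n "0\<^sub>m n n" n "0\<^sub>m n n" n T] T Tt by simp
  have St: "S\<^sup>T = S" using S_symmetric unfolding symmetric_mat_def by simp
  have "X\<^sup>T = (\<alpha> \<cdot>\<^sub>m S)\<^sup>T + ((- \<beta>) \<cdot>\<^sub>m ?F)\<^sup>T"
    unfolding X_def by (rule transpose_add[of _ "n + n" "n + n"]) (use S F in auto)
  also have "(\<alpha> \<cdot>\<^sub>m S)\<^sup>T = \<alpha> \<cdot>\<^sub>m S\<^sup>T" by (intro eq_matI) auto
  also have "((- \<beta>) \<cdot>\<^sub>m ?F)\<^sup>T = (- \<beta>) \<cdot>\<^sub>m ?F\<^sup>T" by (intro eq_matI) auto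
  finally have "X\<^sup>T = X" unfolding St Ft X_def .
  moreover have "X \<in> carrier_mat (n + n) (n + n)" unfolding X_def using F by simp
  ultimately show ?thesis unfolding symmetric_mat_def by simp
qed

lemma greek_nonneg: "0 \<le> \<beta>" "w1 \<le> \<alpha>" "0 \<le> \<alpha>" "2 * \<beta> * D * c\<^sup>2 * w2 \<le> \<alpha>"
proof -
  show b: "0 \<le> \<beta>" unfolding \<beta>_def using consts_nonneg by simp
  have "0 \<le> 2 * \<beta> * D * c\<^sup>2 * w2" using b consts_nonneg by simp
  then show "w1 \<le> \<alpha>" "0 \<le> \<alpha>" "2 * \<beta> * D * c\<^sup>2 * w2 \<le> \<alpha>" unfolding \<alpha>_def using consts_nonneg by auto
qed

lemma X_ineq:
  assumes w: "w \<in> carrier_vec (n + n)"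
  shows "w \<bullet> (X *\<^sub>v (M\<^sup>T *\<^sub>v w)) + (M\<^sup>T *\<^sub>v w) \<bullet> (X *\<^sub>v w) \<le> - (w \<bullet> w)"
proof -
  obtain x y where xy: "x \<in> carrier_vec n" "y \<in> carrier_vec n" "w = x @\<^sub>v y"
    using append_vec_cases[OF w] by blast
  define u where "u = BK\<^sup>T *\<^sub>v y"
  define f where "f = S12 *\<^sub>v y"
  define g where "g = mat_inv S11 *\<^sub>v f"
  have u: "u \<in> carrier_vec m" unfolding u_def using BKt xy by simp
  have f: "f \<in> carrier_vec n" unfolding f_def using S12 xy by simp
  have g: "g \<in> carrier_vec n" "S11 *\<^sub>v g = f"
    unfolding g_def using pos_def_mat_inv_mult[OF S11_pos_def f] by auto
  define x' where "x' = A\<^sup>T *\<^sub>v x + C\<^sup>T *\<^sub>v u"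
  define y' where "y' = AK\<^sup>T *\<^sub>v y"
  have Cu: "C\<^sup>T *\<^sub>v u \<in> carrier_vec n" using Ct u by simp
  have x': "x' \<in> carrier_vec n" unfolding x'_def using At xy Cu by simp
  have y': "y' \<in> carrier_vec n" unfolding y'_def using AKt xy by simp
  have Mw: "M\<^sup>T *\<^sub>v w = x' @\<^sub>v y'"
    unfolding xy(3) Mt_vec[OF xy(1,2)] x'_def y'_def u_def ..
  have Sy': "S12 *\<^sub>v y' \<in> carrier_vec n" using S12 y' by simp
  have sym1: "(mat_inv S11 *\<^sub>v (S12 *\<^sub>v y')) \<bullet> f = g \<bullet> (S12 *\<^sub>v y')"
    unfolding g_def
    using pos_def_mat_inv_symmetric_form[OF S11_pos_def f Sy']
      comm_scalar_prod[OF f pos_def_mat_inv_mult(1)[OF S11_pos_def Sy']] by simp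
  have sym11: "symmetric_mat n S11" using S11_pos_def unfolding pos_def_def by simp
  \<comment> \<open>Moving \<open>S11\<close> to the left factor turns \<open>g\<close> into
    \<open>f\<close>, so the cross term involves only \<open>C\<close> besides the vectors
    \<open>f\<close> and \<open>u\<close>.\<close>
  have "g \<bullet> (S11 *\<^sub>v (C\<^sup>T *\<^sub>v u)) = f \<bullet> (C\<^sup>T *\<^sub>v u)"
    using symmetric_form[OF sym11 g(1) Cu] comm_scalar_prod[OF f Cu] g(2) by simp
  also have "\<dots> = (C *\<^sub>v f) \<bullet> u"
    using transpose_vec_mult_scalar[OF Ct u f] by simp
  finally have gy: "2 * (g \<bullet> (S12 *\<^sub>v y')) = g \<bullet> (W1 *\<^sub>v g) - 2 * ((C *\<^sub>v f) \<bullet> u)"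
    using S12_lyap[OF g(1) xy(2)] S11_lyap[OF g(1)] unfolding y'_def u_def f_def[symmetric] g(2) by simp
  have Xw: "w \<bullet> (X *\<^sub>v (M\<^sup>T *\<^sub>v w)) + (M\<^sup>T *\<^sub>v w) \<bullet> (X *\<^sub>v w) =
      - (\<alpha> * (x \<bullet> (W1 *\<^sub>v x) + u \<bullet> (W2 *\<^sub>v u))) - \<beta> * (g \<bullet> (W1 *\<^sub>v g) - 2 * ((C *\<^sub>v f) \<bullet> u))"
  proof -
    have "w \<bullet> (X *\<^sub>v (M\<^sup>T *\<^sub>v w)) + (M\<^sup>T *\<^sub>v w) \<bullet> (X *\<^sub>v w) =
        \<alpha> * (w \<bullet> (S *\<^sub>v (M\<^sup>T *\<^sub>v w)) + (M\<^sup>T *\<^sub>v w) \<bullet> (S *\<^sub>v w)) - \<beta> * (2 * (g \<bullet> (S12 *\<^sub>v y')))"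
      unfolding Mw unfolding xy(3) X_form[OF xy(1,2) x' y'] X_form[OF x' y' xy(1,2)]
        f_def[symmetric] g_def[symmetric] sym1
      by (simp add: algebra_simps)
    also have "w \<bullet> (S *\<^sub>v (M\<^sup>T *\<^sub>v w)) + (M\<^sup>T *\<^sub>v w) \<bullet> (S *\<^sub>v w) = - (x \<bullet> (W1 *\<^sub>v x) + u \<bullet> (W2 *\<^sub>v u))"
      unfolding lyap_sol_form[OF M W S_lyap w w] unfolding xy(3) W_form[OF xy(1,2,1,2)] u_def ..
    finally show ?thesis unfolding gy by (simp add: algebra_simps)
  qed
  define F where "F = eucl_norm f"
  define V where "V = eucl_norm u"
  have FV: "0 \<le> F" "0 \<le> V" unfolding F_def V_def by auto
  have px: "0 \<le> x \<bullet> (W1 *\<^sub>v x)" by (rule W1_nonneg[OF xy(1)])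
  have pu: "0 \<le> u \<bullet> (W2 *\<^sub>v u)" by (rule W2_nonneg[OF u])
  have "F\<^sup>2 \<le> (s * eucl_norm g)\<^sup>2"
    unfolding F_def using S_column_norm(1)[OF g(1)] g(2) by (intro power_mono) auto
  also have "\<dots> = s\<^sup>2 * (g \<bullet> g)" by (simp add: power_mult_distrib eucl_norm_sq)
  also have "\<dots> \<le> s\<^sup>2 * (w1 * (g \<bullet> (W1 *\<^sub>v g)))" by (intro mult_left_mono W1_lower[OF g(1)]) simp
  finally have Fq: "F\<^sup>2 \<le> D * (g \<bullet> (W1 *\<^sub>v g))" unfolding D_def by (simp add: mult_ac)
  have Cf: "C *\<^sub>v f \<in> carrier_vec m" using C f by simp
  have "\<bar>(C *\<^sub>v f) \<bullet> u\<bar> \<le> eucl_norm (C *\<^sub>v f) * V"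
    unfolding V_def by (rule vec_Cauchy_Schwarz[OF Cf u])
  also have "\<dots> \<le> c * F * V"
    unfolding c_def F_def using op_norm_bound[OF C f] FV(2) by (rule mult_right_mono)
  finally have cr: "(C *\<^sub>v f) \<bullet> u \<le> c * F * V" by simp
  have "(eucl_norm y)\<^sup>2 \<le> (k * F)\<^sup>2"
    unfolding F_def f_def using S12_lower[OF xy(2)] by (intro power_mono) auto
  then have yy: "y \<bullet> y \<le> k\<^sup>2 * F\<^sup>2" by (simp add: eucl_norm_sq power_mult_distrib)
  have xx: "x \<bullet> x \<le> \<alpha> * (x \<bullet> (W1 *\<^sub>v x))"
    using W1_lower[OF xy(1)] mult_right_mono[OF greek_nonneg(2) px] by linarith
  have uu: "2 * \<beta> * D * c\<^sup>2 * V\<^sup>2 \<le> \<alpha> * (u \<bullet> (W2 *\<^sub>v u))"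
  proof -
    have "2 * \<beta> * D * c\<^sup>2 * V\<^sup>2 \<le> 2 * \<beta> * D * c\<^sup>2 * (w2 * (u \<bullet> (W2 *\<^sub>v u)))"
      unfolding V_def eucl_norm_sq using greek_nonneg(1) consts_nonneg
      by (intro mult_left_mono W2_lower[OF u]) auto
    also have "\<dots> \<le> \<alpha> * (u \<bullet> (W2 *\<^sub>v u))"
      using mult_right_mono[OF greek_nonneg(4) pu] by (simp add: mult_ac)
    finally show ?thesis .
  qed
  have qq: "2 * k\<^sup>2 * F\<^sup>2 \<le> \<beta> * (g \<bullet> (W1 *\<^sub>v g))"
    using mult_left_mono[OF Fq, of "2 * k\<^sup>2"] unfolding \<beta>_def by (simp add: mult_ac)
  have cc: "\<beta> * (2 * ((C *\<^sub>v f) \<bullet> u)) \<le> 2 * \<beta> * (c * F * V)"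
    using mult_left_mono[OF cr, of "2 * \<beta>"] greek_nonneg(1) by (simp add: mult_ac)
  \<comment> \<open>Young's inequality for the cross term. Its weights are those for which the
    \<open>F\<close> part uses exactly half of \<open>qq\<close> and the \<open>V\<close> part
    exactly the bound \<open>uu\<close>.\<close>
  have "0 \<le> k\<^sup>2 * (F - 2 * D * c * V)\<^sup>2" by simp
  also have "\<dots> = k\<^sup>2 * F\<^sup>2 - 2 * \<beta> * (c * F * V) + 2 * \<beta> * D * c\<^sup>2 * V\<^sup>2"
    unfolding \<beta>_def by (simp add: power2_eq_square algebra_simps)
  finally have sq: "2 * \<beta> * (c * F * V) \<le> k\<^sup>2 * F\<^sup>2 + 2 * \<beta> * D * c\<^sup>2 * V\<^sup>2" by simp
  have ww: "w \<bullet> w = x \<bullet> x + y \<bullet> y" unfolding xy(3) by (rule scalar_prod_append[OF xy(1,2,1,2)])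
  show ?thesis unfolding Xw ww using xx yy uu qq cc sq by (simp add: algebra_simps)
qed

text \<open>The correction is subtracted and its form is nonnegative, so only
  \<open>\<alpha> S\<close> contributes.\<close>

lemma X_le:
  assumes w: "w \<in> carrier_vec (n + n)"
  shows "w \<bullet> (X *\<^sub>v w) \<le> (\<alpha> * s) * (w \<bullet> w)"
proof -
  obtain x y where xy: "x \<in> carrier_vec n" "y \<in> carrier_vec n" "w = x @\<^sub>v y"
    using append_vec_cases[OF w] by blast
  have f: "S12 *\<^sub>v y \<in> carrier_vec n" using S12 xy by simp
  note i = pos_def_mat_inv_mult[OF S11_pos_def f]
  have "0 \<le> (mat_inv S11 *\<^sub>v (S12 *\<^sub>v y)) \<bullet> (S11 *\<^sub>v (mat_inv S11 *\<^sub>v (S12 *\<^sub>v y)))"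
    using pos_def_imp_pos_semidef[OF S11_pos_def] i(1) unfolding pos_semidef_def by blast
  then have "0 \<le> \<beta> * ((mat_inv S11 *\<^sub>v (S12 *\<^sub>v y)) \<bullet> (S12 *\<^sub>v y))"
    unfolding i(2) using greek_nonneg(1) by simp
  then have "w \<bullet> (X *\<^sub>v w) \<le> \<alpha> * (w \<bullet> (S *\<^sub>v w))"
    unfolding xy(3) X_form[OF xy(1,2,1,2)] by simp
  also have "\<dots> \<le> \<alpha> * (s * (w \<bullet> w))"
    unfolding s_def using op_norm_quadratic_form[OF S w] greek_nonneg(3) by (intro mult_left_mono) auto
  finally show ?thesis by simp
qed

section \<open>The supersolution for the transposed closed loop\<close>

definition "\<alpha>' = s\<^sup>2 * (1 + 2 * k\<^sup>2 * s\<^sup>2) * w1"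
text \<open>Both primed constants are read off from the final chain of \<open>P_ineq\<close>: in the
  bound of \<open>w \<bullet> w\<close>, \<open>\<alpha>'\<close> is the coefficient of
  \<open>Gx\<^sup>2\<close> times \<open>w1\<close>, and \<open>\<beta>'\<close> is the coefficient
  of \<open>E\<^sup>2\<close> times \<open>D\<close>.\<close>

definition "\<beta>' = 2 * s\<^sup>2 * k\<^sup>2 * D"
definition "P = \<alpha>' \<cdot>\<^sub>m mat_inv S + \<beta>' \<cdot>\<^sub>m four_block_mat (mat_inv S11) (0\<^sub>m n n) (0\<^sub>m n n) (0\<^sub>m n n)"

lemma P_form:
  assumes xy: "x \<in> carrier_vec n" "y \<in> carrier_vec n" "x' \<in> carrier_vec n" "y' \<in> carrier_vec n"
  shows "(x @\<^sub>v y) \<bullet> (P *\<^sub>v (x' @\<^sub>v y')) =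
    \<alpha>' * ((mat_inv S *\<^sub>v (x @\<^sub>v y)) \<bullet> (x' @\<^sub>v y')) + \<beta>' * ((mat_inv S11 *\<^sub>v x) \<bullet> x')"
proof -
  note i = pos_def_mat_inv(1)[OF S11_pos_def] and iS = pos_def_mat_inv(1)[OF S_pos_def]
  let ?F = "four_block_mat (mat_inv S11) (0\<^sub>m n n) (0\<^sub>m n n) (0\<^sub>m n n)"
  have F: "?F \<in> carrier_mat (n + n) (n + n)" using i by simp
  have v: "x @\<^sub>v y \<in> carrier_vec (n + n)" "x' @\<^sub>v y' \<in> carrier_vec (n + n)" using xy by auto
  have Ix: "mat_inv S11 *\<^sub>v x' \<in> carrier_vec n" using i xy by simp
  have Fv: "?F *\<^sub>v (x' @\<^sub>v y') = (mat_inv S11 *\<^sub>v x') @\<^sub>v 0\<^sub>v n"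
    unfolding four_block_mat_mult_vec[OF i zero_carrier_mat zero_carrier_mat zero_carrier_mat xy(3,4)]
    using xy Ix by simp
  have "(x @\<^sub>v y) \<bullet> (?F *\<^sub>v (x' @\<^sub>v y')) = x \<bullet> (mat_inv S11 *\<^sub>v x')"
    unfolding Fv using scalar_prod_append[OF xy(1,2) Ix zero_carrier_vec] xy by simp
  also have "\<dots> = (mat_inv S11 *\<^sub>v x) \<bullet> x'"
    by (rule pos_def_mat_inv_symmetric_form[OF S11_pos_def xy(1,3)])
  finally have 1: "(x @\<^sub>v y) \<bullet> (?F *\<^sub>v (x' @\<^sub>v y')) = (mat_inv S11 *\<^sub>v x) \<bullet> x'" .
  have 2: "(x @\<^sub>v y) \<bullet> (mat_inv S *\<^sub>v (x' @\<^sub>v y')) = (mat_inv S *\<^sub>v (x @\<^sub>v y)) \<bullet> (x' @\<^sub>v y')"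
    by (rule pos_def_mat_inv_symmetric_form[OF S_pos_def v])
  have "P *\<^sub>v (x' @\<^sub>v y') = \<alpha>' \<cdot>\<^sub>v (mat_inv S *\<^sub>v (x' @\<^sub>v y')) + \<beta>' \<cdot>\<^sub>v (?F *\<^sub>v (x' @\<^sub>v y'))"
    unfolding P_def using iS F v
    by (subst add_mult_distrib_mat_vec[of _ "n + n" "n + n"]) (auto simp: smult_mult_mat_vec[of _ "n + n" "n + n"])
  moreover have "mat_inv S *\<^sub>v (x' @\<^sub>v y') \<in> carrier_vec (n + n)" "?F *\<^sub>v (x' @\<^sub>v y') \<in> carrier_vec (n + n)"
    using mult_mat_vec_carrier[OF iS v(2)] mult_mat_vec_carrier[OF F v(2)] by auto
  ultimately show ?thesis
    unfolding 1[symmetric] 2[symmetric] using v by (simp add: scalar_prod_add_distrib[of _ "n + n"])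
qed

lemma P: "P \<in> carrier_mat (n + n) (n + n)"
  unfolding P_def using pos_def_mat_inv(1)[OF S11_pos_def] by simp

lemma greek'_nonneg: "0 \<le> \<alpha>'" "0 \<le> \<beta>'"
  unfolding \<alpha>'_def \<beta>'_def using consts_nonneg by auto

text \<open>With \<open>g = S\<^sup>-\<^sup>1 w\<close>, the \<open>S\<^sup>-\<^sup>1\<close> part
  dissipates \<open>g \<bullet> W g\<close>, which controls the first component \<open>gx\<close> of
  \<open>g\<close> only. The \<open>S11\<^sup>-\<^sup>1\<close> part controls \<open>x\<close>. The
  first block row \<open>x = S11 gx + S12 gy\<close> then bounds \<open>S12 gy\<close>, hence
  \<open>gy\<close> through \<open>k\<close>, and finally \<open>w = S g\<close>.\<close>

lemma P_ineq:
  assumes w: "w \<in> carrier_vec (n + n)"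
  shows "w \<bullet> (P *\<^sub>v (M *\<^sub>v w)) + (M *\<^sub>v w) \<bullet> (P *\<^sub>v w) \<le> - (w \<bullet> w)"
proof -
  obtain x y where xy: "x \<in> carrier_vec n" "y \<in> carrier_vec n" "w = x @\<^sub>v y"
    using append_vec_cases[OF w] by blast
  define g where "g = mat_inv S *\<^sub>v w"
  have g: "g \<in> carrier_vec (n + n)" "S *\<^sub>v g = w"
    unfolding g_def using pos_def_mat_inv_mult[OF S_pos_def w] by auto
  obtain gx gy where gxy: "gx \<in> carrier_vec n" "gy \<in> carrier_vec n" "g = gx @\<^sub>v gy"
    using append_vec_cases[OF g(1)] by blast
  define h where "h = mat_inv S11 *\<^sub>v x"
  have h: "h \<in> carrier_vec n" "S11 *\<^sub>v h = x"
    unfolding h_def using pos_def_mat_inv_mult[OF S11_pos_def xy(1)] by auto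
  define x' where "x' = A *\<^sub>v x"
  define y' where "y' = (BK * C) *\<^sub>v x + AK *\<^sub>v y"
  have x': "x' \<in> carrier_vec n" unfolding x'_def using A xy by simp
  have "(BK * C) *\<^sub>v x \<in> carrier_vec n" by (rule mult_mat_vec_carrier[OF BKC xy(1)])
  then have y': "y' \<in> carrier_vec n" unfolding y'_def using AK xy by simp
  have Mw: "M *\<^sub>v w = x' @\<^sub>v y'" unfolding xy(3) M_vec[OF xy(1,2)] x'_def y'_def ..
  have Mwc: "M *\<^sub>v w \<in> carrier_vec (n + n)" by (rule mult_mat_vec_carrier[OF M w])
  have Mtg: "M\<^sup>T *\<^sub>v g \<in> carrier_vec (n + n)" by (rule mult_mat_vec_carrier[OF Mt g(1)])
  have Ath: "A\<^sup>T *\<^sub>v h \<in> carrier_vec n" by (rule mult_mat_vec_carrier[OF At h(1)])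
  have s1: "(mat_inv S *\<^sub>v (M *\<^sub>v w)) \<bullet> w = g \<bullet> (M *\<^sub>v w)"
    unfolding g_def using pos_def_mat_inv_symmetric_form[OF S_pos_def w Mwc]
      comm_scalar_prod[OF w pos_def_mat_inv_mult(1)[OF S_pos_def Mwc]] by simp
  have s2: "(mat_inv S11 *\<^sub>v x') \<bullet> x = h \<bullet> x'"
    unfolding h_def using pos_def_mat_inv_symmetric_form[OF S11_pos_def xy(1) x']
      comm_scalar_prod[OF xy(1) pos_def_mat_inv_mult(1)[OF S11_pos_def x']] by simp
  \<comment> \<open>Writing \<open>w\<close> as \<open>S g\<close> turns the derivative of the
    \<open>S\<^sup>-\<^sup>1\<close> form at \<open>w\<close> into the Lyapunov equation of
    \<open>S\<close> tested at \<open>g\<close>.\<close>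
  have "g \<bullet> (M *\<^sub>v w) = (M\<^sup>T *\<^sub>v g) \<bullet> (S *\<^sub>v g)"
    unfolding g(2) by (rule transpose_vec_mult_scalar[OF M w g(1), symmetric])
  then have g2: "2 * (g \<bullet> (M *\<^sub>v w)) = - (g \<bullet> (W *\<^sub>v g))"
    using lyap_sol_form[OF M W S_lyap g(1) g(1)] symmetric_form[OF S_symmetric g(1) Mtg] by simp
  have "h \<bullet> x' = (A\<^sup>T *\<^sub>v h) \<bullet> (S11 *\<^sub>v h)"
    unfolding h(2) x'_def by (rule transpose_vec_mult_scalar[OF A xy(1) h(1), symmetric])
  then have h2: "2 * (h \<bullet> x') = - (h \<bullet> (W1 *\<^sub>v h))" using S11_lyap[OF h(1)] by simp
  have "w \<bullet> (P *\<^sub>v (M *\<^sub>v w)) + (M *\<^sub>v w) \<bullet> (P *\<^sub>v w) =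
      \<alpha>' * (g \<bullet> (M *\<^sub>v w) + (mat_inv S *\<^sub>v (M *\<^sub>v w)) \<bullet> w) + \<beta>' * (h \<bullet> x' + (mat_inv S11 *\<^sub>v x') \<bullet> x)"
    unfolding g_def h_def Mw unfolding xy(3) P_form[OF xy(1,2) x' y'] P_form[OF x' y' xy(1,2)]
    by (simp add: algebra_simps)
  then have Pw: "w \<bullet> (P *\<^sub>v (M *\<^sub>v w)) + (M *\<^sub>v w) \<bullet> (P *\<^sub>v w) =
      - (\<alpha>' * (g \<bullet> (W *\<^sub>v g))) - \<beta>' * (h \<bullet> (W1 *\<^sub>v h))"
    unfolding s1 s2 using g2 h2 by (simp add: mult_2[symmetric])
  define Gx Gy E where "Gx = eucl_norm gx" and "Gy = eucl_norm gy" and "E = eucl_norm x"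
  have "BK\<^sup>T *\<^sub>v gy \<in> carrier_vec m" using BKt gxy by simp
  then have "gx \<bullet> (W1 *\<^sub>v gx) \<le> g \<bullet> (W *\<^sub>v g)"
    unfolding gxy(3) W_form[OF gxy(1,2,1,2)] using W2_nonneg by simp
  then have Gx: "Gx\<^sup>2 \<le> w1 * (g \<bullet> (W *\<^sub>v g))"
    unfolding Gx_def eucl_norm_sq using W1_lower[OF gxy(1)] consts_nonneg(4)
    by (meson mult_left_mono order_trans)
  have "E\<^sup>2 \<le> (s * eucl_norm h)\<^sup>2"
    unfolding E_def using S_column_norm(1)[OF h(1)] h(2) by (intro power_mono) auto
  also have "\<dots> = s\<^sup>2 * (h \<bullet> h)" by (simp add: power_mult_distrib eucl_norm_sq)
  also have "\<dots> \<le> s\<^sup>2 * (w1 * (h \<bullet> (W1 *\<^sub>v h)))" by (intro mult_left_mono W1_lower[OF h(1)]) simp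
  finally have E: "E\<^sup>2 \<le> D * (h \<bullet> (W1 *\<^sub>v h))" unfolding D_def by (simp add: mult_ac)
  have "(S11 *\<^sub>v gx + S12 *\<^sub>v gy) @\<^sub>v (S12\<^sup>T *\<^sub>v gx + S22 *\<^sub>v gy) = x @\<^sub>v y"
    using g(2) unfolding gxy(3) S_vec[OF gxy(1,2)] xy(3) .
  moreover have cc: "S11 *\<^sub>v gx \<in> carrier_vec n" "S12 *\<^sub>v gy \<in> carrier_vec n" using S11 S12 gxy by auto
  moreover have "S11 *\<^sub>v gx + S12 *\<^sub>v gy \<in> carrier_vec n" using cc by simp
  ultimately have xe: "S11 *\<^sub>v gx + S12 *\<^sub>v gy = x" using xy(1) by (metis append_vec_eq)
  have "S12 *\<^sub>v gy = x + (- 1) \<cdot>\<^sub>v (S11 *\<^sub>v gx)" unfolding xe[symmetric] using cc S11 S12 by (intro eq_vecI) auto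
  then have "eucl_norm (S12 *\<^sub>v gy) \<le> E + eucl_norm (S11 *\<^sub>v gx)"
    using eucl_norm_triangle[OF xy(1), of "(- 1) \<cdot>\<^sub>v (S11 *\<^sub>v gx)"] cc
    unfolding E_def by (simp add: eucl_norm_smult[OF cc(1)])
  also have "\<dots> \<le> E + s * Gx" unfolding Gx_def using S_column_norm(1)[OF gxy(1)] by simp
  finally have "Gy \<le> k * (E + s * Gx)"
    unfolding Gy_def using S12_lower[OF gxy(2)] mult_left_mono[OF _ consts_nonneg(7)] by (meson order_trans)
  then have "Gy\<^sup>2 \<le> (k * (E + s * Gx))\<^sup>2" unfolding Gy_def by (intro power_mono) auto
  \<comment> \<open>The square of a sum is at most twice the sum of the squares; this is the factor
    \<open>2\<close> in the primed constants.\<close>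
  also have "\<dots> \<le> k\<^sup>2 * (2 * (E\<^sup>2 + s\<^sup>2 * Gx\<^sup>2))"
  proof -
    have "0 \<le> (E - s * Gx)\<^sup>2" by simp
    then have "(E + s * Gx)\<^sup>2 \<le> 2 * (E\<^sup>2 + s\<^sup>2 * Gx\<^sup>2)" by (simp add: power2_eq_square algebra_simps)
    then show ?thesis unfolding power_mult_distrib by (intro mult_left_mono) auto
  qed
  finally have Gy: "Gy\<^sup>2 \<le> k\<^sup>2 * (2 * (E\<^sup>2 + s\<^sup>2 * Gx\<^sup>2))" .
  have "(eucl_norm w)\<^sup>2 \<le> (s * eucl_norm g)\<^sup>2"
    using op_norm_bound[OF S g(1)] unfolding g(2) s_def by (intro power_mono) auto
  then have "w \<bullet> w \<le> s\<^sup>2 * (Gx\<^sup>2 + Gy\<^sup>2)"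
    unfolding power_mult_distrib eucl_norm_sq Gx_def Gy_def gxy(3) scalar_prod_append[OF gxy(1,2,1,2)] .
  also have "\<dots> \<le> s\<^sup>2 * (Gx\<^sup>2 + k\<^sup>2 * (2 * (E\<^sup>2 + s\<^sup>2 * Gx\<^sup>2)))"
    using Gy by (intro mult_left_mono) auto
  also have "\<dots> = s\<^sup>2 * (1 + 2 * k\<^sup>2 * s\<^sup>2) * Gx\<^sup>2 + 2 * s\<^sup>2 * k\<^sup>2 * E\<^sup>2" by (simp add: algebra_simps)
  also have "\<dots> \<le> s\<^sup>2 * (1 + 2 * k\<^sup>2 * s\<^sup>2) * (w1 * (g \<bullet> (W *\<^sub>v g))) + 2 * s\<^sup>2 * k\<^sup>2 * (D * (h \<bullet> (W1 *\<^sub>v h)))"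
    by (intro add_mono mult_left_mono Gx E) auto
  also have "\<dots> = \<alpha>' * (g \<bullet> (W *\<^sub>v g)) + \<beta>' * (h \<bullet> (W1 *\<^sub>v h))"
    unfolding \<alpha>'_def \<beta>'_def by (simp add: mult_ac)
  finally show ?thesis unfolding Pw by simp
qed

lemma P_le:
  assumes w: "w \<in> carrier_vec (n + n)"
  shows "w \<bullet> (P *\<^sub>v w) \<le> (r * (\<alpha>' + \<beta>')) * (w \<bullet> w)"
proof -
  obtain x y where xy: "x \<in> carrier_vec n" "y \<in> carrier_vec n" "w = x @\<^sub>v y"
    using append_vec_cases[OF w] by blast
  have ww: "w \<bullet> w = x \<bullet> x + y \<bullet> y" unfolding xy(3) by (rule scalar_prod_append[OF xy(1,2,1,2)])
  have iw: "mat_inv S *\<^sub>v w \<in> carrier_vec (n + n)" by (rule pos_def_mat_inv_mult(1)[OF S_pos_def w])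
  have "(mat_inv S *\<^sub>v w) \<bullet> w \<le> r * (w \<bullet> w)"
    using op_norm_quadratic_form[OF pos_def_mat_inv(1)[OF S_pos_def] w] comm_scalar_prod[OF iw w]
    unfolding r_def by simp
  moreover have "(mat_inv S11 *\<^sub>v x) \<bullet> x \<le> r * (w \<bullet> w)"
  proof -
    have ix: "mat_inv S11 *\<^sub>v x \<in> carrier_vec n" by (rule pos_def_mat_inv_mult(1)[OF S11_pos_def xy(1)])
    have "(mat_inv S11 *\<^sub>v x) \<bullet> x \<le> eucl_norm (mat_inv S11 *\<^sub>v x) * eucl_norm x"
      using vec_Cauchy_Schwarz[OF ix xy(1)] by simp
    also have "\<dots> \<le> r * eucl_norm x * eucl_norm x"
      by (intro mult_right_mono S11_inv_norm xy(1)) simp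
    also have "\<dots> = r * (x \<bullet> x)" by (simp add: eucl_norm_sq[symmetric] power2_eq_square)
    also have "\<dots> \<le> r * (w \<bullet> w)" unfolding ww using consts_nonneg(2) by (intro mult_left_mono) auto
    finally show ?thesis .
  qed
  ultimately have "\<alpha>' * ((mat_inv S *\<^sub>v w) \<bullet> w) + \<beta>' * ((mat_inv S11 *\<^sub>v x) \<bullet> x) \<le>
      \<alpha>' * (r * (w \<bullet> w)) + \<beta>' * (r * (w \<bullet> w))"
    by (intro add_mono mult_left_mono greek'_nonneg)
  then show ?thesis
    unfolding xy(3) P_form[OF xy(1,2,1,2)] by (simp add: algebra_simps)
qed

sublocale certificates: lyapunov_supersolutions "n + n" M X P "\<alpha> * s" "r * (\<alpha>' + \<beta>')"
  by unfold_locales (use nn M hM X_symmetric P X_ineq P_ineq X_le P_le in auto)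

end

section \<open>The polynomial and the final assembly\<close>

lemma nuclear_norm_nonneg:
  assumes "symmetric_mat n X"
  shows "0 \<le> nuclear_norm X"
proof -
  obtain U d where "U \<in> carrier_mat n n" "U\<^sup>T * U = 1\<^sub>m n" "U * U\<^sup>T = 1\<^sub>m n" "X = U * mat_diag n d * U\<^sup>T"
    using symmetric_diagonalization[OF assms] by blast
  from nuclear_norm_diagonalization[OF this] show ?thesis by (simp add: sum_nonneg)
qed

text \<open>The sum of both certificate bounds with all abbreviations expanded, so that it is one
  function of six reals, independent of dimension and filter. The components are taken by nested
  projections because polynomial functions on a product are generated by bounded linear
  functionals.\<close>

definition lyapunov_constant :: "real \<times> real \<times> real \<times> real \<times> real \<times> real \<Rightarrow> real" where
  "lyapunov_constant p =
    (let s = fst p; r = fst (snd p); z = fst (snd (snd p)); w1 = fst (snd (snd (snd p)));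
         w2 = fst (snd (snd (snd (snd p)))); c = snd (snd (snd (snd (snd p))));
         k = r * s * z; D = s\<^sup>2 * w1
     in (w1 + 2 * (2 * D * k\<^sup>2) * D * c\<^sup>2 * w2) * s +
        r * (s\<^sup>2 * (1 + 2 * k\<^sup>2 * s\<^sup>2) * w1 + 2 * s\<^sup>2 * k\<^sup>2 * D))"

lemma lyapunov_constant_polynomial: "real_polynomial_function lyapunov_constant"
proof -
  note c = bounded_linear_compose and f = bounded_linear_fst and g = bounded_linear_snd
  note lin = real_polynomial_function.intros(1)
  \<comment> \<open>The six coordinate functionals, each a composition of \<open>fst\<close> and
    \<open>snd\<close>.\<close>
  note v = lin[OF f] lin[OF c[OF f g]] lin[OF c[OF f c[OF g g]]] lin[OF c[OF f c[OF g c[OF g g]]]]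
    lin[OF c[OF f c[OF g c[OF g c[OF g g]]]]] lin[OF c[OF g c[OF g c[OF g c[OF g g]]]]]
  show ?thesis
    unfolding lyapunov_constant_def Let_def
    by (intro real_polynomial_function.intros(2-4) real_polynomial_function_power v)
qed

context informative_filter
begin

lemma lyapunov_constant_eq: "lyapunov_constant (s, r, z, w1, w2, c) = \<alpha> * s + r * (\<alpha>' + \<beta>')"
  by (simp add: lyapunov_constant_def Let_def \<alpha>_def \<beta>_def \<alpha>'_def \<beta>'_def k_def D_def)

text \<open>One constant has to serve all three norms. The operator norm uses only the summand from
  \<open>X\<close>, the nuclear norm only that from \<open>P\<close>, and in each case the other
  summand is nonnegative.\<close>

lemma lyapunov_norm_bounds:
  assumes Y: "symmetric_mat (n + n) Y" and Sol: "is_lyap_sol M Y Sol"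
    and nrm: "nrm \<in> {op_norm, frobenius_norm, nuclear_norm}"
  shows "nrm Sol \<le> lyapunov_constant (s, r, z, w1, w2, c) * nrm Y"
proof -
  have Yc: "Y \<in> carrier_mat (n + n) (n + n)" using Y unfolding symmetric_mat_def by simp
  note ab = certificates.a_nonneg certificates.b_nonneg
  consider "nrm = op_norm" | "nrm = frobenius_norm" | "nrm = nuclear_norm" using nrm by auto
  then show ?thesis
  proof cases
    case 1
    have "0 \<le> r * (\<alpha>' + \<beta>') * op_norm Y" using ab(2) op_norm_nonneg[OF Yc nn] by simp
    then show ?thesis
      unfolding 1 lyapunov_constant_eq using certificates.op_norm_lyap[OF Y Sol] by (simp add: distrib_right)
  next
    case 2
    show ?thesis unfolding 2 lyapunov_constant_eq by (rule certificates.frobenius_norm_lyap[OF Y Sol])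
  next
    case 3
    have "0 \<le> \<alpha> * s * nuclear_norm Y" using ab(1) nuclear_norm_nonneg[OF Y] by simp
    then show ?thesis
      unfolding 3 lyapunov_constant_eq using certificates.nuclear_norm_lyap[OF Y Sol] by (simp add: distrib_right)
  qed
qed

end

lemma lyap_sol_is_sol:
  assumes "M \<in> carrier_mat n n" "hurwitz M" "Y \<in> carrier_mat n n"
  shows "is_lyap_sol M Y (lyap_sol M Y)"
  unfolding lyap_sol_def by (rule theI'[OF lyap_sol_ex1[OF assms]])

text \<open>Full rank of the square block \<open>S12\<close> means nonzero determinant, which
  supplies the inverse required by \<open>informative_filter\<close>.\<close>

lemma K_info_informative_filter:
  assumes n: "n \<ge> 1" and m: "m \<ge> 1" and st: "standing_assumptions n m A C W1 W2"
    and K: "(AK, BK, CK) \<in> K_info n m p A C W1 W2"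
  obtains S11 J where
    "informative_filter n m A C AK BK W1 W2 S11 (Sigma12_K n A C W1 W2 (AK, BK, CK))
       (Sigma22_K n A C W1 W2 (AK, BK, CK)) J"
    "Sigma_K n A C W1 W2 (AK, BK, CK) = four_block_mat S11 (Sigma12_K n A C W1 W2 (AK, BK, CK))
       (Sigma12_K n A C W1 W2 (AK, BK, CK))\<^sup>T (Sigma22_K n A C W1 W2 (AK, BK, CK))"
proof -
  let ?K = "(AK, BK, CK)"
  define Sg where "Sg = Sigma_K n A C W1 W2 ?K"
  define S12 where "S12 = Sigma12_K n A C W1 W2 ?K"
  define S22 where "S22 = Sigma22_K n A C W1 W2 ?K"
  define S11 where "S11 = mat n n (\<lambda>(i, j). Sg $$ (i, j))"
  have A: "A \<in> carrier_mat n n" and C: "C \<in> carrier_mat m n" and hA: "hurwitz A"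
    and W1: "pos_def n W1" and W2: "pos_def m W2"
    using st unfolding standing_assumptions_def by auto
  have AK: "AK \<in> carrier_mat n n" and BK: "BK \<in> carrier_mat n m" and hAK: "hurwitz AK"
    and rk: "vec_space.rank n S12 = n"
    using K unfolding K_info_def K_stab_def S12_def by auto
  have S12: "S12 \<in> carrier_mat n n" and S22: "S22 \<in> carrier_mat n n" and S11: "S11 \<in> carrier_mat n n"
    unfolding S12_def S22_def S11_def Sigma12_K_def Sigma22_K_def by auto
  let ?M = "four_block_mat A (0\<^sub>m n n) (BK * C) AK"
  let ?W = "four_block_mat W1 (0\<^sub>m n n) (0\<^sub>m n n) (BK * W2 * BK\<^sup>T)"
  have M: "?M \<in> carrier_mat (n + n) (n + n)" using A AK by simp
  have hM: "hurwitz ?M"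
    by (rule hurwitz_four_block_lower[OF A mult_carrier_mat[OF BK C] AK hA hAK])
  have Wsym: "symmetric_mat (n + n) ?W"
    by (intro symmetric_block_diagonal symmetric_congruence[OF _ BK])
      (use W1 W2 in \<open>auto simp: pos_def_def\<close>)
  then have W: "?W \<in> carrier_mat (n + n) (n + n)" unfolding symmetric_mat_def by simp
  have sol: "is_lyap_sol ?M ?W Sg"
    using lyap_sol_is_sol[OF M hM W] unfolding Sg_def Sigma_K_def A_cl_def W_cl_def by simp
  have Sg: "Sg \<in> carrier_mat (n + n) (n + n)" "Sg\<^sup>T = Sg"
    using lyap_sol_symmetric[OF M hM Wsym sol] unfolding symmetric_mat_def by auto
  \<comment> \<open>Only the upper right block is extracted as \<open>Sigma12_K\<close>; symmetry of
    the solution identifies the lower left block with its transpose.\<close>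
  have swap: "Sg $$ (i, j) = Sg $$ (j, i)" if "i < n + n" "j < n + n" for i j
    using that Sg by (metis carrier_matD index_transpose_mat(1))
  have blocks: "Sg = four_block_mat S11 S12 S12\<^sup>T S22"
  proof (rule eq_matI)
    fix i j assume "i < dim_row (four_block_mat S11 S12 S12\<^sup>T S22)"
      "j < dim_col (four_block_mat S11 S12 S12\<^sup>T S22)"
    then have ij: "i < n + n" "j < n + n" using S11 S22 by auto
    show "Sg $$ (i, j) = four_block_mat S11 S12 S12\<^sup>T S22 $$ (i, j)"
    proof (cases "i < n")
      case True
      then show ?thesis using ij
        by (auto simp: S11_def S12_def S22_def Sigma12_K_def Sigma22_K_def Sg_def[symmetric])
    next
      case False
      then show ?thesis using ij swap[OF ij]
        by (auto simp: S11_def S12_def S22_def Sigma12_K_def Sigma22_K_def Sg_def[symmetric])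
    qed
  qed (use Sg S11 S22 in auto)
  have "det S12 \<noteq> 0" using rk vec_space.det_rank_iff[OF S12] by simp
  then have "v = 0\<^sub>v n" if "v \<in> carrier_vec n" "S12 *\<^sub>v v = 0\<^sub>v n" for v
    using that det_0_iff_vec_prod_zero_field[OF S12] by blast
  then obtain J where J: "J \<in> carrier_mat n n" "S12 * J = 1\<^sub>m n" "J * S12 = 1\<^sub>m n"
    using invertible_mat_cases[OF S12] by blast
  have "informative_filter n m A C AK BK W1 W2 S11 S12 S22 J"
    by unfold_locales
      (use n m A C AK BK hA hAK W1 W2 S11 S12 S22 J sol[unfolded blocks] in auto)
  then show ?thesis using that blocks unfolding Sg_def S12_def S22_def by blast
qed

theorem proposition6p2:
  shows "\<exists>q :: real \<times> real \<times> real \<times> real \<times> real \<times> real \<Rightarrow> real.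
    real_polynomial_function q \<and>
    (\<forall>n \<ge> 1. \<forall>m \<ge> 1. \<forall>p \<ge> 1. \<forall>A C (G :: real mat) W1 W2.
       G \<in> carrier_mat p n \<longrightarrow> standing_assumptions n m A C W1 W2 \<longrightarrow>
       (\<exists>C_lyap :: filt \<Rightarrow> real. \<forall>K \<in> K_info n m p A C W1 W2.
          C_lyap K \<le> q (op_norm (Sigma_K n A C W1 W2 K),
                         op_norm (mat_inv (Sigma_K n A C W1 W2 K)),
                         op_norm (mat_inv (Z_K n A C W1 W2 K)),
                         op_norm (mat_inv W1),
                         op_norm (mat_inv W2),
                         op_norm C) \<and>
          (\<forall>Y. symmetric_mat (2 * n) Y \<longrightarrow>
             (\<exists>!S. is_lyap_sol (A_cl n A C K) Y S) \<and>
             (\<forall>nrm \<in> {op_norm, frobenius_norm, nuclear_norm}.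
                nrm (lyap_sol (A_cl n A C K) Y) \<le> C_lyap K * nrm Y))))"
proof (intro exI conjI allI impI)
  show "real_polynomial_function lyapunov_constant" by (rule lyapunov_constant_polynomial)
next
  fix n m p :: nat and A C G W1 W2 :: "real mat"
  assume n: "1 \<le> n" and m: "1 \<le> m" and st: "standing_assumptions n m A C W1 W2"
  \<comment> \<open>The polynomial evaluated at the filter is itself taken as \<open>C_lyap\<close>,
    so the first conjunct holds by reflexivity.\<close>
  let ?q = "\<lambda>K. lyapunov_constant (op_norm (Sigma_K n A C W1 W2 K),
    op_norm (mat_inv (Sigma_K n A C W1 W2 K)), op_norm (mat_inv (Z_K n A C W1 W2 K)),
    op_norm (mat_inv W1), op_norm (mat_inv W2), op_norm C)"
  show "\<forall>K \<in> K_info n m p A C W1 W2. ?q K \<le> ?q K \<and>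
      (\<forall>Y. symmetric_mat (2 * n) Y \<longrightarrow> (\<exists>!S. is_lyap_sol (A_cl n A C K) Y S) \<and>
        (\<forall>nrm \<in> {op_norm, frobenius_norm, nuclear_norm}.
          nrm (lyap_sol (A_cl n A C K) Y) \<le> ?q K * nrm Y))"
  proof (intro ballI conjI allI impI order_refl)
    fix K Y assume K: "K \<in> K_info n m p A C W1 W2" and "symmetric_mat (2 * n) Y"
    then have Y: "symmetric_mat (n + n) Y" by (simp add: mult_2)
    then have Yc: "Y \<in> carrier_mat (n + n) (n + n)" unfolding symmetric_mat_def by simp
    obtain AK BK CK where Keq: "K = (AK, BK, CK)" by (cases K)
    obtain S11 J where F: "informative_filter n m A C AK BK W1 W2 S11 (Sigma12_K n A C W1 W2 K)
        (Sigma22_K n A C W1 W2 K) J"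
      and Sg: "Sigma_K n A C W1 W2 K = four_block_mat S11 (Sigma12_K n A C W1 W2 K)
        (Sigma12_K n A C W1 W2 K)\<^sup>T (Sigma22_K n A C W1 W2 K)"
      using K_info_informative_filter[OF n m st K[unfolded Keq]] unfolding Keq by blast
    interpret F: informative_filter n m A C AK BK W1 W2 S11 "Sigma12_K n A C W1 W2 K"
        "Sigma22_K n A C W1 W2 K" J by (rule F)
    have M: "F.M = A_cl n A C K" unfolding F.M_def A_cl_def Keq by simp
    have q: "lyapunov_constant (F.s, F.r, F.z, F.w1, F.w2, F.c) = ?q K"
      unfolding F.s_def F.r_def F.z_def F.w1_def F.w2_def F.c_def F.S_def Sg[symmetric] Z_K_def ..
    show "\<exists>!S. is_lyap_sol (A_cl n A C K) Y S"
      using lyap_sol_ex1[OF F.M F.hM Yc] unfolding M .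
    fix nrm assume "nrm \<in> {op_norm, frobenius_norm, nuclear_norm}"
    from F.lyapunov_norm_bounds[OF Y lyap_sol_is_sol[OF F.M F.hM Yc] this]
    show "nrm (lyap_sol (A_cl n A C K) Y) \<le> ?q K * nrm Y" unfolding q M .
  qed
qed

end
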